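(* Let $(\Gamma,\mathrm d)$ be a finite dimensional bicovariant first order differential calculus over a Hopf algebra $A$ over a field $k$. If there exists a biinvariant element $\theta\in\Gamma_{\rm inv}$ such that $\mathrm d(a)=a\theta-\theta a$ for all $a\in A$, then $$U(\mathfrak g_\Gamma)\simeq(\Gamma_R^{\wedge,quad})^!,$$ i.e. $U(\mathfrak g_\Gamma)$ is isomorphic (as an algebra) to the quadratic dual of $\Gamma_R^{\wedge,quad}$.
   Context: A bicovariant FODC over $A$ is a Hopf bimodule $\Gamma$ (an $A$-bimodule and bicomodule with coactions $\Delta_L:\Gamma\to A\otimes\Gamma$, $\Delta_R:\Gamma\to\Gamma\otimes A$ compatible with both actions) with a derivation $\mathrm d:A\to\Gamma$ that is a bicomodule map and such that $a\otimes b\mapsto a\,\mathrm db$ is surjective onto $\Gamma$. $\Gamma_R=\{\eta\in\Gamma:\Delta_R\eta=\eta\otimes1\}$; finite dimensional means $\dim_k\Gamma_R<\infty$; $\Gamma_{\rm inv}=\{\eta\in\Gamma:\Delta_L\eta=1\otimes\eta,\ \Delta_R\eta=\eta\otimes1\}$. $\omega_R(a)=\mathrm d(a_{(1)})S(a_{(2)})\in\Gamma_R$, and $\mathcal I_\Gamma=\ker\omega_R\cap\ker\varepsilon_A$. $\Gamma_R$ is a left crossed $A$-module with action $a\triangleright\eta=a_{(1)}\eta S(a_{(2)})$ and coaction $\eta\mapsto\eta^{(-1)}\otimes\eta^{(0)}=\Delta_L(\eta)$; its crossed module braiding is $\sigma^t(v\otimes w)=v^{(-1)}\triangleright w\otimes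 v^{(0)}$. Tangent space: $\mathfrak g_\Gamma=\{x\in A^*:x(\mathcal I_\Gamma)=0,\ x(1)=0\}\subset A^\circ$, identified with $(\Gamma_R)^*$ by $(\omega_R(a),x)=x(a)$. On $A^\circ$ put $[X,Y]=X_{(1)}YS(X_{(2)})$; for $x,y\in\mathfrak g_\Gamma$ let $\sigma(x\otimes y)=[x_{(1)},y]\otimes x_{(2)}-[x,y]\otimes1_{A^\circ}\in\mathfrak g_\Gamma\otimes\mathfrak g_\Gamma$; then $\sigma^t$ is the transpose of $\sigma$ for the pairing $(a\otimes b,x\otimes y)=(a,x)(b,y)$. $U(\mathfrak g_\Gamma)=T(\mathfrak g_\Gamma)/\langle x\otimes y-\sigma(x\otimes y)-[x,y]\;:\;x,y\in\mathfrak g_\Gamma\rangle$. $\Gamma_R^{\wedge,quad}=T(\Gamma_R)/\langle\ker(\mathrm{id}^{\otimes2}-\sigma^t)\rangle$. The quadratic dual of $T(V)/\langle W\rangle$, $W\subset V\otimes V$, $\dim V<\infty$, is $T(V^* )/\langle W^\perp\rangle$, with $W^\perp\subset V^*\otimes V^*$ the annihilator of $W$ for the pairing $(v\otimes w,x\otimes y)=(v,x)(w,y)$ between $V\otimes V$ and $V^*\otimes V^*$ ($v,w\in V$, $x,y\in V^*$). *)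

theory Defs
  imports
    Complex_Main
    "HOL-Library.Poly_Mapping"
    "HOL-Library.Function_Algebras"
    "HOL-Algebra.QuotRing"
    "HOL-Algebra.Module"
begin

section \<open>Formal linear combinations\<close>

abbreviation gen :: "'x \<Rightarrow> ('x \<Rightarrow>\<^sub>0 'k::field)"
  where "gen x \<equiv> Poly_Mapping.single x 1"

definition formal_scale :: "'k::field \<Rightarrow> ('x \<Rightarrow>\<^sub>0 'k) \<Rightarrow> ('x \<Rightarrow>\<^sub>0 'k)"
  where "formal_scale c p = Poly_Mapping.map ((*) c) p"

definition fun_scale :: "'k::field \<Rightarrow> ('x \<Rightarrow> 'k) \<Rightarrow> ('x \<Rightarrow> 'k)"
  where "fun_scale c f = (\<lambda>x. c * f x)"

text \<open>The linear extension of a function on basis elements to formal linear combinations.\<close>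

definition lin_ext :: "('k::field \<Rightarrow> 'v \<Rightarrow> 'v) \<Rightarrow> ('x \<Rightarrow> 'v::ab_group_add) \<Rightarrow> ('x \<Rightarrow>\<^sub>0 'k) \<Rightarrow> 'v"
  where "lin_ext s f t = (\<Sum>x\<in>Poly_Mapping.keys t. s (Poly_Mapping.lookup t x) (f x))"

abbreviation formal_ext :: "('x \<Rightarrow> ('y \<Rightarrow>\<^sub>0 'k)) \<Rightarrow> ('x \<Rightarrow>\<^sub>0 'k::field) \<Rightarrow> ('y \<Rightarrow>\<^sub>0 'k)"
  where "formal_ext \<equiv> lin_ext formal_scale"

lemma lookup_formal_scale [simp]:
  "Poly_Mapping.lookup (formal_scale c p) x = c * Poly_Mapping.lookup p x"
  by (simp add: formal_scale_def Poly_Mapping.map.rep_eq when_def)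

lemma vector_space_formal_scale: "vector_space (formal_scale :: 'k::field \<Rightarrow> ('x \<Rightarrow>\<^sub>0 'k) \<Rightarrow> _)"
  by unfold_locales
    (auto intro!: poly_mapping_eqI simp: lookup_add algebra_simps)

lemma vector_space_fun_scale: "vector_space (fun_scale :: 'k::field \<Rightarrow> ('x \<Rightarrow> 'k) \<Rightarrow> _)"
  by unfold_locales (auto simp: fun_scale_def fun_eq_iff algebra_simps)

lemma lin_ext_superset:
  assumes "vector_space s" "finite A" "Poly_Mapping.keys t \<subseteq> A"
  shows "lin_ext s f t = (\<Sum>x\<in>A. s (Poly_Mapping.lookup t x) (f x))"
proof -
  interpret vector_space s by fact
  show ?thesis unfolding lin_ext_def
    by (rule sum.mono_neutral_left) (use assms in \<open>auto simp: in_keys_iff\<close>)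
qed

lemma lin_ext_add:
  assumes "vector_space s"
  shows "lin_ext s f (p + q) = lin_ext s f p + lin_ext s f q"
proof -
  interpret vector_space s by fact
  let ?A = "Poly_Mapping.keys p \<union> Poly_Mapping.keys q"
  have "Poly_Mapping.keys (p + q) \<subseteq> ?A" by (rule Poly_Mapping.keys_add)
  then show ?thesis
    using lin_ext_superset[OF assms, of ?A p f] lin_ext_superset[OF assms, of ?A q f]
      lin_ext_superset[OF assms, of ?A "p + q" f]
    by (simp add: lookup_add scale_left_distrib sum.distrib)
qed

lemma lin_ext_gen: "vector_space s \<Longrightarrow> lin_ext s f (gen x) = f x"
  using vector_space.vector_space_assms(4)[of s]
  by (simp add: lin_ext_def)

lemma lin_ext_scale:
  assumes "vector_space s"
  shows "lin_ext s f (formal_scale c p) = s c (lin_ext s f p)"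
proof -
  interpret vector_space s by fact
  have "Poly_Mapping.keys (formal_scale c p) \<subseteq> Poly_Mapping.keys p" by (auto simp: in_keys_iff)
  then show ?thesis
    using lin_ext_superset[OF assms, of "Poly_Mapping.keys p" "formal_scale c p" f]
    by (simp add: lin_ext_def scale_sum_right)
qed

lemma formal_induct [case_names add scale gen]:
  fixes p :: "'x \<Rightarrow>\<^sub>0 'k::field"
  assumes add: "\<And>p q. P p \<Longrightarrow> P q \<Longrightarrow> P (p + q)" 
    and scale: "\<And>c p. P p \<Longrightarrow> P (formal_scale c p)" and gen: "\<And>x. P (gen x)"
  shows "P p"
proof -
  have sg: "P (Poly_Mapping.single x c)" for x c
  proof -
    have "Poly_Mapping.single x c = formal_scale c (gen x)"
      by (rule poly_mapping_eqI) (simp add: lookup_single when_def)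
    then show ?thesis using gen scale by metis
  qed
  have "P (\<Sum>x\<in>A. Poly_Mapping.single x (Poly_Mapping.lookup p x))" if "finite A" for A
    using that
  proof (induction A)
    case empty
    have "formal_scale 0 (gen undefined) = (0 :: 'x \<Rightarrow>\<^sub>0 'k)" by (rule poly_mapping_eqI) simp
    then show ?case using scale[OF gen] by (metis sum.empty)
  qed (auto intro: add sg)
  moreover have "p = (\<Sum>x\<in>Poly_Mapping.keys p. Poly_Mapping.single x (Poly_Mapping.lookup p x))"
    by (rule poly_mapping_eqI) (simp add: lookup_sum lookup_single when_def sum.delta in_keys_iff)
  ultimately show ?thesis by (metis finite_keys)
qed

lemma keys_formal_ext:
  assumes "\<And>x. x \<in> Poly_Mapping.keys p \<Longrightarrow> Poly_Mapping.keys (f x) \<subseteq> A"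
  shows "Poly_Mapping.keys (formal_ext f p) \<subseteq> A"
proof -
  have "Poly_Mapping.keys (formal_scale c q) \<subseteq> Poly_Mapping.keys q" for c :: 'b and q :: "'c \<Rightarrow>\<^sub>0 'b"
    by (auto simp: in_keys_iff)
  then show ?thesis
    using assms unfolding lin_ext_def
    by (intro order.trans[OF keys_sum]) blast
qed

lemma lin_ext_addf:
  assumes "vector_space s"
  shows "lin_ext s (\<lambda>x. f x + g x) p = lin_ext s f p + lin_ext s g p"
proof -
  interpret vector_space s by fact
  show ?thesis by (simp add: lin_ext_def scale_right_distrib sum.distrib)
qed

lemma lin_ext_scalef:
  assumes "vector_space s"
  shows "lin_ext s (\<lambda>x. s c (f x)) p = s c (lin_ext s f p)"
proof -
  interpret vector_space s by fact
  show ?thesis by (simp add: lin_ext_def scale_sum_right mult.commute)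
qed

lemmas formal_ext_simps = lin_ext_add[OF vector_space_formal_scale] lin_ext_scale[OF vector_space_formal_scale] lin_ext_gen[OF vector_space_formal_scale]
 lin_ext_addf[OF vector_space_formal_scale] lin_ext_scalef[OF vector_space_formal_scale]


section \<open>Tensor products\<close>

text \<open>
  Let \<open>V\<close>, \<open>W\<close> be subspaces of vector spaces with scalar multiplications \<open>s\<close>, \<open>t\<close>.
  The tensor product of \<open>V\<close> and \<open>W\<close> is the space of formal linear combinations of elements
  of \<open>V \<times> W\<close> (those \<open>x\<close> with \<open>keys x \<subseteq> V \<times> W\<close>) modulo the span of the bilinearity relations.
  The scalar multiplication is an argument rather than part of the type, so there is no type
  of tensors: a tensor is given by a formal representative, and an equation between tensors is
  \<open>tensor_eq\<close>. In particular a linear map into a tensor product is given by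
  a choice of representatives, and is required to be linear up to \<open>tensor_eq\<close>.
\<close>

definition tensor_relations ::
  "('k::field \<Rightarrow> 'v \<Rightarrow> 'v) \<Rightarrow> 'v::ab_group_add set \<Rightarrow> ('k \<Rightarrow> 'w \<Rightarrow> 'w) \<Rightarrow> 'w::ab_group_add set
    \<Rightarrow> ('v \<times> 'w \<Rightarrow>\<^sub>0 'k) set"
  where "tensor_relations s V t W =
     {gen (v + v', w) - gen (v, w) - gen (v', w) | v v' w. v \<in> V \<and> v' \<in> V \<and> w \<in> W}
   \<union> {gen (v, w + w') - gen (v, w) - gen (v, w') | v w w'. v \<in> V \<and> w \<in> W \<and> w' \<in> W}
   \<union> {gen (s c v, w) - formal_scale c (gen (v, w)) | c v w. v \<in> V \<and> w \<in> W}
   \<union> {gen (v, t c w) - formal_scale c (gen (v, w)) | c v w. v \<in> V \<and> w \<in> W}"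

definition tensor_eq ::
  "('k::field \<Rightarrow> 'v \<Rightarrow> 'v) \<Rightarrow> 'v::ab_group_add set \<Rightarrow> ('k \<Rightarrow> 'w \<Rightarrow> 'w) \<Rightarrow> 'w::ab_group_add set
    \<Rightarrow> ('v \<times> 'w \<Rightarrow>\<^sub>0 'k) \<Rightarrow> ('v \<times> 'w \<Rightarrow>\<^sub>0 'k) \<Rightarrow> bool"
  where "tensor_eq s V t W x y \<longleftrightarrow> x - y \<in> module.span formal_scale (tensor_relations s V t W)"

text \<open>
  For subspaces \<open>V' \<subseteq> V\<close> and \<open>W' \<subseteq> W\<close> the canonical map from the tensor product of \<open>V'\<close> and \<open>W'\<close>
  to that of \<open>V\<close> and \<open>W\<close> is injective (we work over a field). The following is the preimage
  of a tensor under this map; it is only meaningful for tensors in the image.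
\<close>

definition tensor_restrict ::
  "('k::field \<Rightarrow> 'v \<Rightarrow> 'v) \<Rightarrow> 'v::ab_group_add set \<Rightarrow> 'v set
    \<Rightarrow> ('k \<Rightarrow> 'w \<Rightarrow> 'w) \<Rightarrow> 'w::ab_group_add set \<Rightarrow> 'w set
    \<Rightarrow> ('v \<times> 'w \<Rightarrow>\<^sub>0 'k) \<Rightarrow> ('v \<times> 'w \<Rightarrow>\<^sub>0 'k)"
  where "tensor_restrict s V V' t W W' x =
    (SOME y. Poly_Mapping.keys y \<subseteq> V' \<times> W' \<and> tensor_eq s V t W y x)"

text \<open>Threefold tensor products are only needed for full spaces.\<close>

definition tensor3_relations ::
  "('k::field \<Rightarrow> 'u \<Rightarrow> 'u::ab_group_add) \<Rightarrow> ('k \<Rightarrow> 'v \<Rightarrow> 'v::ab_group_add)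
    \<Rightarrow> ('k \<Rightarrow> 'w \<Rightarrow> 'w::ab_group_add) \<Rightarrow> ('u \<times> 'v \<times> 'w \<Rightarrow>\<^sub>0 'k) set"
  where "tensor3_relations r s t =
     {gen (u + u', v, w) - gen (u, v, w) - gen (u', v, w) | u u' v w. True}
   \<union> {gen (u, v + v', w) - gen (u, v, w) - gen (u, v', w) | u v v' w. True}
   \<union> {gen (u, v, w + w') - gen (u, v, w) - gen (u, v, w') | u v w w'. True}
   \<union> {gen (r c u, v, w) - formal_scale c (gen (u, v, w)) | c u v w. True}
   \<union> {gen (u, s c v, w) - formal_scale c (gen (u, v, w)) | c u v w. True}
   \<union> {gen (u, v, t c w) - formal_scale c (gen (u, v, w)) | c u v w. True}"

definition tensor3_eq ::
  "('k::field \<Rightarrow> 'u \<Rightarrow> 'u::ab_group_add) \<Rightarrow> ('k \<Rightarrow> 'v \<Rightarrow> 'v::ab_group_add)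
    \<Rightarrow> ('k \<Rightarrow> 'w \<Rightarrow> 'w::ab_group_add) \<Rightarrow> ('u \<times> 'v \<times> 'w \<Rightarrow>\<^sub>0 'k) \<Rightarrow> ('u \<times> 'v \<times> 'w \<Rightarrow>\<^sub>0 'k) \<Rightarrow> bool"
  where "tensor3_eq r s t x y \<longleftrightarrow> x - y \<in> module.span formal_scale (tensor3_relations r s t)"


section \<open>Dual spaces\<close>

text \<open>Linear functionals on a subspace \<open>V\<close>, made unique as functions by the value \<open>0\<close> outside \<open>V\<close>.\<close>

definition dual_space :: "('k::field \<Rightarrow> 'v \<Rightarrow> 'v) \<Rightarrow> 'v::ab_group_add set \<Rightarrow> ('v \<Rightarrow> 'k) set"
  where "dual_space s V = {f. (\<forall>v\<in>V. \<forall>w\<in>V. f (v + w) = f v + f w)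
                            \<and> (\<forall>c. \<forall>v\<in>V. f (s c v) = c * f v)
                            \<and> (\<forall>v. v \<notin> V \<longrightarrow> f v = 0)}"

definition pairing2 :: "('v \<times> 'v \<Rightarrow>\<^sub>0 'k::field) \<Rightarrow> (('v \<Rightarrow> 'k) \<times> ('v \<Rightarrow> 'k) \<Rightarrow>\<^sub>0 'k) \<Rightarrow> 'k"
  where "pairing2 t f = lin_ext (*) (\<lambda>(v, w). lin_ext (*) (\<lambda>(x, y). x v * y w) f) t"


section \<open>Algebras and quadratic algebras\<close>

text \<open>An algebra over the field is a \<open>module\<close> record of HOL-Algebra: a ring with \<open>smult\<close>.\<close>

definition quot_alg :: "('k, 'b) module \<Rightarrow> 'b set \<Rightarrow> ('k, 'b set) module"
  where "quot_alg B I = ring.extend (B Quot I)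
     (module.fields (\<lambda>c X. \<Union>x\<in>X. I +>\<^bsub>B\<^esub> (c \<odot>\<^bsub>B\<^esub> x)))"

definition alg_isomorphic :: "('k, 'b) module \<Rightarrow> ('k, 'c) module \<Rightarrow> bool"  (infix \<open>\<simeq>\<^sub>a\<^sub>l\<^sub>g\<close> 50)
  where "B \<simeq>\<^sub>a\<^sub>l\<^sub>g C \<longleftrightarrow>
    (\<exists>h \<in> ring_iso B C. \<forall>c. \<forall>x \<in> carrier B. h (c \<odot>\<^bsub>B\<^esub> x) = c \<odot>\<^bsub>C\<^esub> h x)"

text \<open>The free associative algebra on the set \<open>V\<close>: linear combinations of words in \<open>V\<close>.\<close>

definition free_alg :: "'v set \<Rightarrow> ('k::field, 'v list \<Rightarrow>\<^sub>0 'k) module"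
  where "free_alg V =
    \<lparr>carrier = {p. Poly_Mapping.keys p \<subseteq> lists V},
     mult = (\<lambda>p q. formal_ext (\<lambda>u. formal_ext (\<lambda>w. gen (u @ w)) q) p),
     one = gen [],
     zero = 0,
     add = (+),
     smult = formal_scale\<rparr>"

definition linearity_relations ::
  "('k::field \<Rightarrow> 'v \<Rightarrow> 'v) \<Rightarrow> 'v::ab_group_add set \<Rightarrow> ('v list \<Rightarrow>\<^sub>0 'k) set"
  where "linearity_relations s V =
     {gen [v + w] - gen [v] - gen [w] | v w. v \<in> V \<and> w \<in> V}
   \<union> {gen [s c v] - formal_scale c (gen [v]) | c v. v \<in> V}"

definition linearity_ideal ::
  "('k::field \<Rightarrow> 'v \<Rightarrow> 'v) \<Rightarrow> 'v::ab_group_add set \<Rightarrow> ('v list \<Rightarrow>\<^sub>0 'k) set"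
  where "linearity_ideal s V = Idl\<^bsub>free_alg V\<^esub> (linearity_relations s V)"

text \<open>
  The ideal is the span of the multilinearity relations between words of equal length, so the
  quotient is the direct sum of the tensor powers of \<open>V\<close>; a word \<open>[v\<^sub>1, \<dots>, v\<^sub>n]\<close> represents
  the tensor product of \<open>v\<^sub>1, \<dots>, v\<^sub>n\<close>.
\<close>

definition tensor_algebra ::
  "('k::field \<Rightarrow> 'v \<Rightarrow> 'v) \<Rightarrow> 'v::ab_group_add set \<Rightarrow> ('k, ('v list \<Rightarrow>\<^sub>0 'k) set) module"
  where "tensor_algebra s V = quot_alg (free_alg V) (linearity_ideal s V)"

text \<open>
  The rings are rings in the sense of HOL-Algebra, so the ideals generated in them are the usual
  two-sided ideals (\<open>Idl\<close> is only meaningful for a subset of the carrier of a ring).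
\<close>

lemma mult_assoc_free:
  fixes p q r :: "'v list \<Rightarrow>\<^sub>0 'k::field"
  defines "m \<equiv> (\<lambda>p q :: 'v list \<Rightarrow>\<^sub>0 'k. formal_ext (\<lambda>u. formal_ext (\<lambda>w. gen (u @ w)) q) p)"
  shows "m (m p q) r = m p (m q r)"
  unfolding m_def
proof (induction p rule: formal_induct)
  case (gen x)
  show ?case
    unfolding formal_ext_simps
  proof (induction q rule: formal_induct)
    case (gen y) show ?case unfolding formal_ext_simps
      by (induction r rule: formal_induct) (simp_all add: formal_ext_simps)
  qed (simp_all add: formal_ext_simps)
qed (simp_all add: formal_ext_simps)

lemma gen_id: "formal_ext gen p = p"
  by (induction p rule: formal_induct) (simp_all add: formal_ext_simps)

lemma ring_free_alg: "ring (free_alg V :: ('k::field, 'v list \<Rightarrow>\<^sub>0 'k) module)"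
proof -
  let ?F = "free_alg V :: ('k, 'v list \<Rightarrow>\<^sub>0 'k) module"
  have neg: "\<exists>y\<in>carrier ?F. y + x = 0" if "x \<in> carrier ?F" for x
    using that by (intro bexI[of _ "- x"]) (auto simp: free_alg_def in_keys_iff)
  have ab: "abelian_group ?F"
  proof (rule abelian_groupI)
    fix p q assume "p \<in> carrier ?F" "q \<in> carrier ?F"
    then show "p \<oplus>\<^bsub>?F\<^esub> q \<in> carrier ?F"
      using Poly_Mapping.keys_add[of p q] unfolding free_alg_def by simp blast
  qed (use neg in \<open>simp_all add: free_alg_def add_ac\<close>)
  have mon: "monoid ?F"
  proof (rule monoidI)
    fix p q assume "p \<in> carrier ?F" "q \<in> carrier ?F"
    then have "Poly_Mapping.keys p \<subseteq> lists V" "Poly_Mapping.keys q \<subseteq> lists V"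
      by (simp_all add: free_alg_def)
    then have "Poly_Mapping.keys (formal_ext (\<lambda>u. formal_ext (\<lambda>w. gen (u @ w)) q) p) \<subseteq> lists V"
      by (intro keys_formal_ext) auto
    then show "p \<otimes>\<^bsub>?F\<^esub> q \<in> carrier ?F"
      by (simp add: free_alg_def)
  next
    fix p q r assume "p \<in> carrier ?F" "q \<in> carrier ?F" "r \<in> carrier ?F"
    show "p \<otimes>\<^bsub>?F\<^esub> q \<otimes>\<^bsub>?F\<^esub> r = p \<otimes>\<^bsub>?F\<^esub> (q \<otimes>\<^bsub>?F\<^esub> r)"
      unfolding free_alg_def by (simp, rule mult_assoc_free)
  qed (simp_all add: free_alg_def lin_ext_gen[OF vector_space_formal_scale] gen_id)
  show ?thesis
    by (rule ringI[OF ab mon])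
      (simp_all add: free_alg_def lin_ext_add lin_ext_addf vector_space_formal_scale)
qed

lemma ring_quot_alg:
  assumes "ideal I B" shows "ring (quot_alg B I)"
proof -
  interpret Q: ring "B Quot I" using assms by (rule ideal.quotient_is_ring)
  have E: "carrier (quot_alg B I) = carrier (B Quot I)" "mult (quot_alg B I) = mult (B Quot I)"
    "one (quot_alg B I) = one (B Quot I)" "zero (quot_alg B I) = zero (B Quot I)"
    "add (quot_alg B I) = add (B Quot I)"
    by (simp_all add: quot_alg_def ring.defs)
  have "abelian_group (quot_alg B I)"
  proof (rule abelian_groupI)
    fix X assume "X \<in> carrier (quot_alg B I)"
    then show "\<exists>Y\<in>carrier (quot_alg B I). Y \<oplus>\<^bsub>quot_alg B I\<^esub> X = \<zero>\<^bsub>quot_alg B I\<^esub>"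
      unfolding E by (meson Q.l_neg Q.a_inv_closed)
  qed (unfold E, simp_all add: Q.a_ac)
  moreover have "monoid (quot_alg B I)"
    by (rule monoidI; unfold E) (simp_all add: Q.m_assoc)
  ultimately show ?thesis
    by (rule ringI; unfold E) (simp_all add: Q.l_distr Q.r_distr)
qed

lemma linrel_carrier: "linearity_relations s V \<subseteq> carrier (free_alg V)" if "module.subspace s V" "vector_space s"
proof -
  have A: "\<And>v w. v \<in> V \<Longrightarrow> w \<in> V \<Longrightarrow> v + w \<in> V" "\<And>c v. v \<in> V \<Longrightarrow> s c v \<in> V"
    using that by (auto simp: module.subspace_def module_iff_vector_space)
  show ?thesis
    unfolding linearity_relations_def free_alg_def
    by (auto dest!: subsetD[OF keys_diff] simp: A formal_scale_def in_keys_iff lookup_single when_def Poly_Mapping.map.rep_eq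
       split: if_splits)
qed

lemma ring_tensor_algebra:
  assumes "vector_space s" "module.subspace s V"
  shows "ring (tensor_algebra s V)"
  unfolding tensor_algebra_def linearity_ideal_def
  by (intro ring_quot_alg ring.genideal_ideal ring_free_alg linrel_carrier assms)

definition tensor_algebra_quot ::
  "('k::field \<Rightarrow> 'v \<Rightarrow> 'v) \<Rightarrow> 'v::ab_group_add set \<Rightarrow> ('v list \<Rightarrow>\<^sub>0 'k) set
    \<Rightarrow> ('k, ('v list \<Rightarrow>\<^sub>0 'k) set set) module"
  where "tensor_algebra_quot s V R = quot_alg (tensor_algebra s V)
    (Idl\<^bsub>tensor_algebra s V\<^esub> ((\<lambda>p. linearity_ideal s V +>\<^bsub>free_alg V\<^esub> p) ` R))"

definition deg2 :: "('v \<times> 'v \<Rightarrow>\<^sub>0 'k::field) \<Rightarrow> ('v list \<Rightarrow>\<^sub>0 'k)"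
  where "deg2 = formal_ext (\<lambda>(v, w). gen [v, w])"

text \<open>
  The quadratic dual depends on the generators and relations, so it is an operation
  on presentations \<open>(V, W)\<close>, where \<open>W\<close> is given as the set of all representatives, in the sense
  of \<open>tensor_eq\<close>, of elements of a subspace of the tensor square of \<open>V\<close>.
\<close>

record (overloaded) ('k, 'v) quadratic_presentation =
  gen_scale :: "'k::field \<Rightarrow> 'v::ab_group_add \<Rightarrow> 'v"
  gen_space :: "'v set"
  rel_space :: "('v \<times> 'v \<Rightarrow>\<^sub>0 'k) set"

definition quadratic_algebra ::
  "('k::field, 'v::ab_group_add) quadratic_presentation \<Rightarrow> ('k, ('v list \<Rightarrow>\<^sub>0 'k) set set) module"
  where "quadratic_algebra Q =
    tensor_algebra_quot (gen_scale Q) (gen_space Q) (deg2 ` rel_space Q)"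

definition quadratic_dual ::
  "('k::field, 'v::ab_group_add) quadratic_presentation \<Rightarrow> ('k, 'v \<Rightarrow> 'k) quadratic_presentation"
  where "quadratic_dual Q = (let V' = dual_space (gen_scale Q) (gen_space Q) in
    \<lparr>gen_scale = fun_scale,
     gen_space = V',
     rel_space = {f. Poly_Mapping.keys f \<subseteq> V' \<times> V' \<and> (\<forall>t \<in> rel_space Q. pairing2 t f = 0)}\<rparr>)"


section \<open>Hopf algebras\<close>

text \<open>
  The ring structure of the Hopf algebra is the type class structure of \<open>'a\<close>. That \<open>0 \<noteq> 1\<close> in
  \<open>ring_1\<close> is no restriction, since the counit maps \<open>1\<close> to \<open>1\<close>.
\<close>

record (overloaded) ('k, 'a) hopf_data =
  sc :: "'k::field \<Rightarrow> 'a::ring_1 \<Rightarrow> 'a"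
  cop :: "'a \<Rightarrow> ('a \<times> 'a \<Rightarrow>\<^sub>0 'k)"
  cou :: "'a \<Rightarrow> 'k"
  anti :: "'a \<Rightarrow> 'a"

locale hopf_algebra =
  fixes H :: "('k::field, 'a::ring_1) hopf_data"
  assumes sc_vector_space: "vector_space (sc H)"
    and sc_mult_left: "sc H c (a * b) = sc H c a * b"
    and sc_mult_right: "sc H c (a * b) = a * sc H c b"
    and cop_add: "tensor_eq (sc H) UNIV (sc H) UNIV (cop H (a + b)) (cop H a + cop H b)"
    and cop_sc: "tensor_eq (sc H) UNIV (sc H) UNIV (cop H (sc H c a)) (formal_scale c (cop H a))"
    and cop_mult: "tensor_eq (sc H) UNIV (sc H) UNIV (cop H (a * b))
          (formal_ext (\<lambda>(a1, a2). formal_ext (\<lambda>(b1, b2). gen (a1 * b1, a2 * b2)) (cop H b)) (cop H a))"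
    and cop_one: "tensor_eq (sc H) UNIV (sc H) UNIV (cop H 1) (gen (1, 1))"
    and cou_linear: "Vector_Spaces.linear (sc H) (*) (cou H)"
    and cou_mult: "cou H (a * b) = cou H a * cou H b"
    and cou_one: "cou H 1 = 1"
    and coassoc: "tensor3_eq (sc H) (sc H) (sc H)
          (formal_ext (\<lambda>(a1, a2). formal_ext (\<lambda>(p, q). gen (p, q, a2)) (cop H a1)) (cop H a))
          (formal_ext (\<lambda>(a1, a2). formal_ext (\<lambda>(p, q). gen (a1, p, q)) (cop H a2)) (cop H a))"
    and counit_left: "lin_ext (sc H) (\<lambda>(a1, a2). sc H (cou H a1) a2) (cop H a) = a"
    and counit_right: "lin_ext (sc H) (\<lambda>(a1, a2). sc H (cou H a2) a1) (cop H a) = a"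
    and anti_linear: "Vector_Spaces.linear (sc H) (sc H) (anti H)"
    and antipode_left: "lin_ext (sc H) (\<lambda>(a1, a2). anti H a1 * a2) (cop H a) = sc H (cou H a) 1"
    and antipode_right: "lin_ext (sc H) (\<lambda>(a1, a2). a1 * anti H a2) (cop H a) = sc H (cou H a) 1"


section \<open>Bicovariant first order differential calculi\<close>

record (overloaded) ('k, 'a, 'g) fodc_data =
  gsc :: "'k::field \<Rightarrow> 'g::ab_group_add \<Rightarrow> 'g"
  lact :: "'a::ring_1 \<Rightarrow> 'g \<Rightarrow> 'g"
  ract :: "'g \<Rightarrow> 'a \<Rightarrow> 'g"
  lcoact :: "'g \<Rightarrow> ('a \<times> 'g \<Rightarrow>\<^sub>0 'k)"
  rcoact :: "'g \<Rightarrow> ('g \<times> 'a \<Rightarrow>\<^sub>0 'k)"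
  diff :: "'a \<Rightarrow> 'g"

locale bimodule_over = hopf_algebra H
  for H :: "('k::field, 'a::ring_1) hopf_data" +
  fixes G :: "('k, 'a, 'g::ab_group_add) fodc_data"
  assumes gsc_vector_space: "vector_space (gsc G)"
    and lact_add_left: "lact G (a + b) x = lact G a x + lact G b x"
    and lact_add_right: "lact G a (x + y) = lact G a x + lact G a y"
    and lact_sc_left: "lact G (sc H c a) x = gsc G c (lact G a x)"
    and lact_sc_right: "lact G a (gsc G c x) = gsc G c (lact G a x)"
    and lact_one: "lact G 1 x = x"
    and lact_mult: "lact G (a * b) x = lact G a (lact G b x)"
    and ract_add_left: "ract G (x + y) a = ract G x a + ract G y a"
    and ract_add_right: "ract G x (a + b) = ract G x a + ract G x b"
    and ract_sc_left: "ract G (gsc G c x) a = gsc G c (ract G x a)"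
    and ract_sc_right: "ract G x (sc H c a) = gsc G c (ract G x a)"
    and ract_one: "ract G x 1 = x"
    and ract_mult: "ract G x (a * b) = ract G (ract G x a) b"
    and lact_ract: "ract G (lact G a x) b = lact G a (ract G x b)"

locale hopf_bimodule = bimodule_over H G
  for H :: "('k::field, 'a::ring_1) hopf_data" and G :: "('k, 'a, 'g::ab_group_add) fodc_data" +
  assumes lcoact_add: "tensor_eq (sc H) UNIV (gsc G) UNIV (lcoact G (x + y)) (lcoact G x + lcoact G y)"
    and lcoact_gsc: "tensor_eq (sc H) UNIV (gsc G) UNIV
          (lcoact G (gsc G c x)) (formal_scale c (lcoact G x))"
    and lcoact_coassoc: "tensor3_eq (sc H) (sc H) (gsc G)
          (formal_ext (\<lambda>(a, y). formal_ext (\<lambda>(p, q). gen (p, q, y)) (cop H a)) (lcoact G x))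
          (formal_ext (\<lambda>(a, y). formal_ext (\<lambda>(p, z). gen (a, p, z)) (lcoact G y)) (lcoact G x))"
    and lcoact_counit: "lin_ext (gsc G) (\<lambda>(a, y). gsc G (cou H a) y) (lcoact G x) = x"
    and rcoact_add: "tensor_eq (gsc G) UNIV (sc H) UNIV (rcoact G (x + y)) (rcoact G x + rcoact G y)"
    and rcoact_gsc: "tensor_eq (gsc G) UNIV (sc H) UNIV
          (rcoact G (gsc G c x)) (formal_scale c (rcoact G x))"
    and rcoact_coassoc: "tensor3_eq (gsc G) (sc H) (sc H)
          (formal_ext (\<lambda>(y, a). formal_ext (\<lambda>(z, p). gen (z, p, a)) (rcoact G y)) (rcoact G x))
          (formal_ext (\<lambda>(y, a). formal_ext (\<lambda>(p, q). gen (y, p, q)) (cop H a)) (rcoact G x))"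
    and rcoact_counit: "lin_ext (gsc G) (\<lambda>(y, a). gsc G (cou H a) y) (rcoact G x) = x"
    and bicomodule: "tensor3_eq (sc H) (gsc G) (sc H)
          (formal_ext (\<lambda>(y, a). formal_ext (\<lambda>(p, z). gen (p, z, a)) (lcoact G y)) (rcoact G x))
          (formal_ext (\<lambda>(a, y). formal_ext (\<lambda>(z, p). gen (a, z, p)) (rcoact G y)) (lcoact G x))"
    and lcoact_lact: "tensor_eq (sc H) UNIV (gsc G) UNIV (lcoact G (lact G a x))
          (formal_ext (\<lambda>(a1, a2). formal_ext (\<lambda>(p, y). gen (a1 * p, lact G a2 y)) (lcoact G x)) (cop H a))"
    and lcoact_ract: "tensor_eq (sc H) UNIV (gsc G) UNIV (lcoact G (ract G x a))
          (formal_ext (\<lambda>(p, y). formal_ext (\<lambda>(a1, a2). gen (p * a1, ract G y a2)) (cop H a)) (lcoact G x))"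
    and rcoact_lact: "tensor_eq (gsc G) UNIV (sc H) UNIV (rcoact G (lact G a x))
          (formal_ext (\<lambda>(a1, a2). formal_ext (\<lambda>(y, p). gen (lact G a1 y, a2 * p)) (rcoact G x)) (cop H a))"
    and rcoact_ract: "tensor_eq (gsc G) UNIV (sc H) UNIV (rcoact G (ract G x a))
          (formal_ext (\<lambda>(y, p). formal_ext (\<lambda>(a1, a2). gen (ract G y a1, p * a2)) (cop H a)) (rcoact G x))"

locale bicovariant_fodc = hopf_bimodule H G
  for H :: "('k::field, 'a::ring_1) hopf_data" and G :: "('k, 'a, 'g::ab_group_add) fodc_data" +
  assumes diff_linear: "Vector_Spaces.linear (sc H) (gsc G) (diff G)"
    and diff_mult: "diff G (a * b) = ract G (diff G a) b + lact G a (diff G b)"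
    and lcoact_diff: "tensor_eq (sc H) UNIV (gsc G) UNIV (lcoact G (diff G a))
          (formal_ext (\<lambda>(a1, a2). gen (a1, diff G a2)) (cop H a))"
    and rcoact_diff: "tensor_eq (gsc G) UNIV (sc H) UNIV (rcoact G (diff G a))
          (formal_ext (\<lambda>(a1, a2). gen (diff G a1, a2)) (cop H a))"
    and diff_surj: "surj (lin_ext (gsc G) (\<lambda>(a, b). lact G a (diff G b)))"

definition right_inv :: "('k::field, 'a::ring_1) hopf_data \<Rightarrow> ('k, 'a, 'g::ab_group_add) fodc_data \<Rightarrow> 'g set"
  where "right_inv H G = {x. tensor_eq (gsc G) UNIV (sc H) UNIV (rcoact G x) (gen (x, 1))}"

definition bi_inv :: "('k::field, 'a::ring_1) hopf_data \<Rightarrow> ('k, 'a, 'g::ab_group_add) fodc_data \<Rightarrow> 'g set"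
  where "bi_inv H G = {x. tensor_eq (sc H) UNIV (gsc G) UNIV (lcoact G x) (gen (1, x))
                        \<and> tensor_eq (gsc G) UNIV (sc H) UNIV (rcoact G x) (gen (x, 1))}"

definition finite_dim_fodc :: "('k::field, 'a::ring_1) hopf_data \<Rightarrow> ('k, 'a, 'g::ab_group_add) fodc_data \<Rightarrow> bool"
  where "finite_dim_fodc H G \<longleftrightarrow> (\<exists>B. finite B \<and> module.span (gsc G) B = right_inv H G)"

definition omega_R :: "('k::field, 'a::ring_1) hopf_data \<Rightarrow> ('k, 'a, 'g::ab_group_add) fodc_data \<Rightarrow> 'a \<Rightarrow> 'g"
  where "omega_R H G a = lin_ext (gsc G) (\<lambda>(a1, a2). ract G (diff G a1) (anti H a2)) (cop H a)"

definition ideal_of :: "('k::field, 'a::ring_1) hopf_data \<Rightarrow> ('k, 'a, 'g::ab_group_add) fodc_data \<Rightarrow> 'a set"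
  where "ideal_of H G = {a. omega_R H G a = 0 \<and> cou H a = 0}"

subsection \<open>The exterior algebra\<close>

definition crossed_act ::
  "('k::field, 'a::ring_1) hopf_data \<Rightarrow> ('k, 'a, 'g::ab_group_add) fodc_data \<Rightarrow> 'a \<Rightarrow> 'g \<Rightarrow> 'g"
  where "crossed_act H G a x = lin_ext (gsc G) (\<lambda>(a1, a2). ract G (lact G a1 x) (anti H a2)) (cop H a)"

text \<open>The left coaction of a right invariant element, with second legs in the right invariants.\<close>

definition crossed_coact ::
  "('k::field, 'a::ring_1) hopf_data \<Rightarrow> ('k, 'a, 'g::ab_group_add) fodc_data \<Rightarrow> 'g \<Rightarrow> ('a \<times> 'g \<Rightarrow>\<^sub>0 'k)"
  where "crossed_coact H G x =
    tensor_restrict (sc H) UNIV UNIV (gsc G) UNIV (right_inv H G) (lcoact G x)"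

definition sigma_t ::
  "('k::field, 'a::ring_1) hopf_data \<Rightarrow> ('k, 'a, 'g::ab_group_add) fodc_data
    \<Rightarrow> ('g \<times> 'g \<Rightarrow>\<^sub>0 'k) \<Rightarrow> ('g \<times> 'g \<Rightarrow>\<^sub>0 'k)"
  where "sigma_t H G = formal_ext (\<lambda>(v, w).
    formal_ext (\<lambda>(a, v0). gen (crossed_act H G a w, v0)) (crossed_coact H G v))"

definition wedge_quad ::
  "('k::field, 'a::ring_1) hopf_data \<Rightarrow> ('k, 'a, 'g::ab_group_add) fodc_data
    \<Rightarrow> ('k, 'g) quadratic_presentation"
  where "wedge_quad H G = (let V = right_inv H G in
    \<lparr>gen_scale = gsc G,
     gen_space = V,
     rel_space = {t. Poly_Mapping.keys t \<subseteq> V \<times> V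
                   \<and> tensor_eq (gsc G) V (gsc G) V (t - sigma_t H G t) 0}\<rparr>)"

subsection \<open>The finite dual and the quantum Lie algebra\<close>

definition finite_dual :: "('k::field, 'a::ring_1) hopf_data \<Rightarrow> ('a \<Rightarrow> 'k) set"
  where "finite_dual H = {f \<in> dual_space (sc H) UNIV.
    \<exists>J. module.subspace (sc H) J \<and> (\<forall>a. \<forall>j\<in>J. a * j \<in> J \<and> j * a \<in> J)
      \<and> (\<exists>B. finite B \<and> module.span (sc H) (B \<union> J) = UNIV)
      \<and> (\<forall>j\<in>J. f j = 0)}"

definition dual_mult :: "('k::field, 'a::ring_1) hopf_data \<Rightarrow> ('a \<Rightarrow> 'k) \<Rightarrow> ('a \<Rightarrow> 'k) \<Rightarrow> 'a \<Rightarrow> 'k"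
  where "dual_mult H f g a = lin_ext (*) (\<lambda>(a1, a2). f a1 * g a2) (cop H a)"

text \<open>The coproduct of the finite dual is the transpose of the product; the tensor is unique.\<close>

definition dual_cop ::
  "('k::field, 'a::ring_1) hopf_data \<Rightarrow> ('a \<Rightarrow> 'k) \<Rightarrow> (('a \<Rightarrow> 'k) \<times> ('a \<Rightarrow> 'k) \<Rightarrow>\<^sub>0 'k)"
  where "dual_cop H f = (SOME t. Poly_Mapping.keys t \<subseteq> finite_dual H \<times> finite_dual H
    \<and> (\<forall>a b. f (a * b) = lin_ext (*) (\<lambda>(f1, f2). f1 a * f2 b) t))"

definition bracket ::
  "('k::field, 'a::ring_1) hopf_data \<Rightarrow> ('a \<Rightarrow> 'k) \<Rightarrow> ('a \<Rightarrow> 'k) \<Rightarrow> ('a \<Rightarrow> 'k)"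
  where "bracket H X Y = lin_ext fun_scale
    (\<lambda>(X1, X2). dual_mult H (dual_mult H X1 Y) (X2 \<circ> anti H)) (dual_cop H X)"

definition tangent_space ::
  "('k::field, 'a::ring_1) hopf_data \<Rightarrow> ('k, 'a, 'g::ab_group_add) fodc_data \<Rightarrow> ('a \<Rightarrow> 'k) set"
  where "tangent_space H G = {x \<in> dual_space (sc H) UNIV. (\<forall>a \<in> ideal_of H G. x a = 0) \<and> x 1 = 0}"

text \<open>
  \<open>sigma H G x y\<close> is the value of the braiding at the tensor of \<open>x\<close> and \<open>y\<close>. The defining expression lies
  in the tensor square of the finite dual, whose unit is the counit \<open>cou H\<close>.
\<close>

definition sigma ::
  "('k::field, 'a::ring_1) hopf_data \<Rightarrow> ('k, 'a, 'g::ab_group_add) fodc_data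
    \<Rightarrow> ('a \<Rightarrow> 'k) \<Rightarrow> ('a \<Rightarrow> 'k) \<Rightarrow> (('a \<Rightarrow> 'k) \<times> ('a \<Rightarrow> 'k) \<Rightarrow>\<^sub>0 'k)"
  where "sigma H G x y =
    tensor_restrict fun_scale (finite_dual H) (tangent_space H G)
                    fun_scale (finite_dual H) (tangent_space H G)
      (formal_ext (\<lambda>(x1, x2). gen (bracket H x1 y, x2)) (dual_cop H x) - gen (bracket H x y, cou H))"

definition enveloping_algebra ::
  "('k::field, 'a::ring_1) hopf_data \<Rightarrow> ('k, 'a, 'g::ab_group_add) fodc_data
    \<Rightarrow> ('k, (('a \<Rightarrow> 'k) list \<Rightarrow>\<^sub>0 'k) set set) module"
  where "enveloping_algebra H G = tensor_algebra_quot fun_scale (tangent_space H G)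
    {gen [x, y] - deg2 (sigma H G x y) - gen [bracket H x y] | x y.
      x \<in> tangent_space H G \<and> y \<in> tangent_space H G}"

end

theory Submission
  imports Defs
begin

text \<open>
  Let \<open>V\<close> be the space of right invariants. In an inner calculus \<open>\<omega>\<^sub>R(a) = a \<triangleright> \<theta> - \<epsilon>(a)\<theta>\<close>, and \<open>\<omega>\<^sub>R\<close> maps
  \<open>A\<close> onto \<open>V\<close>, so \<open>f \<mapsto> f \<circ> \<omega>\<^sub>R\<close> identifies the dual of \<open>V\<close> with the tangent space. Under this
  identification \<open>\<sigma>\<close> is the transpose of \<open>\<sigma>\<^sup>t\<close>, and biinvariance of \<open>\<theta>\<close> gives
  \<open>\<sigma>\<^sup>t(\<theta> \<otimes> w) = w \<otimes> \<theta>\<close>, while pairing \<open>\<sigma>\<^sup>t(v \<otimes> \<theta>) - \<theta> \<otimes> v\<close> with \<open>x \<otimes> y\<close> gives \<open>[x, y](v)\<close>. Hence the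
  automorphism \<open>x \<mapsto> x - x(\<theta>)\<close> of the tensor algebra turns the quadratic-linear relation
  \<open>x \<otimes> y - \<sigma>(x \<otimes> y) - [x, y]\<close> into the purely quadratic \<open>x \<otimes> y - \<sigma>(x \<otimes> y)\<close>, and these span
  the annihilator of \<open>ker(id - \<sigma>\<^sup>t)\<close> because \<open>V\<close> is finite dimensional.
\<close>

section \<open>Tensors and bilinear forms\<close>

text \<open>Three objects of the statement are Hilbert choices: the coaction with right invariant
  legs, the coproduct of the finite dual, and \<open>sigma\<close>. Each needs a witness before
  anything is known about it, and then it is known only up to \<open>tensor_eq\<close>. So they are
  tested rather than manipulated: by bilinear forms in general, and by evaluation at pairs of points
  for tensors of functions. The function \<open>braid\<close> is where \<open>sigma\<close> and
  \<open>sigma_t\<close> meet. The constant x(\<theta>) of the shift is dictated by the contractions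
  of \<sigma>(x \<otimes> y) with \<theta>: they are y(\<theta>) x in the first leg and [x, y] +
  x(\<theta>) y in the second, precisely the linear terms that arise from the bracket and from
  expanding (x - x(\<theta>)) (y - y(\<theta>)). Comparing both contractions at \<theta> also yields
  [x, y](\<theta>) = 0, without which a constant would survive. All maps are built on free algebras
  of words, before multilinearity is imposed, and relations are compared only inside ideals that
  contain the linearity ideal.\<close>

lemma vector_space_field: "vector_space ((*) :: 'k::field \<Rightarrow> 'k \<Rightarrow> 'k)"
  by unfold_locales (auto simp: algebra_simps)

lemma lin_ext_0: "lin_ext s f 0 = 0"
  by (simp add: lin_ext_def)

lemma lin_ext_diff:
  assumes "vector_space s"
  shows "lin_ext s f (p - q) = lin_ext s f p - lin_ext s f q"
  using lin_ext_add[OF assms, of f "p - q" q] by simp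

lemma lin_ext_sum:
  assumes "vector_space s"
  shows "lin_ext s f (sum g A) = (\<Sum>i\<in>A. lin_ext s f (g i))"
  by (induction A rule: infinite_finite_induct) (simp_all add: lin_ext_0 lin_ext_add[OF assms])

lemma lin_ext_diff_fun:
  assumes "vector_space s"
  shows "lin_ext s (\<lambda>x. f x - g x) p = lin_ext s f p - lin_ext s g p"
  using lin_ext_addf[OF assms, of "\<lambda>x. f x - g x" g p] by simp

lemma lin_ext_cong: "(\<And>x. x \<in> Poly_Mapping.keys p \<Longrightarrow> f x = g x) \<Longrightarrow> lin_ext s f p = lin_ext s g p"
  by (simp add: lin_ext_def)

lemma lin_ext_swap:
  assumes "vector_space s"
  shows "lin_ext s (\<lambda>x. lin_ext s (\<lambda>y. f x y) q) p = lin_ext s (\<lambda>y. lin_ext s (\<lambda>x. f x y) p) q"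
proof -
  interpret vector_space s by fact
  show ?thesis
    unfolding lin_ext_def scale_sum_right
    by (subst sum.swap) (simp add: mult.commute)
qed

lemma lin_ext_formal_ext:
  assumes "vector_space s"
  shows "lin_ext s f (formal_ext g p) = lin_ext s (\<lambda>x. lin_ext s f (g x)) p"
  by (induction p rule: formal_induct)
    (simp_all add: lin_ext_add lin_ext_scale lin_ext_gen assms vector_space_formal_scale)

lemma lin_ext_comp:
  assumes "Vector_Spaces.linear s r g"
  shows "g (lin_ext s f p) = lin_ext r (\<lambda>x. g (f x)) p"
proof -
  interpret Vector_Spaces.linear s r g by fact
  show ?thesis by (simp add: lin_ext_def sum scale)
qed

lemma lin_ext_field_mult:
  "lin_ext (*) (\<lambda>x. f x * c) p = lin_ext (*) f p * (c :: 'k::field)"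
  "lin_ext (*) (\<lambda>x. c * f x) p = c * lin_ext (*) f p"
  by (simp_all add: lin_ext_def sum_distrib_left sum_distrib_right mult_ac)

text \<open>Take a basis of the span of \<open>S\<close>, add \<open>x\<close>, and extend to a
  basis of the whole space. The coordinate along \<open>x\<close> is the functional.\<close>

lemma separating_functional:
  assumes "vector_space s" and "x \<notin> module.span s S"
  obtains L where "Vector_Spaces.linear s (*) L" "\<And>y. y \<in> module.span s S \<Longrightarrow> L y = 0" "L x = 1"
proof -
  interpret vector_space s by fact
  obtain B where B: "B \<subseteq> S" "independent B" "S \<subseteq> span B"
    by (rule maximal_independent_subset)
  have span_B: "span B = span S"
    using B by (simp add: span_eq span_superset order.trans[OF B(1)])
  let ?D = "extend_basis (insert x B)"
  have "independent (insert x B)"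
    using B assms(2) span_B by (intro independent_insertI) auto
  note D = extend_basis_superset[OF this] independent_extend_basis[OF this] span_extend_basis[OF this]
  let ?L = "\<lambda>y. representation ?D y x"
  have lin: "Vector_Spaces.linear s (*) ?L"
    using D by (intro linear_representation)
  interpret L: Vector_Spaces.linear s "(*)" ?L by fact
  have xB: "x \<notin> B" using assms(2) span_B span_base by blast
  show ?thesis
  proof (rule that[OF lin])
    fix y assume "y \<in> span S"
    then have "y \<in> span B" by (simp add: span_B)
    then show "?L y = 0"
    proof (induction rule: span_induct_alt)
      case (step c u z)
      then have "?L u = 0" using D xB by (subst representation_basis) auto
      then show ?case using step by (simp add: L.add L.scale)
    qed (simp add: representation_zero)
  next
    show "?L x = 1" using D by (subst representation_basis) auto
  qed
qed

text \<open>Bilinearity is demanded on \<open>V\<close> and \<open>W\<close> only. Functionals such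
  as \<open>hat x\<close> below, which are 0 off the right invariants by convention, are linear
  there but need not be linear on the ambient space.\<close>

definition bilinear_on ::
  "('k::field \<Rightarrow> 'v \<Rightarrow> 'v) \<Rightarrow> 'v::ab_group_add set \<Rightarrow> ('k \<Rightarrow> 'w \<Rightarrow> 'w) \<Rightarrow> 'w::ab_group_add set
    \<Rightarrow> ('k \<Rightarrow> 'u \<Rightarrow> 'u) \<Rightarrow> ('v \<Rightarrow> 'w \<Rightarrow> 'u::ab_group_add) \<Rightarrow> bool"
  where "bilinear_on s V t W r f \<longleftrightarrow>
     (\<forall>v\<in>V. \<forall>v'\<in>V. \<forall>w\<in>W. f (v + v') w = f v w + f v' w)
   \<and> (\<forall>v\<in>V. \<forall>w\<in>W. \<forall>w'\<in>W. f v (w + w') = f v w + f v w')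
   \<and> (\<forall>c. \<forall>v\<in>V. \<forall>w\<in>W. f (s c v) w = r c (f v w))
   \<and> (\<forall>c. \<forall>v\<in>V. \<forall>w\<in>W. f v (t c w) = r c (f v w))"

definition trilinear ::
  "('k::field \<Rightarrow> 'v \<Rightarrow> 'v) \<Rightarrow> ('k \<Rightarrow> 'w \<Rightarrow> 'w) \<Rightarrow> ('k \<Rightarrow> 'x \<Rightarrow> 'x)
    \<Rightarrow> ('k \<Rightarrow> 'u \<Rightarrow> 'u) \<Rightarrow> ('v::ab_group_add \<Rightarrow> 'w::ab_group_add \<Rightarrow> 'x::ab_group_add \<Rightarrow> 'u::ab_group_add) \<Rightarrow> bool"
  where "trilinear s t u r f \<longleftrightarrow>
     (\<forall>v v' w x. f (v + v') w x = f v w x + f v' w x)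
   \<and> (\<forall>v w w' x. f v (w + w') x = f v w x + f v w' x)
   \<and> (\<forall>v w x x'. f v w (x + x') = f v w x + f v w x')
   \<and> (\<forall>c v w x. f (s c v) w x = r c (f v w x))
   \<and> (\<forall>c v w x. f v (t c w) x = r c (f v w x))
   \<and> (\<forall>c v w x. f v w (u c x) = r c (f v w x))"

text \<open>A bilinear map kills every bilinearity relation, so its linear extension descends to the
  tensor product. This is how identities between representatives are put to use.\<close>

lemma tensor_eq_lin_ext:
  assumes "tensor_eq s V t W x y" "vector_space r" "bilinear_on s V t W r f"
  shows "lin_ext r (\<lambda>(v, w). f v w) x = lin_ext r (\<lambda>(v, w). f v w) y"
proof -
  interpret F: vector_space "formal_scale :: _ \<Rightarrow> ('b \<times> 'c \<Rightarrow>\<^sub>0 'a) \<Rightarrow> _" by (rule vector_space_formal_scale)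
  interpret R: vector_space r by fact
  have "lin_ext r (\<lambda>(v, w). f v w) z = 0" if "z \<in> F.span (tensor_relations s V t W)" for z
    using that
  proof (induction rule: F.span_induct_alt)
    case (step c z z')
    have "lin_ext r (\<lambda>(v, w). f v w) z = 0"
      using step(1) assms(3) unfolding tensor_relations_def bilinear_on_def
      by (auto simp: lin_ext_diff[OF assms(2)] lin_ext_gen[OF assms(2)] lin_ext_scale[OF assms(2)])
    then show ?case using step by (simp add: lin_ext_add[OF assms(2)] lin_ext_scale[OF assms(2)])
  qed (simp add: lin_ext_0)
  from this[of "x - y"] assms(1) show ?thesis
    by (simp add: tensor_eq_def lin_ext_diff[OF assms(2)])
qed

lemma tensor3_eq_lin_ext:
  assumes "tensor3_eq s t u x y" "vector_space r" "trilinear s t u r f"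
  shows "lin_ext r (\<lambda>(a, b, c). f a b c) x = lin_ext r (\<lambda>(a, b, c). f a b c) y"
proof -
  interpret F: vector_space "formal_scale :: _ \<Rightarrow> ('b \<times> 'c \<times> 'd \<Rightarrow>\<^sub>0 'a) \<Rightarrow> _" by (rule vector_space_formal_scale)
  interpret R: vector_space r by fact
  have "lin_ext r (\<lambda>(a, b, c). f a b c) z = 0" if "z \<in> F.span (tensor3_relations s t u)" for z
    using that
  proof (induction rule: F.span_induct_alt)
    case (step c z z')
    have "lin_ext r (\<lambda>(a, b, c). f a b c) z = 0"
      using step(1) assms(3) unfolding tensor3_relations_def trilinear_def
      by (auto simp: lin_ext_diff[OF assms(2)] lin_ext_gen[OF assms(2)] lin_ext_scale[OF assms(2)])
    then show ?case using step by (simp add: lin_ext_add[OF assms(2)] lin_ext_scale[OF assms(2)])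
  qed (simp add: lin_ext_0)
  from this[of "x - y"] assms(1) show ?thesis
    by (simp add: tensor3_eq_def lin_ext_diff[OF assms(2)])
qed

text \<open>If x - y were outside the span of the relations, some functional would vanish on that
  span and be 1 on x - y. Its values on pairs form a bilinear form that tells x from y, so scalar
  forms suffice as tests.\<close>

lemma tensor_eqI:
  fixes s :: "'k::field \<Rightarrow> 'v::ab_group_add \<Rightarrow> 'v" and t :: "'k \<Rightarrow> 'w::ab_group_add \<Rightarrow> 'w"
  assumes "\<And>f. bilinear_on s V t W (*) f \<Longrightarrow>
    lin_ext (*) (\<lambda>(v, w). f v w) x = lin_ext (*) (\<lambda>(v, w). f v w) y"
  shows "tensor_eq s V t W x y"
proof (rule ccontr)
  interpret F: vector_space "formal_scale :: 'k \<Rightarrow> ('v \<times> 'w \<Rightarrow>\<^sub>0 'k) \<Rightarrow> _" by (rule vector_space_formal_scale)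
  assume "\<not> ?thesis"
  then have "x - y \<notin> F.span (tensor_relations s V t W)" by (simp add: tensor_eq_def)
  then obtain L where L: "Vector_Spaces.linear formal_scale (*) L"
      "\<And>y. y \<in> F.span (tensor_relations s V t W) \<Longrightarrow> L y = 0" "L (x - y) = 1"
    by (rule separating_functional[OF vector_space_formal_scale]) blast
  interpret L: Vector_Spaces.linear formal_scale "(*)" L by fact
  have rel: "L y = 0" if "y \<in> tensor_relations s V t W" for y
    using that L(2) F.span_base by blast
  have "bilinear_on s V t W (*) (\<lambda>v w. L (gen (v, w)))"
    unfolding bilinear_on_def
  proof (intro conjI ballI allI)
    fix v v' w assume "v \<in> V" "v' \<in> V" "w \<in> W"
    then have "L (gen (v + v', w) - gen (v, w) - gen (v', w)) = 0"
      by (intro rel) (unfold tensor_relations_def, blast)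
    then show "L (gen (v + v', w)) = L (gen (v, w)) + L (gen (v', w))"
      by (simp add: L.diff diff_eq_eq add.commute)
  next
    fix v w w' assume "v \<in> V" "w \<in> W" "w' \<in> W"
    then have "L (gen (v, w + w') - gen (v, w) - gen (v, w')) = 0"
      by (intro rel) (unfold tensor_relations_def, blast)
    then show "L (gen (v, w + w')) = L (gen (v, w)) + L (gen (v, w'))"
      by (simp add: L.diff diff_eq_eq add.commute)
  next
    fix c v w assume "v \<in> V" "w \<in> W"
    then have "L (gen (s c v, w) - formal_scale c (gen (v, w))) = 0"
      by (intro rel) (unfold tensor_relations_def, blast)
    then show "L (gen (s c v, w)) = c * L (gen (v, w))"
      by (simp add: L.diff L.scale)
  next
    fix c v w assume "v \<in> V" "w \<in> W"
    then have "L (gen (v, t c w) - formal_scale c (gen (v, w))) = 0"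
      by (intro rel) (unfold tensor_relations_def, blast)
    then show "L (gen (v, t c w)) = c * L (gen (v, w))"
      by (simp add: L.diff L.scale)
  qed
  from assms[OF this]
  have "lin_ext (*) (\<lambda>p. L (gen p)) (x - y) = 0"
    by (simp add: lin_ext_diff[OF vector_space_field] case_prod_unfold)
  also have "lin_ext (*) (\<lambda>p. L (gen p)) (x - y) = L (x - y)"
    using lin_ext_comp[OF L(1), of gen "x - y"] by (simp add: gen_id)
  finally show False using L(3) by simp
qed

lemma bilinear_on_left_sum:
  assumes "bilinear_on s V t W (*) f" "w \<in> W" "vector_space s" "module.subspace s V"
    and "finite I" "\<And>i. i \<in> I \<Longrightarrow> v i \<in> V"
  shows "f (\<Sum>i\<in>I. s (c i) (v i)) w = (\<Sum>i\<in>I. c i * f (v i) w)"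
  using assms(5,6)
proof (induction I)
  interpret vector_space s by fact
  case empty
  have "f (s 0 0) w = 0 * f 0 w"
    using assms subspace_0[OF assms(4)] unfolding bilinear_on_def by blast
  then show ?case by simp
next
  interpret vector_space s by fact
  case (insert j I)
  have "(\<Sum>i\<in>I. s (c i) (v i)) \<in> V" "s (c j) (v j) \<in> V"
    using insert assms(4) by (auto intro!: subspace_sum subspace_scale)
  then show ?case using insert assms(1,2) unfolding bilinear_on_def by simp
qed

lemma bilinear_on_right_sum:
  assumes "bilinear_on s V t W (*) f" "v \<in> V" "vector_space t" "module.subspace t W"
    and "finite I" "\<And>i. i \<in> I \<Longrightarrow> w i \<in> W"
  shows "f v (\<Sum>i\<in>I. t (c i) (w i)) = (\<Sum>i\<in>I. c i * f v (w i))"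
proof -
  have "bilinear_on t W s V (*) (\<lambda>w v. f v w)"
    using assms(1) unfolding bilinear_on_def by auto
  from bilinear_on_left_sum[OF this assms(2-)] show ?thesis by simp
qed

text \<open>
  Writing a tensor as \<open>\<Sum>u\<in>U. u \<otimes> w\<^sub>u\<close> with \<open>U\<close> independent, the functionals on the
  first leg followed by those on the second leg show that every \<open>w\<^sub>u\<close> vanishes.
\<close>

lemma tensor_eq_separating:
  fixes s :: "'k::field \<Rightarrow> 'v::ab_group_add \<Rightarrow> 'v" and t :: "'k \<Rightarrow> 'w::ab_group_add \<Rightarrow> 'w"
  assumes vs: "vector_space s" and vt: "vector_space t"
    and V: "module.subspace s V" and W: "module.subspace t W"
    and keys: "Poly_Mapping.keys x \<subseteq> V \<times> W" "Poly_Mapping.keys y \<subseteq> V \<times> W"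
    and Phi: "\<And>f v v'. f \<in> \<Phi> \<Longrightarrow> v \<in> V \<Longrightarrow> v' \<in> V \<Longrightarrow> f (v + v') = f v + f v'"
      "\<And>f c v. f \<in> \<Phi> \<Longrightarrow> v \<in> V \<Longrightarrow> f (s c v) = c * f v"
      "\<And>v. v \<in> V \<Longrightarrow> (\<And>f. f \<in> \<Phi> \<Longrightarrow> f v = (0::'k)) \<Longrightarrow> v = 0"
    and Psi: "\<And>f w w'. f \<in> \<Psi> \<Longrightarrow> w \<in> W \<Longrightarrow> w' \<in> W \<Longrightarrow> f (w + w') = f w + f w'"
      "\<And>f c w. f \<in> \<Psi> \<Longrightarrow> w \<in> W \<Longrightarrow> f (t c w) = c * f w"
      "\<And>w. w \<in> W \<Longrightarrow> (\<And>f. f \<in> \<Psi> \<Longrightarrow> f w = (0::'k)) \<Longrightarrow> w = 0"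
    and eq: "\<And>f g. f \<in> \<Phi> \<Longrightarrow> g \<in> \<Psi> \<Longrightarrow>
      lin_ext (*) (\<lambda>(v, w). f v * g w) x = lin_ext (*) (\<lambda>(v, w). f v * g w) y"
  shows "tensor_eq s V t W x y"
proof (rule tensor_eqI)
  interpret S: vector_space s by fact
  interpret T: vector_space t by fact
  define z where "z = x - y"
  have kz: "Poly_Mapping.keys z \<subseteq> V \<times> W"
    using keys_diff[of x y] keys unfolding z_def by blast
  let ?K = "Poly_Mapping.keys z"
  obtain U where U: "U \<subseteq> fst ` ?K" "S.independent U" "fst ` ?K \<subseteq> S.span U"
    by (rule S.maximal_independent_subset)
  have fU: "finite U" using U(1) finite_subset by fastforce
  have UV: "U \<subseteq> V" using U(1) kz by fastforce
  \<comment> \<open>Coordinates of the first legs, moved across the tensor sign: the coefficient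
    vector of \<open>u\<close> in \<open>z\<close>.\<close>
  define w where "w u = (\<Sum>p\<in>?K. t (Poly_Mapping.lookup z p * S.representation U (fst p) u) (snd p))" for u
  have wW: "w u \<in> W" for u
    unfolding w_def using kz by (intro T.subspace_sum[OF W] T.subspace_scale[OF W]) auto
  have expand: "lin_ext (*) (\<lambda>(v, w). f v w) z = (\<Sum>u\<in>U. f u (w u))"
    if f: "bilinear_on s V t W (*) f" for f
  proof -
    have "lin_ext (*) (\<lambda>(v, w). f v w) z = (\<Sum>p\<in>?K. Poly_Mapping.lookup z p * f (fst p) (snd p))"
      by (simp add: lin_ext_def case_prod_unfold)
    also have "\<dots> = (\<Sum>p\<in>?K. Poly_Mapping.lookup z p * (\<Sum>u\<in>U. S.representation U (fst p) u * f u (snd p)))"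
    proof (intro sum.cong refl arg_cong2[where f = "(*)"])
      fix p assume p: "p \<in> ?K"
      have "f (fst p) (snd p) = f (\<Sum>u\<in>U. s (S.representation U (fst p) u) u) (snd p)"
        using p U fU by (subst S.sum_representation_eq) auto
      also have "\<dots> = (\<Sum>u\<in>U. S.representation U (fst p) u * f u (snd p))"
        using p kz UV by (intro bilinear_on_left_sum[OF f _ vs V fU]) auto
      finally show "f (fst p) (snd p) = \<dots>" .
    qed
    also have "\<dots> = (\<Sum>u\<in>U. \<Sum>p\<in>?K. (Poly_Mapping.lookup z p * S.representation U (fst p) u) * f u (snd p))"
      unfolding sum_distrib_left by (subst sum.swap) (simp add: mult_ac)
    also have "\<dots> = (\<Sum>u\<in>U. f u (w u))"
      unfolding w_def using kz UV
      by (intro sum.cong refl bilinear_on_right_sum[OF f _ vt W, symmetric]) auto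
    finally show ?thesis .
  qed
  have "w u = 0" if u: "u \<in> U" for u
  proof (rule Psi(3)[OF wW])
    fix g assume g: "g \<in> \<Psi>"
    have "(\<Sum>u\<in>U. s (g (w u)) u) = 0"
    proof (rule Phi(3))
      show "(\<Sum>u\<in>U. s (g (w u)) u) \<in> V"
        using UV by (intro S.subspace_sum[OF V] S.subspace_scale[OF V]) auto
      fix f assume f: "f \<in> \<Phi>"
      have b: "bilinear_on s V t W (*) (\<lambda>v w. f v * g w)"
        unfolding bilinear_on_def using Phi(1,2)[OF f] Psi(1,2)[OF g] by (auto simp: algebra_simps)
      have b1: "bilinear_on s V (*) UNIV (*) (\<lambda>v (c::'k). f v * c)"
        unfolding bilinear_on_def using Phi(1,2)[OF f] by (auto simp: algebra_simps)
      have "f (\<Sum>u\<in>U. s (g (w u)) u) = (\<Sum>u\<in>U. g (w u) * f u)"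
        using bilinear_on_left_sum[OF b1 UNIV_I vs V fU, of "\<lambda>u. u" "\<lambda>u. g (w u)" 1] UV by auto
      also have "\<dots> = lin_ext (*) (\<lambda>(v, w). f v * g w) z"
        by (simp add: expand[OF b] mult.commute)
      also have "\<dots> = 0"
        unfolding z_def by (simp add: lin_ext_diff[OF vector_space_field] eq[OF f g])
      finally show "f (\<Sum>u\<in>U. s (g (w u)) u) = 0" .
    qed
    then show "g (w u) = 0"
      using S.independentD[OF U(2) fU order.refl _ u, of "\<lambda>u. g (w u)"] by blast
  qed
  moreover fix f :: "'v \<Rightarrow> 'w \<Rightarrow> 'k" assume f: "bilinear_on s V t W (*) f"
  ultimately have "lin_ext (*) (\<lambda>(v, w). f v w) z = (\<Sum>u\<in>U. f u 0)"
    by (simp add: expand)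
  also have "\<dots> = 0"
  proof (intro sum.neutral ballI)
    fix u assume "u \<in> U"
    then have "f u (t 0 0) = 0 * f u 0"
      using f UV T.subspace_0[OF W] unfolding bilinear_on_def by blast
    then show "f u 0 = 0" by simp
  qed
  finally show "lin_ext (*) (\<lambda>(v, w). f v w) x = lin_ext (*) (\<lambda>(v, w). f v w) y"
    unfolding z_def by (simp add: lin_ext_diff[OF vector_space_field])
qed

section \<open>Sweedler calculus\<close>

context hopf_algebra
begin

text \<open>
  \<open>sw r f a\<close> is \<open>f(a\<^sub>(\<^sub>1\<^sub>), a\<^sub>(\<^sub>2\<^sub>))\<close> in Sweedler notation, with values in a space with scalar multiplication
  \<open>r\<close>; it depends only on the tensor \<open>\<Delta>(a)\<close> when \<open>f\<close> is bilinear. The operators \<open>lw\<close> and \<open>rw\<close> below do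
  the same for the two coactions.
\<close>

definition sw :: "('k \<Rightarrow> 'u \<Rightarrow> 'u) \<Rightarrow> ('a \<Rightarrow> 'a \<Rightarrow> 'u::ab_group_add) \<Rightarrow> 'a \<Rightarrow> 'u"
  where "sw r f a = lin_ext r (\<lambda>(p, q). f p q) (cop H a)"

abbreviation bil :: "('k \<Rightarrow> 'u \<Rightarrow> 'u) \<Rightarrow> ('a \<Rightarrow> 'a \<Rightarrow> 'u::ab_group_add) \<Rightarrow> bool"
  where "bil \<equiv> bilinear_on (sc H) UNIV (sc H) UNIV"

lemma anti_add: "anti H (a + b) = anti H a + anti H b"
  and anti_sc: "anti H (sc H c a) = sc H c (anti H a)"
  using anti_linear by (simp_all add: Vector_Spaces.linear_iff)

lemma cou_add: "cou H (a + b) = cou H a + cou H b"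
  and cou_sc: "cou H (sc H c a) = c * cou H a"
  using cou_linear by (simp_all add: Vector_Spaces.linear_iff)

lemma sc_scale_simps:
  "sc H c (a + b) = sc H c a + sc H c b" "sc H (c + d) a = sc H c a + sc H d a"
  "sc H c (sc H d a) = sc H (c * d) a" "sc H 1 a = a"
  using sc_vector_space by (simp_all add: vector_space_def)

lemma sc_mult: "sc H c a * b = sc H c (a * b)" "a * sc H c b = sc H c (a * b)"
  by (simp_all only: sc_mult_left[symmetric] sc_mult_right[symmetric])

lemmas sc_simps = anti_add anti_sc cou_add cou_sc sc_scale_simps sc_mult distrib_left distrib_right

lemma sw_add:
  assumes "vector_space r" "bil r f"
  shows "sw r f (a + b) = sw r f a + sw r f b"
  unfolding sw_def tensor_eq_lin_ext[OF cop_add assms] by (rule lin_ext_add[OF assms(1)])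

lemma sw_sc:
  assumes "vector_space r" "bil r f"
  shows "sw r f (sc H c a) = r c (sw r f a)"
  unfolding sw_def tensor_eq_lin_ext[OF cop_sc assms] by (rule lin_ext_scale[OF assms(1)])

lemma sw_add_fun: "vector_space r \<Longrightarrow> sw r (\<lambda>p q. f p q + g p q) a = sw r f a + sw r g a"
  unfolding sw_def using lin_ext_addf[of r "case_prod f" "case_prod g"] by (simp add: case_prod_unfold)

lemma sw_scale_fun: "vector_space r \<Longrightarrow> sw r (\<lambda>p q. r c (f p q)) a = r c (sw r f a)"
  unfolding sw_def using lin_ext_scalef[of r c "case_prod f"] by (simp add: case_prod_unfold)

lemma sw_swap:
  "vector_space r \<Longrightarrow>
    sw r (\<lambda>p q. sw r (\<lambda>s t. f p q s t) b) a = sw r (\<lambda>s t. sw r (\<lambda>p q. f p q s t) a) b"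
  unfolding sw_def case_prod_unfold by (rule lin_ext_swap)

lemma sw_comp: "Vector_Spaces.linear s r g \<Longrightarrow> g (sw s f a) = sw r (\<lambda>p q. g (f p q)) a"
  unfolding sw_def using lin_ext_comp[of s r g "case_prod f"] by (simp add: case_prod_unfold)

lemma sw_mult_const:
  "sw (sc H) (\<lambda>p q. f p q * b) a = sw (sc H) f a * b"
  "sw (sc H) (\<lambda>p q. b * f p q) a = b * sw (sc H) f a"
  by (rule sw_comp[symmetric]; simp add: Vector_Spaces.linear_iff sc_vector_space sc_simps)+

lemma sw_field_mult:
  "sw (*) (\<lambda>p q. f p q * c) a = sw (*) f a * c"
  "sw (*) (\<lambda>p q. c * f p q) a = c * sw (*) f a"
  unfolding sw_def case_prod_unfold by (rule lin_ext_field_mult)+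

lemma sw_coassoc:
  assumes "vector_space r" "trilinear (sc H) (sc H) (sc H) r f"
  shows "sw r (\<lambda>p q. sw r (\<lambda>s t. f s t q) p) a = sw r (\<lambda>p q. sw r (\<lambda>s t. f p s t) q) a"
  using tensor3_eq_lin_ext[OF coassoc assms]
  by (simp add: sw_def case_prod_unfold lin_ext_formal_ext[OF assms(1)] lin_ext_gen[OF assms(1)])

lemma sw_mult:
  assumes "vector_space r" "bil r f"
  shows "sw r f (a * b) = sw r (\<lambda>p q. sw r (\<lambda>s t. f (p * s) (q * t)) b) a"
  using tensor_eq_lin_ext[OF cop_mult assms]
  by (simp add: sw_def case_prod_unfold lin_ext_formal_ext[OF assms(1)] lin_ext_gen[OF assms(1)])

lemma sw_one:
  assumes "vector_space r" "bil r f"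
  shows "sw r f 1 = f 1 1"
  using tensor_eq_lin_ext[OF cop_one assms]
  by (simp add: sw_def lin_ext_gen[OF assms(1)])

lemma sw_counit:
  assumes "Vector_Spaces.linear (sc H) r f"
  shows "sw r (\<lambda>p q. r (cou H p) (f q)) a = f a" "sw r (\<lambda>p q. r (cou H q) (f p)) a = f a"
  using sw_comp[OF assms, of "\<lambda>p q. sc H (cou H p) q" a] sw_comp[OF assms, of "\<lambda>p q. sc H (cou H q) p" a]
    assms by (simp_all add: sw_def counit_left counit_right Vector_Spaces.linear_iff)

lemma sw_anti:
  assumes "Vector_Spaces.linear (sc H) r f"
  shows "sw r (\<lambda>p q. f (anti H p * q)) a = r (cou H a) (f 1)"
    "sw r (\<lambda>p q. f (p * anti H q)) a = r (cou H a) (f 1)"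
  using sw_comp[OF assms, of "\<lambda>p q. anti H p * q" a] sw_comp[OF assms, of "\<lambda>p q. p * anti H q" a]
    assms by (simp_all add: sw_def antipode_left antipode_right Vector_Spaces.linear_iff)

text \<open>The antipode axiom at 1, where the coproduct is 1 \<otimes> 1.\<close>

lemma anti_one: "anti H 1 = 1"
proof -
  have "sw (sc H) (\<lambda>p q. anti H p * q) 1 = anti H 1 * 1"
    by (rule sw_one) (simp_all add: sc_vector_space bilinear_on_def sc_simps)
  then show ?thesis by (simp add: sw_def antipode_left cou_one sc_simps)
qed

text \<open>Both sides are reductions of \<open>S(a\<^sub>1b\<^sub>1)a\<^sub>2b\<^sub>2S(b\<^sub>3)S(a\<^sub>3)\<close>.\<close>

lemma anti_mult: "anti H (a * b) = anti H b * anti H a"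
proof -
  let ?s = "sc H" and ?S = "anti H" and ?e = "cou H"
  note V = sc_vector_space
  note simps = V bilinear_on_def trilinear_def sc_simps sw_add_fun sw_scale_fun sw_mult_const mult.assoc
      Vector_Spaces.linear_iff
  \<comment> \<open>Antipode axiom for the product \<open>p * s\<close>, read from right to left:
    two counits become S(p1 s1) p2 s2.\<close>
  have one: "?s (?e p) (?s (?e s) x)
      = sw ?s (\<lambda>p1 p2. sw ?s (\<lambda>s1 s2. ?S (p1 * s1) * (p2 * s2) * x) s) p" for p s x
  proof -
    have "sw ?s (\<lambda>u v. ?S u * v * x) (p * s)
        = sw ?s (\<lambda>p1 p2. sw ?s (\<lambda>s1 s2. ?S (p1 * s1) * (p2 * s2) * x) s) p"
      by (rule sw_mult) (simp_all add: simps)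
    moreover have "sw ?s (\<lambda>u v. ?S u * v * x) (p * s) = ?s (?e (p * s)) (1 * x)"
      by (rule sw_anti(1)[of ?s "\<lambda>y. y * x"]) (simp add: simps)
    ultimately show ?thesis by (simp add: cou_mult sc_simps)
  qed
  \<comment> \<open>With the legs of \<open>a\<close> held fixed, b2 S(b3) collapses by the antipode
    axiom.\<close>
  have two: "sw ?s (\<lambda>s t. sw ?s (\<lambda>s1 s2. ?S (p1 * s1) * (p2 * s2) * (?S t * z)) s) b = ?S (p1 * b) * (p2 * z)"
    for p1 p2 z
  proof -
    have "sw ?s (\<lambda>s t. sw ?s (\<lambda>s1 s2. ?S (p1 * s1) * (p2 * s2) * (?S t * z)) s) b
        = sw ?s (\<lambda>s t. sw ?s (\<lambda>t1 t2. ?S (p1 * s) * (p2 * t1) * (?S t2 * z)) t) b"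
      by (rule sw_coassoc) (simp_all add: simps)
    also have "\<dots> = sw ?s (\<lambda>s t. ?s (?e t) (?S (p1 * s) * (p2 * 1 * z))) b"
      using sw_anti(2)[of ?s "\<lambda>y. ?S (p1 * s) * (p2 * y * z)" for s] by (simp add: simps)
    also have "\<dots> = ?S (p1 * b) * (p2 * 1 * z)"
      by (rule sw_counit(2)) (simp add: simps)
    finally show ?thesis by simp
  qed
  have "?S b * ?S a = sw ?s (\<lambda>p q. ?s (?e p) (?S b * ?S q)) a"
    by (rule sw_counit(1)[symmetric]) (simp add: simps)
  also have "\<dots> = sw ?s (\<lambda>p q. ?s (?e p) (sw ?s (\<lambda>s t. ?s (?e s) (?S t * ?S q)) b)) a"
    by (subst sw_counit(1)) (simp_all add: simps)
  also have "\<dots> = sw ?s (\<lambda>p q. sw ?s (\<lambda>s t. ?s (?e p) (?s (?e s) (?S t * ?S q))) b) a"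
    by (simp only: sw_scale_fun[OF V])
  also have "\<dots> = sw ?s (\<lambda>p q. sw ?s (\<lambda>p1 p2. ?S (p1 * b) * (p2 * ?S q)) p) a"
    unfolding one by (subst sw_swap[OF V]) (simp only: two)
  also have "\<dots> = sw ?s (\<lambda>p q. sw ?s (\<lambda>q1 q2. ?S (p * b) * (q1 * ?S q2)) q) a"
    by (rule sw_coassoc) (simp_all add: simps)
  also have "\<dots> = sw ?s (\<lambda>p q. ?s (?e q) (?S (p * b) * 1)) a"
    using sw_anti(2)[of ?s "\<lambda>y. ?S (p * b) * y" for p] by (simp add: simps)
  also have "\<dots> = ?S (a * b) * 1"
    by (rule sw_counit(2)) (simp add: simps)
  finally show ?thesis by simp
qed

end

section \<open>The crossed action on a bimodule\<close>

context bimodule_over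
begin

lemma gsc_scale_simps:
  "gsc G c (x + y) = gsc G c x + gsc G c y" "gsc G (c + d) x = gsc G c x + gsc G d x"
  "gsc G c (gsc G d x) = gsc G (c * d) x" "gsc G 1 x = x"
  using gsc_vector_space by (simp_all add: vector_space_def)

lemmas gsc_simps = gsc_scale_simps lact_add_left lact_add_right lact_sc_left lact_sc_right
  ract_add_left ract_add_right ract_sc_left ract_sc_right

lemmas multilinear_simps = sc_vector_space gsc_vector_space vector_space_field
  bilinear_on_def trilinear_def Vector_Spaces.linear_iff sc_simps gsc_simps
  sw_add_fun sw_scale_fun[OF sc_vector_space] sw_scale_fun[OF gsc_vector_space]
  sw_scale_fun[OF vector_space_field] sw_add sw_sc

lemma crossed_act_sw: "crossed_act H G a x = sw (gsc G) (\<lambda>p q. ract G (lact G p x) (anti H q)) a"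
  by (simp add: crossed_act_def sw_def)

lemma crossed_act_add_left: "crossed_act H G (a + b) x = crossed_act H G a x + crossed_act H G b x"
  and crossed_act_sc_left: "crossed_act H G (sc H c a) x = gsc G c (crossed_act H G a x)"
  and crossed_act_add_right: "crossed_act H G a (x + y) = crossed_act H G a x + crossed_act H G a y"
  and crossed_act_sc_right: "crossed_act H G a (gsc G c x) = gsc G c (crossed_act H G a x)"
  unfolding crossed_act_sw by (simp_all add: multilinear_simps)

lemmas crossed_act_simps = crossed_act_add_left crossed_act_sc_left
  crossed_act_add_right crossed_act_sc_right

lemma crossed_act_one: "crossed_act H G 1 x = x"
  unfolding crossed_act_sw
  by (subst sw_one) (simp_all add: multilinear_simps anti_one lact_one ract_one)

lemma ract_sw: "ract G (sw (gsc G) f a) b = sw (gsc G) (\<lambda>p q. ract G (f p q) b) a"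
  and lact_sw: "lact G b (sw (gsc G) f a) = sw (gsc G) (\<lambda>p q. lact G b (f p q)) a"
  by (rule sw_comp, simp add: multilinear_simps)+

text \<open>S(a2 b2) = S(b2) S(a2) nests the conjugation by \<open>b\<close> inside the conjugation
  by \<open>a\<close>.\<close>

lemma crossed_act_mult: "crossed_act H G (a * b) x = crossed_act H G a (crossed_act H G b x)"
  unfolding crossed_act_sw
  by (subst sw_mult)
    (simp_all add: multilinear_simps anti_mult lact_mult ract_mult lact_ract lact_sw ract_sw)

text \<open>In a1 x S(a2) a3 the last two factors collapse to a counit. The formula trades left
  multiplication for the crossed action followed by right multiplication, as needed for the right
  invariance of the crossed action.\<close>

lemma lact_crossed_act: "lact G a x = sw (gsc G) (\<lambda>p q. ract G (crossed_act H G p x) q) a"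
proof -
  let ?S = "anti H"
  have "sw (gsc G) (\<lambda>p q. ract G (crossed_act H G p x) q) a
      = sw (gsc G) (\<lambda>p q. sw (gsc G) (\<lambda>s t. ract G (ract G (lact G s x) (?S t)) q) p) a"
    unfolding crossed_act_sw ract_sw ..
  also have "\<dots> = sw (gsc G) (\<lambda>p q. sw (gsc G) (\<lambda>s t. ract G (ract G (lact G p x) (?S s)) t) q) a"
    by (rule sw_coassoc) (simp_all add: multilinear_simps)
  also have "\<dots> = sw (gsc G) (\<lambda>p q. sw (gsc G) (\<lambda>s t. ract G (lact G p x) (?S s * t)) q) a"
    by (simp add: ract_mult)
  also have "\<dots> = sw (gsc G) (\<lambda>p q. gsc G (cou H q) (ract G (lact G p x) 1)) a"
    by (subst sw_anti(1)) (simp_all add: multilinear_simps)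
  also have "\<dots> = ract G (lact G a x) 1"
    by (rule sw_counit(2)) (simp add: multilinear_simps)
  finally show ?thesis by (simp add: ract_one)
qed

end

section \<open>Coactions and right invariants\<close>

context hopf_bimodule
begin

definition lw :: "('k \<Rightarrow> 'u \<Rightarrow> 'u) \<Rightarrow> ('a \<Rightarrow> 'g \<Rightarrow> 'u::ab_group_add) \<Rightarrow> 'g \<Rightarrow> 'u"
  where "lw r f x = lin_ext r (\<lambda>(p, y). f p y) (lcoact G x)"

definition rw :: "('k \<Rightarrow> 'u \<Rightarrow> 'u) \<Rightarrow> ('g \<Rightarrow> 'a \<Rightarrow> 'u::ab_group_add) \<Rightarrow> 'g \<Rightarrow> 'u"
  where "rw r f x = lin_ext r (\<lambda>(y, p). f y p) (rcoact G x)"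

abbreviation lbil :: "('k \<Rightarrow> 'u \<Rightarrow> 'u) \<Rightarrow> ('a \<Rightarrow> 'g \<Rightarrow> 'u::ab_group_add) \<Rightarrow> bool"
  where "lbil \<equiv> bilinear_on (sc H) UNIV (gsc G) UNIV"

abbreviation rbil :: "('k \<Rightarrow> 'u \<Rightarrow> 'u) \<Rightarrow> ('g \<Rightarrow> 'a \<Rightarrow> 'u::ab_group_add) \<Rightarrow> bool"
  where "rbil \<equiv> bilinear_on (gsc G) UNIV (sc H) UNIV"

lemma lw_linear:
  assumes "vector_space r" "lbil r f"
  shows "Vector_Spaces.linear (gsc G) r (lw r f)"
  unfolding Vector_Spaces.linear_iff lw_def
    tensor_eq_lin_ext[OF lcoact_add assms] tensor_eq_lin_ext[OF lcoact_gsc assms]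
  by (simp add: gsc_vector_space assms(1) lin_ext_add lin_ext_scale)

lemma rw_linear:
  assumes "vector_space r" "rbil r f"
  shows "Vector_Spaces.linear (gsc G) r (rw r f)"
  unfolding Vector_Spaces.linear_iff rw_def
    tensor_eq_lin_ext[OF rcoact_add assms] tensor_eq_lin_ext[OF rcoact_gsc assms]
  by (simp add: gsc_vector_space assms(1) lin_ext_add lin_ext_scale)

lemma lw_add_fun: "vector_space r \<Longrightarrow> lw r (\<lambda>p q. f p q + g p q) a = lw r f a + lw r g a"
  unfolding lw_def using lin_ext_addf[of r "case_prod f" "case_prod g"] by (simp add: case_prod_unfold)

lemma lw_scale_fun: "vector_space r \<Longrightarrow> lw r (\<lambda>p q. r c (f p q)) a = r c (lw r f a)"
  unfolding lw_def using lin_ext_scalef[of r c "case_prod f"] by (simp add: case_prod_unfold)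

lemma lw_comp: "Vector_Spaces.linear s r g \<Longrightarrow> g (lw s f a) = lw r (\<lambda>p q. g (f p q)) a"
  unfolding lw_def using lin_ext_comp[of s r g "case_prod f"] by (simp add: case_prod_unfold)

lemma rw_comp: "Vector_Spaces.linear s r g \<Longrightarrow> g (rw s f a) = rw r (\<lambda>p q. g (f p q)) a"
  unfolding rw_def using lin_ext_comp[of s r g "case_prod f"] by (simp add: case_prod_unfold)

lemma lw_lact:
  assumes "vector_space r" "lbil r f"
  shows "lw r f (lact G a x) = sw r (\<lambda>p q. lw r (\<lambda>s y. f (p * s) (lact G q y)) x) a"
  using tensor_eq_lin_ext[OF lcoact_lact assms]
  by (simp add: sw_def lw_def case_prod_unfold lin_ext_formal_ext[OF assms(1)] lin_ext_gen[OF assms(1)])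

lemma lw_ract:
  assumes "vector_space r" "lbil r f"
  shows "lw r f (ract G x a) = lw r (\<lambda>s y. sw r (\<lambda>p q. f (s * p) (ract G y q)) a) x"
  using tensor_eq_lin_ext[OF lcoact_ract assms]
  by (simp add: sw_def lw_def case_prod_unfold lin_ext_formal_ext[OF assms(1)] lin_ext_gen[OF assms(1)])

lemma rw_lact:
  assumes "vector_space r" "rbil r f"
  shows "rw r f (lact G a x) = sw r (\<lambda>p q. rw r (\<lambda>y s. f (lact G p y) (q * s)) x) a"
  using tensor_eq_lin_ext[OF rcoact_lact assms]
  by (simp add: sw_def rw_def case_prod_unfold lin_ext_formal_ext[OF assms(1)] lin_ext_gen[OF assms(1)])

lemma rw_ract:
  assumes "vector_space r" "rbil r f"
  shows "rw r f (ract G x a) = rw r (\<lambda>y s. sw r (\<lambda>p q. f (ract G y p) (s * q)) a) x"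
  using tensor_eq_lin_ext[OF rcoact_ract assms]
  by (simp add: sw_def rw_def case_prod_unfold lin_ext_formal_ext[OF assms(1)] lin_ext_gen[OF assms(1)])

lemma rw_lw_bicomodule:
  assumes "vector_space r" "trilinear (sc H) (gsc G) (sc H) r f"
  shows "rw r (\<lambda>y a. lw r (\<lambda>p z. f p z a) y) x = lw r (\<lambda>a y. rw r (\<lambda>z p. f a z p) y) x"
  using tensor3_eq_lin_ext[OF bicomodule assms]
  by (simp add: lw_def rw_def case_prod_unfold lin_ext_formal_ext[OF assms(1)] lin_ext_gen[OF assms(1)])

abbreviation "V \<equiv> right_inv H G"

lemma rw_right_inv:
  assumes "x \<in> V" "vector_space r" "rbil r f"
  shows "rw r f x = f x 1"
  using tensor_eq_lin_ext[OF _ assms(2,3)] assms(1)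
  by (simp add: right_inv_def rw_def lin_ext_gen[OF assms(2)])

lemma right_invI:
  assumes "\<And>f. rbil (*) f \<Longrightarrow> rw (*) f x = f x 1"
  shows "x \<in> V"
  unfolding right_inv_def
  using assms by (auto intro!: tensor_eqI simp: rw_def lin_ext_gen[OF vector_space_field])

lemma subspace_right_inv: "module.subspace (gsc G) V"
proof -
  interpret S: vector_space "gsc G" by (rule gsc_vector_space)
  have lin: "rw (*) f (x + y) = rw (*) f x + rw (*) f y" "rw (*) f (gsc G c x) = c * rw (*) f x"
    if "rbil (*) f" for f x y c
    using rw_linear[OF vector_space_field that] by (simp_all add: Vector_Spaces.linear_iff)
  show ?thesis
  proof (rule S.subspaceI)
    show "0 \<in> V"
    proof (rule right_invI)
      fix f assume f: "rbil (*) f"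
      have "f (gsc G 0 0) 1 = 0 * f 0 1" using f unfolding bilinear_on_def by blast
      then show "rw (*) f 0 = f 0 1" using lin(2)[OF f, of 0 0] by simp
    qed
  next
    fix x y assume "x \<in> V" "y \<in> V"
    then show "x + y \<in> V"
      by (intro right_invI) (simp add: lin rw_right_inv vector_space_field, simp add: bilinear_on_def)
  next
    fix c x assume "x \<in> V"
    then show "gsc G c x \<in> V"
      by (intro right_invI) (simp add: lin rw_right_inv vector_space_field, simp add: bilinear_on_def)
  qed
qed

text \<open>Expanding the coaction of a1 \<eta> S(a2) directly would require the coproduct of S(a2).
  Instead p1 \<eta> \<otimes> p2 is written as (p1 \<triangleright> \<eta> \<otimes> 1)
  \<Delta>(p2). Then \<Delta> is applied to the product a2 S(a3) as a whole, and the antipode axiom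
  reduces that product to a counit.\<close>

lemma crossed_act_right_inv:
  assumes "\<eta> \<in> V"
  shows "crossed_act H G a \<eta> \<in> V"
proof (rule right_invI)
  fix f :: "'g \<Rightarrow> 'a \<Rightarrow> 'k" assume f: "rbil (*) f"
  let ?S = "anti H" and ?act = "crossed_act H G"
  note K = vector_space_field
  have fs: "f (x + y) b = f x b + f y b" "f x (b + d) = f x b + f x d"
    "f (gsc G c x) b = c * f x b" "f x (sc H c b) = c * f x b" for x y b c d
    using f by (simp_all add: bilinear_on_def)
  note simps = multilinear_simps fs crossed_act_simps sw_field_mult
  \<comment> \<open>\<open>D y c x\<close> is \<open>f\<close> evaluated at y \<otimes> c multiplied
    on the right by \<Delta>(x).\<close>
  define D where "D y c x = sw (*) (\<lambda>s t. f (ract G y s) (c * t)) x" for y c x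
  have Ds: "D (x + y) b d = D x b d + D y b d" "D x (b + b') d = D x b d + D x b' d"
    "D x b (d + d') = D x b d + D x b d'" "D (gsc G c x) b d = c * D x b d"
    "D x (sc H c b) d = c * D x b d" "D x b (sc H c d) = c * D x b d" for x y b b' c d d'
    unfolding D_def by (simp_all add: simps)
  note simps = multilinear_simps crossed_act_simps sw_field_mult Ds
  \<comment> \<open>Multiplicativity of the coproduct merges \<Delta>(m) and \<Delta>(x) into
    \<Delta>(m x).\<close>
  have one: "sw (*) (\<lambda>s t. D (ract G y s) t x) m = D y 1 (m * x)" for m y x
  proof -
    have "D y 1 (m * x) = sw (*) (\<lambda>p q. sw (*) (\<lambda>s t. f (ract G y (p * s)) (1 * (q * t))) x) m"
      unfolding D_def by (rule sw_mult) (simp_all add: multilinear_simps fs)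
    then show ?thesis by (simp add: D_def ract_mult)
  qed
  have two: "rw (*) f (ract G (lact G p \<eta>) (?S q)) = sw (*) (\<lambda>r m. D (?act r \<eta>) 1 (m * ?S q)) p" for p q
  proof -
    have "rw (*) f (ract G (lact G p \<eta>) (?S q)) = rw (*) (\<lambda>y c. D y c (?S q)) (lact G p \<eta>)"
      unfolding D_def by (rule rw_ract[OF K f])
    also have "\<dots> = sw (*) (\<lambda>s t. rw (*) (\<lambda>y c. D (lact G s y) (t * c) (?S q)) \<eta>) p"
      by (rule rw_lact) (simp_all add: simps)
    also have "\<dots> = sw (*) (\<lambda>s t. D (lact G s \<eta>) (t * 1) (?S q)) p"
      by (subst rw_right_inv[OF assms]) (simp_all add: simps)
    also have "\<dots> = sw (*) (\<lambda>s t. sw (*) (\<lambda>r r'. D (ract G (?act r \<eta>) r') t (?S q)) s) p"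
      by (subst lact_crossed_act, subst sw_comp[where r = "(*)" and g = "\<lambda>y. D y (_ * 1) _"]) (simp_all add: simps)
    also have "\<dots> = sw (*) (\<lambda>r m. sw (*) (\<lambda>r' t. D (ract G (?act r \<eta>) r') t (?S q)) m) p"
      by (rule sw_coassoc) (simp_all add: simps)
    finally show ?thesis by (simp add: one)
  qed
  have "rw (*) f (?act a \<eta>) = sw (*) (\<lambda>p q. rw (*) f (ract G (lact G p \<eta>) (?S q))) a"
    unfolding crossed_act_sw by (rule sw_comp[OF rw_linear[OF K f]])
  also have "\<dots> = sw (*) (\<lambda>p q. sw (*) (\<lambda>r m. D (?act r \<eta>) 1 (m * ?S q)) p) a"
    by (simp add: two)
  also have "\<dots> = sw (*) (\<lambda>r n. sw (*) (\<lambda>m q. D (?act r \<eta>) 1 (m * ?S q)) n) a"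
    by (rule sw_coassoc) (simp_all add: simps)
  also have "\<dots> = sw (*) (\<lambda>r n. cou H n * D (?act r \<eta>) 1 1) a"
    by (subst sw_anti(2)[where f = "\<lambda>x. D _ 1 x"]) (simp_all add: simps)
  also have "\<dots> = D (?act a \<eta>) 1 1"
    by (rule sw_counit(2)) (simp add: simps)
  also have "\<dots> = f (?act a \<eta>) 1"
    unfolding D_def by (subst sw_one) (simp_all add: multilinear_simps fs ract_one)
  finally show "rw (*) f (?act a \<eta>) = f (?act a \<eta>) 1" .
qed

end

text \<open>The choice is under control as soon as one witness is exhibited. For the coaction the
  witness comes from the projection onto right invariants, for \<open>sigma\<close> from a dual
  basis.\<close>

lemma tensor_restrict:
  assumes "Poly_Mapping.keys y \<subseteq> V' \<times> W'" "tensor_eq s V t W y x"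
  shows "Poly_Mapping.keys (tensor_restrict s V V' t W W' x) \<subseteq> V' \<times> W'"
    and "tensor_eq s V t W (tensor_restrict s V V' t W W' x) x"
  using someI_ex[of "\<lambda>y. Poly_Mapping.keys y \<subseteq> V' \<times> W' \<and> tensor_eq s V t W y x"] assms
  unfolding tensor_restrict_def by blast+

section \<open>Inner calculi\<close>

locale inner_fodc = bicovariant_fodc H G
  for H :: "('k::field, 'a::ring_1) hopf_data" and G :: "('k, 'a, 'g::ab_group_add) fodc_data" +
  fixes \<theta> :: 'g
  assumes theta_bi_inv: "\<theta> \<in> bi_inv H G"
    and diff_inner: "diff G a = lact G a \<theta> - ract G \<theta> a"
begin

abbreviation "act \<equiv> crossed_act H G"
abbreviation "\<omega> \<equiv> omega_R H G"

lemma theta_V: "\<theta> \<in> V"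
  using theta_bi_inv by (simp add: bi_inv_def right_inv_def)

lemma lw_theta:
  assumes "vector_space r" "lbil r f"
  shows "lw r f \<theta> = f 1 \<theta>"
proof -
  have "tensor_eq (sc H) UNIV (gsc G) UNIV (lcoact G \<theta>) (gen (1, \<theta>))"
    using theta_bi_inv by (simp add: bi_inv_def)
  from tensor_eq_lin_ext[OF this assms] show ?thesis
    by (simp add: lw_def lin_ext_gen[OF assms(1)])
qed

lemma gsc_minus: "gsc G c (x - y) = gsc G c x - gsc G c y"
proof -
  interpret S: vector_space "gsc G" by (rule gsc_vector_space)
  show ?thesis by (rule S.scale_right_diff_distrib)
qed

text \<open>Put d(a) = a \<theta> - \<theta> a into d(a1) S(a2): the second term contains a1 S(a2)
  and collapses.\<close>

lemma omega_act: "\<omega> a = act a \<theta> - gsc G (cou H a) \<theta>"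
proof -
  have "act a \<theta> = sw (gsc G) (\<lambda>p q. ract G (diff G p) (anti H q) + ract G \<theta> (p * anti H q)) a"
    unfolding crossed_act_sw
    by (simp add: diff_inner ract_mult flip: ract_add_left)
  also have "\<dots> = \<omega> a + sw (gsc G) (\<lambda>p q. ract G \<theta> (p * anti H q)) a"
    by (subst sw_add_fun[OF gsc_vector_space]) (simp add: omega_R_def sw_def)
  also have "sw (gsc G) (\<lambda>p q. ract G \<theta> (p * anti H q)) a = gsc G (cou H a) (ract G \<theta> 1)"
    by (rule sw_anti(2)) (simp add: multilinear_simps)
  finally show ?thesis by (simp add: ract_one)
qed

lemma act_theta: "act a \<theta> = \<omega> a + gsc G (cou H a) \<theta>"
  by (simp add: omega_act)

lemma omega_V: "\<omega> a \<in> V"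
proof -
  interpret S: vector_space "gsc G" by (rule gsc_vector_space)
  show ?thesis unfolding omega_act
    by (intro S.subspace_diff[OF subspace_right_inv] S.subspace_scale[OF subspace_right_inv]
        crossed_act_right_inv theta_V)
qed

lemma omega_add: "\<omega> (a + b) = \<omega> a + \<omega> b"
  and omega_sc: "\<omega> (sc H c a) = gsc G c (\<omega> a)"
  by (simp_all add: omega_act crossed_act_simps cou_add cou_sc gsc_simps gsc_minus)

lemma omega_linear: "Vector_Spaces.linear (sc H) (gsc G) \<omega>"
  by (simp add: Vector_Spaces.linear_iff omega_add omega_sc sc_vector_space gsc_vector_space)

lemma omega_one: "\<omega> 1 = 0"
  by (simp add: omega_act crossed_act_one cou_one gsc_simps)

lemma crossed_act_minus: "act a (x - y) = act a x - act a y"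
  using crossed_act_add_right[of a "x - y" y] by simp

text \<open>Apply \<open>a\<close> to both terms of \<omega>(b) = b \<triangleright> \<theta> -
  \<epsilon>(b) \<theta>. Solved for \<omega>(a b), it splits x(a b) for tangent x, which is the
  heart of the computation of \<open>sigma\<close>.\<close>

lemma act_omega: "act a (\<omega> b) = \<omega> (a * b) - gsc G (cou H b) (\<omega> a)"
  by (simp add: omega_act crossed_act_mult crossed_act_minus crossed_act_sc_right cou_mult gsc_minus
      gsc_simps mult.commute)

text \<open>The standard projection x0 S(x1) of a Hopf module onto its coinvariants. It provides
  representatives of tensors whose legs are right invariant.\<close>

definition proj :: "'g \<Rightarrow> 'g"
  where "proj = rw (gsc G) (\<lambda>y p. ract G y (anti H p))"

lemma proj_linear: "Vector_Spaces.linear (gsc G) (gsc G) proj"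
  unfolding proj_def by (rule rw_linear) (simp_all add: multilinear_simps)

lemma proj_add: "proj (x + y) = proj x + proj y" and proj_gsc: "proj (gsc G c x) = gsc G c (proj x)"
  using proj_linear by (simp_all add: Vector_Spaces.linear_iff)

lemma proj_right_inv: "x \<in> V \<Longrightarrow> proj x = x"
  unfolding proj_def by (subst rw_right_inv) (simp_all add: multilinear_simps anti_one ract_one)

text \<open>The coaction of a \<eta> b has legs a1 \<eta> b1 and a2 b2. In a1 \<eta> b1 S(b2) S(a2)
  the pair b1 S(b2) collapses to \<epsilon>(b), and the crossed action of a remains.\<close>

lemma proj_lact_ract:
  assumes "\<eta> \<in> V"
  shows "proj (ract G (lact G a \<eta>) b) = gsc G (cou H b) (act a \<eta>)"
proof -
  let ?S = "anti H"
  have inner: "sw (gsc G) (\<lambda>p q. ract G (ract G y p) (?S (s * q))) b = gsc G (cou H b) (ract G y (?S s))"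
    for y s
  proof -
    have "sw (gsc G) (\<lambda>p q. ract G (ract G y p) (?S (s * q))) b
        = sw (gsc G) (\<lambda>p q. ract G (ract G y (p * ?S q)) (?S s)) b"
      by (simp add: anti_mult ract_mult)
    also have "\<dots> = gsc G (cou H b) (ract G (ract G y 1) (?S s))"
      by (rule sw_anti(2)) (simp add: multilinear_simps)
    finally show ?thesis by (simp add: ract_one)
  qed
  have "proj (ract G (lact G a \<eta>) b)
      = rw (gsc G) (\<lambda>y s. sw (gsc G) (\<lambda>p q. ract G (ract G y p) (?S (s * q))) b) (lact G a \<eta>)"
    unfolding proj_def by (rule rw_ract) (simp_all add: multilinear_simps)
  also have "\<dots> = rw (gsc G) (\<lambda>y s. gsc G (cou H b) (ract G y (?S s))) (lact G a \<eta>)"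
    by (simp add: inner)
  also have "\<dots> = sw (gsc G) (\<lambda>p q. rw (gsc G) (\<lambda>y s. gsc G (cou H b) (ract G (lact G p y) (?S (q * s)))) \<eta>) a"
    by (rule rw_lact) (simp_all add: multilinear_simps mult.commute)
  also have "\<dots> = sw (gsc G) (\<lambda>p q. gsc G (cou H b) (ract G (lact G p \<eta>) (?S (q * 1)))) a"
    by (subst rw_right_inv[OF assms]) (simp_all add: multilinear_simps mult.commute)
  finally show ?thesis
    by (simp add: crossed_act_sw sw_scale_fun[OF gsc_vector_space])
qed

text \<open>\<Gamma> is spanned by the elements a d(b) = (a b) \<theta> - a \<theta> b. The
  projection turns factors on the right into counits, and after replacing c \<triangleright>
  \<theta> by \<omega>(c) + \<epsilon>(c) \<theta> the multiples of \<theta> cancel.\<close>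

lemma proj_range_omega: "proj x \<in> range \<omega>"
proof -
  interpret S: vector_space "gsc G" by (rule gsc_vector_space)
  interpret P: Vector_Spaces.linear "gsc G" "gsc G" proj by (rule proj_linear)
  interpret W: Vector_Spaces.linear "sc H" "gsc G" \<omega> by (rule omega_linear)
  have sub: "S.subspace (range \<omega>)" by (rule W.subspace_image) simp
  have pd: "proj (lact G a (diff G b)) = \<omega> (a * b) - gsc G (cou H b) (\<omega> a)" for a b
  proof -
    \<comment> \<open>The factor 1 gives both terms the shape treated by
      \<open>proj_lact_ract\<close>.\<close>
    have "lact G a (diff G b) = ract G (lact G (a * b) \<theta>) 1 - ract G (lact G a \<theta>) b"
      using lact_add_right[of a "lact G b \<theta> - ract G \<theta> b" "ract G \<theta> b"]
      by (simp add: diff_inner lact_mult ract_one lact_ract eq_diff_eq)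
    then show ?thesis
      by (simp add: P.diff proj_lact_ract[OF theta_V] cou_one cou_mult act_theta gsc_simps mult.commute)
  qed
  obtain t where "x = lin_ext (gsc G) (\<lambda>(a, b). lact G a (diff G b)) t"
    using diff_surj by (metis surjD)
  then have "proj x = lin_ext (gsc G) (\<lambda>p. proj (case p of (a, b) \<Rightarrow> lact G a (diff G b))) t"
    by (simp add: lin_ext_comp[OF proj_linear])
  also have "\<dots> \<in> range \<omega>"
    unfolding lin_ext_def
    by (intro S.subspace_sum[OF sub] S.subspace_scale[OF sub])
       (auto simp: pd intro!: S.subspace_diff[OF sub] S.subspace_scale[OF sub])
  finally show ?thesis .
qed

lemma proj_V: "proj x \<in> V"
  using proj_range_omega[of x] omega_V by auto

lemma V_eq_range_omega: "V = range \<omega>"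
  using proj_range_omega proj_right_inv omega_V by (metis image_subset_iff subsetI subset_antisym)

lemma omegaE:
  assumes "v \<in> V" obtains a where "v = \<omega> a"
  using assms V_eq_range_omega by auto

text \<open>The two coactions commute, so the right coaction hidden in the projection may be taken
  before the left one; there x is right invariant and S(1) = 1. Hence the second legs of the left
  coaction of a right invariant may be projected freely.\<close>

lemma lw_proj:
  assumes "x \<in> V" "vector_space r" "lbil r f"
  shows "lw r (\<lambda>p z. f p (proj z)) x = lw r f x"
proof -
  interpret R: vector_space r by fact
  have fs: "f (a + b) y = f a y + f b y" "f a (x + y) = f a x + f a y"
    "f (sc H c a) y = r c (f a y)" "f a (gsc G c x) = r c (f a x)" for a b x y c
    using assms(3) by (simp_all add: bilinear_on_def)
  have "lw r (\<lambda>p z. f p (proj z)) x = lw r (\<lambda>p z. rw r (\<lambda>y q. f p (ract G y (anti H q))) z) x"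
    unfolding proj_def
    by (subst rw_comp[where r = r]) (simp_all add: multilinear_simps fs assms(2))
  also have "\<dots> = rw r (\<lambda>y q. lw r (\<lambda>p z. f p (ract G z (anti H q))) y) x"
    by (rule rw_lw_bicomodule[symmetric]) (simp_all add: multilinear_simps fs assms(2))
  also have "\<dots> = lw r (\<lambda>p z. f p (ract G z (anti H 1))) x"
  proof (rule rw_right_inv[OF assms(1,2)])
    have "Vector_Spaces.linear (gsc G) r (lw r (\<lambda>p z. f p (ract G z (anti H q))))" for q
      by (rule lw_linear) (simp_all add: multilinear_simps fs assms(2))
    then show "rbil r (\<lambda>y q. lw r (\<lambda>p z. f p (ract G z (anti H q))) y)"
      by (simp add: multilinear_simps fs assms(2) lw_add_fun lw_scale_fun[OF assms(2)])
  qed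
  finally show ?thesis by (simp add: anti_one ract_one)
qed

lemma crossed_coact:
  assumes "x \<in> V"
  shows "Poly_Mapping.keys (crossed_coact H G x) \<subseteq> UNIV \<times> V"
    and "tensor_eq (sc H) UNIV (gsc G) UNIV (crossed_coact H G x) (lcoact G x)"
proof -
  let ?y = "formal_ext (\<lambda>(p, z). gen (p, proj z)) (lcoact G x)"
  have "Poly_Mapping.keys ?y \<subseteq> UNIV \<times> V"
    by (rule keys_formal_ext) (auto simp: proj_V)
  moreover have "tensor_eq (sc H) UNIV (gsc G) UNIV ?y (lcoact G x)"
  proof (rule tensor_eqI)
    fix f :: "'a \<Rightarrow> 'g \<Rightarrow> 'k" assume "lbil (*) f"
    from lw_proj[OF assms vector_space_field this]
    show "lin_ext (*) (\<lambda>(p, z). f p z) ?y = lin_ext (*) (\<lambda>(p, z). f p z) (lcoact G x)"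
      by (simp add: lw_def case_prod_unfold lin_ext_formal_ext[OF vector_space_field]
          lin_ext_gen[OF vector_space_field])
  qed
  ultimately show "Poly_Mapping.keys (crossed_coact H G x) \<subseteq> UNIV \<times> V"
    and "tensor_eq (sc H) UNIV (gsc G) UNIV (crossed_coact H G x) (lcoact G x)"
    unfolding crossed_coact_def by (rule tensor_restrict)+
qed

text \<open>Here \<open>f\<close> is bilinear on right invariants only. Composing with
  \<open>proj\<close> changes nothing on the chosen legs and makes it bilinear everywhere, so the
  chosen representative can be exchanged for the given coaction.\<close>

lemma crossed_coact_lw:
  assumes "x \<in> V" "vector_space r" "bilinear_on (sc H) UNIV (gsc G) V r f"
  shows "lin_ext r (\<lambda>(p, z). f p z) (crossed_coact H G x) = lw r (\<lambda>p z. f p (proj z)) x"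
proof -
  have "lin_ext r (\<lambda>(p, z). f p z) (crossed_coact H G x)
      = lin_ext r (\<lambda>(p, z). f p (proj z)) (crossed_coact H G x)"
    using crossed_coact(1)[OF assms(1)] by (intro lin_ext_cong) (auto simp: proj_right_inv)
  also have "\<dots> = lin_ext r (\<lambda>(p, z). f p (proj z)) (lcoact G x)"
    by (rule tensor_eq_lin_ext[OF crossed_coact(2)[OF assms(1)] assms(2)])
      (use assms(3) in \<open>simp add: bilinear_on_def proj_V proj_add proj_gsc\<close>)
  finally show ?thesis by (simp add: lw_def)
qed

text \<open>
  The projection turns the second leg of \<open>\<Delta>(S(a))\<close> into its counit, so that
  anticomultiplicativity of the antipode is not needed.
\<close>

lemma lw_omega:
  assumes "vector_space r" "lbil r f"
  shows "lw r (\<lambda>p z. f p (proj z)) (\<omega> a) = sw r (\<lambda>p q. sw r (\<lambda>s t. f (s * anti H q) (\<omega> t)) p) a"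
proof -
  interpret R: vector_space r by fact
  let ?S = "anti H"
  have fs: "f (a + b) y = f a y + f b y" "f a (x + y) = f a x + f a y"
    "f (sc H c a) y = r c (f a y)" "f a (gsc G c x) = r c (f a x)" for a b x y c
    using assms(2) by (simp_all add: bilinear_on_def)
  note simps = multilinear_simps fs assms(1) sw_scale_fun[OF assms(1)] crossed_act_simps omega_add omega_sc
     proj_add proj_gsc R.scale_left_distrib R.scale_right_distrib mult.commute
  let ?F = "\<lambda>p z. f p (proj z)"
  have F: "lbil r ?F" by (simp add: simps)
  have lin: "Vector_Spaces.linear (gsc G) r (lw r ?F)" by (rule lw_linear[OF assms(1) F])
  interpret L: Vector_Spaces.linear "gsc G" r "lw r ?F" by (rule lin)
  \<comment> \<open>Since \<theta> is left invariant, the coaction of p \<theta> x has legs p1 x1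
    and p2 \<theta> x2; the projection replaces x2 by its counit.\<close>
  have one: "lw r ?F (ract G (lact G p \<theta>) x) = sw r (\<lambda>s t. f (s * x) (act t \<theta>)) p" for p x
  proof -
    have "lw r ?F (ract G (lact G p \<theta>) x)
        = lw r (\<lambda>s y. sw r (\<lambda>u v. ?F (s * u) (ract G y v)) x) (lact G p \<theta>)"
      by (rule lw_ract[OF assms(1) F])
    also have "\<dots> = sw r (\<lambda>s t. lw r (\<lambda>s' y. sw r (\<lambda>u v. ?F (s * s' * u) (ract G (lact G t y) v)) x) \<theta>) p"
      by (rule lw_lact[OF assms(1)]) (simp add: simps)
    also have "\<dots> = sw r (\<lambda>s t. sw r (\<lambda>u v. ?F (s * 1 * u) (ract G (lact G t \<theta>) v)) x) p"
      by (subst lw_theta[OF assms(1)]) (simp_all add: simps)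
    also have "\<dots> = sw r (\<lambda>s t. sw r (\<lambda>u v. r (cou H v) (f (s * u) (act t \<theta>))) x) p"
      by (simp add: proj_lact_ract[OF theta_V] fs)
    also have "\<dots> = sw r (\<lambda>s t. f (s * x) (act t \<theta>)) p"
      by (subst sw_counit(2)[OF _, where f = "\<lambda>x. f (_ * x) _"]) (simp_all add: simps)
    finally show ?thesis .
  qed
  have two: "sw r (\<lambda>s t. f (s * x) (gsc G (cou H t) \<theta>)) p = f (p * x) \<theta>" for p x
    using sw_counit(2)[of r "\<lambda>s. f (s * x) \<theta>" p] by (simp add: simps)
  have three: "sw r (\<lambda>p q. f (p * ?S q) \<theta>) a = r (cou H a) (f 1 \<theta>)"
    by (rule sw_anti(2)[of r "\<lambda>x. f x \<theta>"]) (simp add: simps)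
  have "lw r ?F (act a \<theta>) = sw r (\<lambda>p q. sw r (\<lambda>s t. f (s * ?S q) (act t \<theta>)) p) a"
    unfolding crossed_act_sw[of a \<theta>] sw_comp[OF lin] one ..
  \<comment> \<open>The summands \<epsilon>(t) \<theta> of t \<triangleright> \<theta> contribute
    \<epsilon>(a) 1 \<otimes> \<theta>, the coaction of the multiple of \<theta> that is subtracted
    in \<omega>(a).\<close>
  also have "\<dots> = sw r (\<lambda>p q. sw r (\<lambda>s t. f (s * ?S q) (\<omega> t)) p) a + r (cou H a) (f 1 \<theta>)"
    unfolding act_theta fs by (simp add: sw_add_fun assms(1) two[unfolded fs] three)
  finally show ?thesis
    using lw_theta[OF assms(1) F]
    by (simp add: omega_act[of a] L.diff L.scale proj_right_inv[OF theta_V])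
qed

text \<open>Through \<omega> the crossed coaction is the left adjoint coaction a1 S(a3) \<otimes> a2
  of A. Bracket and braiding are both read off from it, the former because X1 Y S(X2) takes the
  value X(a1 S(a3)) Y(a2) at a.\<close>

lemma crossed_coact_omega:
  assumes "vector_space r" "bilinear_on (sc H) UNIV (gsc G) V r f"
  shows "lin_ext r (\<lambda>(p, z). f p z) (crossed_coact H G (\<omega> a))
    = sw r (\<lambda>p q. sw r (\<lambda>s t. f (s * anti H q) (\<omega> t)) p) a"
proof -
  have "lbil r (\<lambda>p z. f p (proj z))"
    using assms(2) by (simp add: bilinear_on_def proj_V proj_add proj_gsc)
  from lw_omega[OF assms(1) this, of a] show ?thesis
    by (simp add: crossed_coact_lw[OF omega_V assms] proj_right_inv[OF omega_V] proj_right_inv[OF proj_V])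
qed

end

section \<open>Finitely many functionals\<close>

text \<open>Induction on the family. The hypothesis applies to the kernel of \<phi> j in U. If
  \<phi> j is nonzero at some u in U, adding a multiple of u moves any t into that kernel, and one
  new coefficient corrects the value at u. U can have any dimension; it will be the space of formal
  sums over pairs of right invariants.\<close>

lemma functional_in_span:
  fixes s :: "'k::field \<Rightarrow> 'v::ab_group_add \<Rightarrow> 'v"
  assumes "vector_space s" "finite I" "module.subspace s U"
    and "\<And>i. i \<in> I \<Longrightarrow> Vector_Spaces.linear s (*) (\<phi> i)" "Vector_Spaces.linear s (*) f"
    and "\<And>t. t \<in> U \<Longrightarrow> (\<And>i. i \<in> I \<Longrightarrow> \<phi> i t = 0) \<Longrightarrow> f t = 0"
  shows "\<exists>c. \<forall>t\<in>U. f t = (\<Sum>i\<in>I. c i * \<phi> i t)"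
  using assms(2,3,4,6)
proof (induction I arbitrary: U)
  case (insert j I)
  interpret S: vector_space s by fact
  have lin: "\<phi> i (x + y) = \<phi> i x + \<phi> i y" "\<phi> i (s c x) = c * \<phi> i x" if "i \<in> insert j I" for i x y c
    using insert.prems(2)[OF that] by (simp_all add: Vector_Spaces.linear_iff)
  have f: "f (x + y) = f x + f y" "f (s c x) = c * f x" for x y c
    using assms(5) by (simp_all add: Vector_Spaces.linear_iff)
  note [simp] = lin(1)[OF insertI1] lin(2)[OF insertI1] lin(1)[OF insertI2] lin(2)[OF insertI2] f
  define U' where "U' = {t \<in> U. \<phi> j t = 0}"
  have "S.subspace U'"
  proof (rule S.subspaceI)
    have "\<phi> j (s 0 0) = 0 * \<phi> j 0" by (simp only: lin(2)[OF insertI1])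
    then show "0 \<in> U'" using S.subspace_0[OF insert.prems(1)] by (simp add: U'_def)
  qed (use insert.prems(1) in \<open>simp_all add: U'_def S.subspace_add S.subspace_scale\<close>)
  with insert obtain c where c: "\<forall>t\<in>U'. f t = (\<Sum>i\<in>I. c i * \<phi> i t)"
    by (force simp: U'_def)
  show ?case
  proof (cases "\<forall>t\<in>U. \<phi> j t = 0")
    case True
    with c have "\<forall>t\<in>U. f t = (\<Sum>i\<in>I. (c(j := 0)) i * \<phi> i t)"
      using insert.hyps by (auto simp: U'_def intro!: sum.cong)
    then show ?thesis using insert.hyps by (intro exI[of _ "c(j := 0)"]) simp
  next
    case False
    then obtain u where u: "u \<in> U" "\<phi> j u \<noteq> 0" by blast
    \<comment> \<open>Chosen so that the two sides agree at \<open>u\<close>.\<close>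
    define d where "d = (f u - (\<Sum>i\<in>I. c i * \<phi> i u)) / \<phi> j u"
    have "f t = d * \<phi> j t + (\<Sum>i\<in>I. c i * \<phi> i t)" if t: "t \<in> U" for t
    proof -
      define b where "b = - (\<phi> j t / \<phi> j u)"
      have b: "b * \<phi> j u = - \<phi> j t" using u by (simp add: b_def)
      have "t + s b u \<in> U'"
        using t u b insert.prems(1) by (simp add: U'_def S.subspace_add S.subspace_scale)
      then have "f (t + s b u) = (\<Sum>i\<in>I. c i * \<phi> i (t + s b u))" using c by blast
      also have "\<dots> = (\<Sum>i\<in>I. c i * \<phi> i t) + b * (\<Sum>i\<in>I. c i * \<phi> i u)"
        by (simp add: sum_distrib_left distrib_left sum.distrib mult.left_commute cong: sum.cong)
      finally have "f t = (\<Sum>i\<in>I. c i * \<phi> i t) - b * (f u - (\<Sum>i\<in>I. c i * \<phi> i u))"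
        by (simp add: algebra_simps)
      also have "b * (f u - (\<Sum>i\<in>I. c i * \<phi> i u)) = - (d * \<phi> j t)"
        using u by (simp add: b_def d_def)
      finally show ?thesis by simp
    qed
    then have "\<forall>t\<in>U. f t = (\<Sum>i\<in>insert j I. (c(j := d)) i * \<phi> i t)"
      using insert.hyps by (auto intro!: sum.cong)
    then show ?thesis by blast
  qed
qed (use assms in auto)

text \<open>A further functional f raises the codimension by at most one: given one j in the old
  kernel with f j nonzero, every vector of the old kernel lies in the new one up to a multiple of
  j.\<close>

lemma finite_codim_kernel:
  fixes s :: "'k::field \<Rightarrow> 'v::ab_group_add \<Rightarrow> 'v"
  assumes "vector_space s" "finite \<Phi>" "\<And>f. f \<in> \<Phi> \<Longrightarrow> Vector_Spaces.linear s (*) f"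
  shows "\<exists>B. finite B \<and> module.span s (B \<union> {a. \<forall>f\<in>\<Phi>. f a = 0}) = UNIV"
  using assms(2,3)
proof (induction \<Phi>)
  interpret S: vector_space s by fact
  case empty
  show ?case by (intro exI[of _ "{}"]) (auto intro: S.span_base)
next
  interpret S: vector_space s by fact
  case (insert f \<Phi>)
  then obtain B where B: "finite B" "S.span (B \<union> {a. \<forall>f\<in>\<Phi>. f a = 0}) = UNIV" by auto
  interpret f: Vector_Spaces.linear s "(*)" f using insert.prems by simp
  have lin: "g (x - s c y) = g x - c * g y" if "g \<in> insert f \<Phi>" for g x y c
  proof -
    interpret g: Vector_Spaces.linear s "(*)" g using insert.prems that by simp
    show ?thesis by (simp add: g.diff g.scale)
  qed
  let ?J = "{a. \<forall>f\<in>\<Phi>. f a = 0}" and ?J' = "{a. \<forall>f\<in>insert f \<Phi>. f a = 0}"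
  show ?case
  proof (cases "\<forall>a\<in>?J. f a = 0")
    case True
    then have "?J' = ?J" by auto
    then show ?thesis using B by (intro exI[of _ B]) (simp only:)
  next
    case False
    then obtain j where j: "j \<in> ?J" "f j \<noteq> 0" by blast
    have "a \<in> S.span (insert j B \<union> ?J')" if a: "a \<in> ?J" for a
    proof -
      define c where "c = f a / f j"
      have "a - s c j \<in> ?J'" using a j by (auto simp: lin c_def)
      then have "(a - s c j) + s c j \<in> S.span (insert j B \<union> ?J')"
        by (intro S.span_add S.span_scale S.span_base) auto
      then show ?thesis by simp
    qed
    then have "B \<union> ?J \<subseteq> S.span (insert j B \<union> ?J')"
      using S.span_superset[of "insert j B \<union> ?J'"] by blast
    then have "S.span (insert j B \<union> ?J') = UNIV"
      using S.span_mono[of "B \<union> ?J" "S.span (insert j B \<union> ?J')"] B(2) by (simp add: S.span_span) blast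
    with B(1) show ?thesis by blast
  qed
qed

text \<open>Extend a basis \<open>A\<close> of a complement-free part, namely of J itself, by
  vectors of \<open>B\<close> to a basis \<open>D\<close> of the whole space. The finitely many
  members of D - A and the coordinates along them describe the quotient by J.\<close>

lemma finite_codim_coordinates:
  fixes s :: "'k::field \<Rightarrow> 'v::ab_group_add \<Rightarrow> 'v"
  assumes "vector_space s" "module.subspace s J" "finite B" "module.span s (B \<union> J) = UNIV"
  obtains E \<phi> where "finite E" "\<And>e. e \<in> E \<Longrightarrow> Vector_Spaces.linear s (*) (\<phi> e)"
    "\<And>e j. e \<in> E \<Longrightarrow> j \<in> J \<Longrightarrow> \<phi> e j = 0" "\<And>a. a - (\<Sum>e\<in>E. s (\<phi> e a) e) \<in> J"
proof -
  interpret S: vector_space s by fact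
  obtain A where A: "A \<subseteq> J" "S.independent A" "J \<subseteq> S.span A"
    by (rule S.maximal_independent_subset)
  obtain D where D: "A \<subseteq> D" "D \<subseteq> B \<union> A" "S.independent D" "B \<union> A \<subseteq> S.span D"
    by (rule S.maximal_independent_subset_extend[of A "B \<union> A"]) (use A in auto)
  have "B \<union> J \<subseteq> S.span D"
    using A(3) D(1,4) S.span_mono[OF D(1)] by blast
  then have D_UNIV: "S.span D = UNIV"
    using assms(4) S.span_mono[of "B \<union> J" "S.span D"] by (simp add: S.span_span) blast
  let ?\<phi> = "\<lambda>e a. S.representation D a e"
  have lin: "Vector_Spaces.linear s (*) (?\<phi> e)" for e
    by (rule S.linear_representation[OF D(3) D_UNIV])
  show thesis
  proof (rule that)
    show "finite (D - A)" using D(2) assms(3) by (auto intro: finite_subset[of _ B])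
    show "Vector_Spaces.linear s (*) (?\<phi> e)" for e by (rule lin)
    show "?\<phi> e j = 0" if e: "e \<in> D - A" and "j \<in> J" for e j
    proof -
      have "j \<in> S.span A" using that A(3) by blast
      then show ?thesis
      proof (induction rule: S.span_induct_alt)
        case (step c u z)
        interpret L: Vector_Spaces.linear s "(*)" "?\<phi> e" by (rule lin)
        have "?\<phi> e u = 0" using step(1) D e by (subst S.representation_basis) auto
        then show ?case using step by (simp add: L.add L.scale)
      qed (simp add: S.representation_zero)
    qed
    show "a - (\<Sum>e\<in>D - A. s (?\<phi> e a) e) \<in> J" for a
    proof -
      let ?N = "{e. ?\<phi> e a \<noteq> 0}"
      have fin: "finite ?N" "finite (D - A)" by (rule S.finite_representation) fact
      have N: "?N \<subseteq> D" using S.representation_ne_zero by blast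
      have "a = (\<Sum>e\<in>?N. s (?\<phi> e a) e)"
        by (rule S.sum_nonzero_representation_eq[symmetric]) (use D D_UNIV in auto)
      also have "\<dots> = (\<Sum>e\<in>?N \<union> (D - A). s (?\<phi> e a) e)"
        by (rule sum.mono_neutral_left) (use fin in auto)
      also have "\<dots> = (\<Sum>e\<in>?N - (D - A). s (?\<phi> e a) e) + (\<Sum>e\<in>D - A. s (?\<phi> e a) e)"
        using sum.union_disjoint[of "?N - (D - A)" "D - A" "\<lambda>e. s (?\<phi> e a) e"] fin by auto
      finally have "a - (\<Sum>e\<in>D - A. s (?\<phi> e a) e) = (\<Sum>e\<in>?N - (D - A). s (?\<phi> e a) e)"
        by (simp add: diff_eq_eq)
      also have "\<dots> \<in> J"
        using N A(1) by (intro S.subspace_sum[OF assms(2)] S.subspace_scale[OF assms(2)]) auto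
      finally show ?thesis .
    qed
  qed
qed

lemma finite_dual_basis:
  fixes s :: "'k::field \<Rightarrow> 'v::ab_group_add \<Rightarrow> 'v"
  assumes "vector_space s" "finite B" "module.span s B = V"
  obtains E \<phi> where "finite E" "E \<subseteq> V" "\<And>e. \<phi> e \<in> dual_space s V"
    "\<And>v. v \<in> V \<Longrightarrow> v = (\<Sum>e\<in>E. s (\<phi> e v) e)"
proof -
  interpret S: vector_space s by fact
  obtain E where E: "E \<subseteq> B" "S.independent E" "B \<subseteq> S.span E"
    by (rule S.maximal_independent_subset)
  have V: "V = S.span E"
    using E assms(3) S.span_mono[OF E(1)] S.span_mono[OF E(3)] by (simp add: S.span_span)
  show thesis
  \<comment> \<open>The value 0 off \<open>V\<close> is the convention of \<open>dual_space\<close>.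
    For e outside E the functional is 0, so membership holds for every index.\<close>
  proof (rule that[of E "\<lambda>e v. if v \<in> V then S.representation E v e else 0"])
    show "finite E" using E assms finite_subset by blast
    then show "v = (\<Sum>e\<in>E. s (if v \<in> V then S.representation E v e else 0) e)" if "v \<in> V" for v
      using that E V by (simp add: S.sum_representation_eq)
    show "E \<subseteq> V" using V S.span_superset by blast
    show "(\<lambda>v. if v \<in> V then S.representation E v e else 0) \<in> dual_space s V" for e
      unfolding dual_space_def V
      using E by (auto simp: S.representation_add S.representation_scale S.span_add S.span_scale)
  qed
qed

section \<open>The finite dual and the tangent space\<close>

lemma linear_fun_eval: "Vector_Spaces.linear fun_scale (*) (\<lambda>f. f a)"
  by (simp add: Vector_Spaces.linear_iff vector_space_fun_scale vector_space_field fun_scale_def)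

lemma subspace_dual_space:
  assumes "vector_space s" "module.subspace s V"
  shows "module.subspace fun_scale (dual_space s V)"
proof -
  interpret S: vector_space s by fact
  interpret F: vector_space fun_scale by (rule vector_space_fun_scale)
  have "v + w \<in> V" "s c v \<in> V" if "v \<in> V" "w \<in> V" for v w c
    using that assms(2) by (auto intro: S.subspace_add S.subspace_scale)
  then show ?thesis
    by (intro F.subspaceI) (auto simp: dual_space_def fun_scale_def algebra_simps)
qed

section \<open>The finite dual of a Hopf algebra\<close>

context hopf_algebra
begin

abbreviation "fd \<equiv> finite_dual H"

lemma dual_space_iff_linear: "f \<in> dual_space (sc H) UNIV \<longleftrightarrow> Vector_Spaces.linear (sc H) (*) f"
  by (auto simp: dual_space_def Vector_Spaces.linear_iff sc_vector_space vector_space_field)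

text \<open>Encodes a two-sided ideal of finite codimension by finitely many functionals that cut it
  out. Intersecting two such ideals becomes a union of sets, which gives closure of the finite dual
  under sums.\<close>

definition cuts_ideal :: "('a \<Rightarrow> 'k) set \<Rightarrow> bool"
  where "cuts_ideal \<Phi> \<longleftrightarrow> finite \<Phi> \<and> (\<forall>g\<in>\<Phi>. Vector_Spaces.linear (sc H) (*) g)
    \<and> (\<forall>a b. (\<forall>g\<in>\<Phi>. g b = 0) \<longrightarrow> (\<forall>g\<in>\<Phi>. g (a * b) = 0 \<and> g (b * a) = 0))"

lemma finite_dualI:
  assumes "Vector_Spaces.linear (sc H) (*) f" "cuts_ideal \<Phi>" "\<And>b. \<forall>g\<in>\<Phi>. g b = 0 \<Longrightarrow> f b = 0"
  shows "f \<in> fd"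
proof -
  interpret S: vector_space "sc H" by (rule sc_vector_space)
  let ?J = "{a. \<forall>g\<in>\<Phi>. g a = 0}"
  have lin: "g 0 = 0" "g (x + y) = g x + g y" "g (sc H c x) = c * g x" if "g \<in> \<Phi>" for g x y c
  proof -
    interpret g: Vector_Spaces.linear "sc H" "(*)" g using assms(2) that by (simp add: cuts_ideal_def)
    show "g 0 = 0" "g (x + y) = g x + g y" "g (sc H c x) = c * g x" by (rule g.zero g.add g.scale)+
  qed
  have "g (x + y) = 0" "g (sc H c x) = 0" if "g \<in> \<Phi>" "g x = 0" "g y = 0" for g x y c
    using lin(2)[OF that(1), of x y] lin(3)[OF that(1), of c x] that by simp_all
  then have "S.subspace ?J" using lin(1) by (intro S.subspaceI) blast+
  moreover obtain B where "finite B" "S.span (B \<union> ?J) = UNIV"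
    using finite_codim_kernel[OF sc_vector_space, of \<Phi>] assms(2) unfolding cuts_ideal_def by blast
  moreover have "\<forall>a. \<forall>j\<in>?J. a * j \<in> ?J \<and> j * a \<in> ?J"
    using assms(2) unfolding cuts_ideal_def by blast
  moreover have "\<forall>j\<in>?J. f j = 0" using assms(3) by blast
  ultimately show ?thesis
    unfolding finite_dual_def dual_space_iff_linear using assms(1) by blast
qed

text \<open>Modulo the ideal J, a is the sum of the e with coefficients \<phi> e a, and f kills J b.
  The last equation is the product transposed: the sum of the \<phi> e \<otimes> f(e _) serves as
  the coproduct of f.\<close>

lemma finite_dual_coordinates:
  assumes "f \<in> fd"
  obtains E \<phi> where "finite E" "cuts_ideal (\<phi> ` E)" "\<forall>b. (\<forall>g\<in>\<phi> ` E. g b = 0) \<longrightarrow> f b = 0"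
    "\<forall>a b. f (a * b) = (\<Sum>e\<in>E. \<phi> e a * f (e * b))"
proof -
  interpret S: vector_space "sc H" by (rule sc_vector_space)
  obtain J B where J: "S.subspace J" "\<And>a j. j \<in> J \<Longrightarrow> a * j \<in> J \<and> j * a \<in> J"
      "finite B" "S.span (B \<union> J) = UNIV" "\<And>j. j \<in> J \<Longrightarrow> f j = 0"
    using assms unfolding finite_dual_def by blast
  interpret f: Vector_Spaces.linear "sc H" "(*)" f
    using assms by (simp add: finite_dual_def dual_space_iff_linear)
  show thesis
  proof (rule finite_codim_coordinates[OF sc_vector_space J(1,3,4)])
    fix E \<phi>
    assume E: "finite E" "\<And>e. e \<in> E \<Longrightarrow> Vector_Spaces.linear (sc H) (*) (\<phi> e)"
      "\<And>e j. e \<in> E \<Longrightarrow> j \<in> J \<Longrightarrow> \<phi> e j = 0" "\<And>a. a - (\<Sum>e\<in>E. sc H (\<phi> e a) e) \<in> J"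
    \<comment> \<open>The common kernel of the coordinates is exactly J: a vector whose coordinates
      all vanish equals its own remainder, which lies in J.\<close>
    have J_iff: "(\<forall>g\<in>\<phi> ` E. g b = 0) \<longleftrightarrow> b \<in> J" for b
      using E(3) E(4)[of b] by (auto simp: sum.neutral)
    have "cuts_ideal (\<phi> ` E)"
      unfolding cuts_ideal_def using E(1,2) J(2) unfolding ball_conj_distrib J_iff by blast
    moreover have "f (a * b) = (\<Sum>e\<in>E. \<phi> e a * f (e * b))" for a b
    proof -
      have "f ((a - (\<Sum>e\<in>E. sc H (\<phi> e a) e)) * b) = 0"
        using J(2,5) E(4) by blast
      then show ?thesis
        by (simp add: left_diff_distrib sum_distrib_right f.diff f.sum f.scale flip: sc_mult_left)
    qed
    ultimately show thesis
      using that[OF E(1), of \<phi>] J(5) unfolding J_iff by blast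
  qed
qed

lemma finite_dual_linear: "f \<in> fd \<Longrightarrow> Vector_Spaces.linear (sc H) (*) f"
  by (simp add: finite_dual_def dual_space_iff_linear)

lemma finite_dual_iff:
  "f \<in> fd \<longleftrightarrow> Vector_Spaces.linear (sc H) (*) f
    \<and> (\<exists>\<Phi>. cuts_ideal \<Phi> \<and> (\<forall>b. (\<forall>g\<in>\<Phi>. g b = 0) \<longrightarrow> f b = 0))"
proof
  assume f: "f \<in> fd"
  obtain E \<phi> where "finite E" "cuts_ideal (\<phi> ` E)" "\<forall>b. (\<forall>g\<in>\<phi> ` E. g b = 0) \<longrightarrow> f b = 0"
    "\<forall>a b. f (a * b) = (\<Sum>e\<in>E. \<phi> e a * f (e * b))"
    by (rule finite_dual_coordinates[OF f])
  with finite_dual_linear[OF f]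
  show "Vector_Spaces.linear (sc H) (*) f
    \<and> (\<exists>\<Phi>. cuts_ideal \<Phi> \<and> (\<forall>b. (\<forall>g\<in>\<Phi>. g b = 0) \<longrightarrow> f b = 0))" by blast
qed (use finite_dualI in blast)

lemma cuts_ideal_Un: "cuts_ideal \<Phi> \<Longrightarrow> cuts_ideal \<Psi> \<Longrightarrow> cuts_ideal (\<Phi> \<union> \<Psi>)"
  unfolding cuts_ideal_def by (simp add: ball_Un)

lemma subspace_finite_dual: "module.subspace fun_scale fd"
proof -
  interpret F: vector_space fun_scale by (rule vector_space_fun_scale)
  show ?thesis
  proof (rule F.subspaceI)
    show "0 \<in> fd"
    proof (rule finite_dualI[of _ "{}"])
      show "Vector_Spaces.linear (sc H) (*) (0 :: 'a \<Rightarrow> 'k)"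
        by (simp add: Vector_Spaces.linear_iff sc_vector_space vector_space_field)
      show "cuts_ideal {}" by (simp add: cuts_ideal_def)
    qed simp
  next
    fix f g assume fg: "f \<in> fd" "g \<in> fd"
    then obtain \<Phi> \<Psi> where *: "cuts_ideal \<Phi>" "\<forall>b. (\<forall>g\<in>\<Phi>. g b = 0) \<longrightarrow> f b = 0"
      "cuts_ideal \<Psi>" "\<forall>b. (\<forall>g\<in>\<Psi>. g b = 0) \<longrightarrow> g b = 0"
      unfolding finite_dual_iff by blast
    show "f + g \<in> fd"
    proof (rule finite_dualI[OF _ cuts_ideal_Un[OF *(1,3)]])
      show "Vector_Spaces.linear (sc H) (*) (f + g)"
        using finite_dual_linear[OF fg(1)] finite_dual_linear[OF fg(2)]
        by (simp add: Vector_Spaces.linear_iff distrib_left)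
    qed (use *(2,4) in \<open>simp add: ball_Un\<close>)
  next
    fix c f assume f: "f \<in> fd"
    then obtain \<Phi> where *: "cuts_ideal \<Phi>" "\<forall>b. (\<forall>g\<in>\<Phi>. g b = 0) \<longrightarrow> f b = 0"
      unfolding finite_dual_iff by blast
    show "fun_scale c f \<in> fd"
    proof (rule finite_dualI[OF _ *(1)])
      show "Vector_Spaces.linear (sc H) (*) (fun_scale c f)"
        using finite_dual_linear[OF f]
        by (simp add: Vector_Spaces.linear_iff fun_scale_def algebra_simps)
    qed (use *(2) in \<open>simp add: fun_scale_def\<close>)
  qed
qed

lemma cou_finite_dual: "cou H \<in> fd"
  by (rule finite_dualI[of _ "{cou H}"]) (auto simp: cou_linear cou_mult cuts_ideal_def)

text \<open>The coordinates modulo the ideal supply the witness. Its second legs vanish on the same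
  ideal because that ideal absorbs left factors.\<close>

lemma dual_cop:
  assumes "f \<in> fd"
  shows "Poly_Mapping.keys (dual_cop H f) \<subseteq> fd \<times> fd"
    and "f (a * b) = lin_ext (*) (\<lambda>(f1, f2). f1 a * f2 b) (dual_cop H f)"
proof -
  obtain E \<phi> where E: "finite E" "cuts_ideal (\<phi> ` E)" "\<forall>b. (\<forall>g\<in>\<phi> ` E. g b = 0) \<longrightarrow> f b = 0"
    "\<forall>a b. f (a * b) = (\<Sum>e\<in>E. \<phi> e a * f (e * b))"
    by (rule finite_dual_coordinates[OF assms])
  let ?t = "\<Sum>e\<in>E. gen (\<phi> e, \<lambda>b. f (e * b)) :: (('a \<Rightarrow> 'k) \<times> ('a \<Rightarrow> 'k)) \<Rightarrow>\<^sub>0 'k"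
  have "\<phi> e \<in> fd" if "e \<in> E" for e
  proof (rule finite_dualI[OF _ E(2)])
    show "Vector_Spaces.linear (sc H) (*) (\<phi> e)" using E(2) that unfolding cuts_ideal_def by blast
  qed (use that in blast)
  moreover have "(\<lambda>b. f (e * b)) \<in> fd" for e
  proof (rule finite_dualI[OF _ E(2)])
    show "Vector_Spaces.linear (sc H) (*) (\<lambda>b. f (e * b))"
      using finite_dual_linear[OF assms]
      by (simp add: Vector_Spaces.linear_iff sc_mult distrib_left[of e])
    show "f (e * b) = 0" if "\<forall>g\<in>\<phi> ` E. g b = 0" for b
    proof -
      have "\<forall>g\<in>\<phi> ` E. g (e * b) = 0" using E(2) that unfolding cuts_ideal_def by blast
      then show ?thesis using E(3) by blast
    qed
  qed
  ultimately have "Poly_Mapping.keys ?t \<subseteq> fd \<times> fd"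
    by (intro order.trans[OF keys_sum]) auto
  moreover have "\<forall>a b. f (a * b) = lin_ext (*) (\<lambda>(f1, f2). f1 a * f2 b) ?t"
    by (simp add: lin_ext_sum[OF vector_space_field] lin_ext_gen[OF vector_space_field]) (rule E(4))
  ultimately have "\<exists>t. Poly_Mapping.keys t \<subseteq> fd \<times> fd
      \<and> (\<forall>a b. f (a * b) = lin_ext (*) (\<lambda>(f1, f2). f1 a * f2 b) t)" by blast
  from someI_ex[OF this]
  show "Poly_Mapping.keys (dual_cop H f) \<subseteq> fd \<times> fd"
    and "f (a * b) = lin_ext (*) (\<lambda>(f1, f2). f1 a * f2 b) (dual_cop H f)"
    unfolding dual_cop_def by blast+
qed

lemma sw_lin_ext_swap:
  "vector_space r \<Longrightarrow> lin_ext r (\<lambda>x. sw r (f x) a) t = sw r (\<lambda>p q. lin_ext r (\<lambda>x. f x p q) t) a"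
  unfolding sw_def case_prod_unfold by (rule lin_ext_swap)

text \<open>The two legs of the chosen coproduct of X meet as X1(a1) X2(S(a3)) and recombine to X(a1
  S(a3)). With this the choice has disappeared from the bracket.\<close>

lemma bracket_sw:
  assumes "X \<in> fd"
  shows "bracket H X Y a = sw (*) (\<lambda>p q. sw (*) (\<lambda>s t. X (s * anti H q) * Y t) p) a"
proof -
  have "bracket H X Y a = lin_ext (*) (\<lambda>x. sw (*) (\<lambda>p q. sw (*) (\<lambda>s t. fst x s * Y t) p * snd x (anti H q)) a)
      (dual_cop H X)"
    unfolding bracket_def
    by (subst lin_ext_comp[OF linear_fun_eval])
      (simp add: dual_mult_def sw_def case_prod_unfold)
  also have "\<dots> = sw (*) (\<lambda>p q. lin_ext (*) (\<lambda>x. sw (*) (\<lambda>s t. fst x s * Y t) p * snd x (anti H q))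
      (dual_cop H X)) a"
    by (rule sw_lin_ext_swap[OF vector_space_field])
  also have "\<dots> = sw (*) (\<lambda>p q. sw (*) (\<lambda>s t.
      lin_ext (*) (\<lambda>x. fst x s * Y t * snd x (anti H q)) (dual_cop H X)) p) a"
    unfolding sw_field_mult(1)[symmetric] sw_lin_ext_swap[OF vector_space_field] ..
  also have "\<dots> = sw (*) (\<lambda>p q. sw (*) (\<lambda>s t.
      lin_ext (*) (\<lambda>(x1, x2). x1 s * x2 (anti H q)) (dual_cop H X) * Y t) p) a"
    unfolding lin_ext_field_mult(1)[symmetric] by (simp add: case_prod_unfold mult_ac)
  finally show ?thesis by (simp add: dual_cop(2)[OF assms])
qed

end

lemma pairing2_gen: "pairing2 (gen (v, w)) f = lin_ext (*) (\<lambda>(x, y). x v * y w) f"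
  by (simp add: pairing2_def lin_ext_gen[OF vector_space_field])

lemma pairing2_right_gen: "pairing2 t (gen (x, y)) = lin_ext (*) (\<lambda>(v, w). x v * y w) t"
  by (simp add: pairing2_def lin_ext_gen[OF vector_space_field])

lemma linear_pairing2_left: "Vector_Spaces.linear formal_scale (*) (\<lambda>t. pairing2 t f)"
  by (simp add: Vector_Spaces.linear_iff pairing2_def vector_space_formal_scale vector_space_field
      lin_ext_add lin_ext_scale)

lemma linear_pairing2_right: "Vector_Spaces.linear formal_scale (*) (pairing2 t)"
  by (simp add: Vector_Spaces.linear_iff pairing2_def vector_space_formal_scale vector_space_field
      lin_ext_add lin_ext_scale case_prod_unfold lin_ext_addf lin_ext_field_mult)

text \<open>Functions are separated by their values, so \<open>tensor_eq_separating\<close> applies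
  with point evaluations on both sides. It serves to identify tensors of functionals that were
  obtained by choice.\<close>

lemma tensor_eq_fun_space:
  fixes x y :: "('a \<Rightarrow> 'k::field) \<times> ('b \<Rightarrow> 'k) \<Rightarrow>\<^sub>0 'k"
  assumes "module.subspace fun_scale V" "module.subspace fun_scale W"
    and "Poly_Mapping.keys x \<subseteq> V \<times> W" "Poly_Mapping.keys y \<subseteq> V \<times> W"
    and "\<And>a b. lin_ext (*) (\<lambda>(f, g). f a * g b) x = lin_ext (*) (\<lambda>(f, g). f a * g b) y"
  shows "tensor_eq fun_scale V fun_scale W x y"
proof (rule tensor_eq_separating[where \<Phi> = "range (\<lambda>a f. f a)" and \<Psi> = "range (\<lambda>a f. f a)"])
  show "v = 0" if "v \<in> V" "\<And>f. f \<in> range (\<lambda>a f. f a) \<Longrightarrow> f v = (0 :: 'k)" for v :: "'a \<Rightarrow> 'k"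
  proof
    show "v a = 0 a" for a using that(2)[OF rangeI[of _ a]] by simp
  qed
  show "w = 0" if "w \<in> W" "\<And>f. f \<in> range (\<lambda>a f. f a) \<Longrightarrow> f w = (0 :: 'k)" for w :: "'b \<Rightarrow> 'k"
  proof
    show "w a = 0 a" for a using that(2)[OF rangeI[of _ a]] by simp
  qed
qed (use assms in \<open>auto simp: vector_space_fun_scale fun_scale_def\<close>)

section \<open>The tangent space as the dual of the right invariants\<close>

locale fin_inner_fodc = inner_fodc H G \<theta>
  for H :: "('k::field, 'a::ring_1) hopf_data" and G :: "('k, 'a, 'g::ab_group_add) fodc_data" and \<theta> +
  assumes finite_dim: "finite_dim_fodc H G"
begin

abbreviation "\<g> \<equiv> tangent_space H G"
abbreviation "V' \<equiv> dual_space (gsc G) V"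

text \<open>The inverse of f \<mapsto> f \<circ> \<omega>, from the tangent space to the dual of
  \<open>V\<close>. The choice of a preimage is harmless because a tangent functional kills the
  kernel of \<omega>.\<close>

definition hat :: "('a \<Rightarrow> 'k) \<Rightarrow> 'g \<Rightarrow> 'k"
  where "hat x v = (if v \<in> V then x (SOME a. \<omega> a = v) else 0)"

lemma tangent_linear: "x \<in> \<g> \<Longrightarrow> Vector_Spaces.linear (sc H) (*) x"
  by (simp add: tangent_space_def dual_space_iff_linear)

lemma hat_omega:
  assumes "x \<in> \<g>"
  shows "hat x (\<omega> a) = x a"
proof -
  interpret x: Vector_Spaces.linear "sc H" "(*)" x using assms by (rule tangent_linear)
  interpret W: Vector_Spaces.linear "sc H" "gsc G" \<omega> by (rule omega_linear)
  \<comment> \<open>Split off the counit part: c - \<epsilon>(c) 1 lies in the ideal because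
    \<omega>(1) = 0, and x(1) = 0 takes care of the rest.\<close>
  have ker: "x c = 0" if "\<omega> c = 0" for c
  proof -
    have "c - sc H (cou H c) 1 \<in> ideal_of H G"
      using that cou_add[of "c - sc H (cou H c) 1" "sc H (cou H c) 1"]
      by (simp add: ideal_of_def W.diff W.scale omega_one cou_sc cou_one)
    then have "x (c - sc H (cou H c) 1) = 0" and "x 1 = 0"
      using assms by (auto simp: tangent_space_def)
    then show ?thesis by (simp add: x.diff x.scale)
  qed
  let ?b = "SOME b. \<omega> b = \<omega> a"
  have "\<omega> ?b = \<omega> a" by (rule someI) (rule refl)
  then have "x (?b - a) = 0" by (intro ker) (simp add: W.diff)
  then show ?thesis by (simp add: hat_def omega_V x.diff)
qed

lemma hat_dual: "x \<in> \<g> \<Longrightarrow> hat x \<in> V'"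
proof -
  assume x: "x \<in> \<g>"
  interpret x: Vector_Spaces.linear "sc H" "(*)" x using x by (rule tangent_linear)
  have "hat x (v + w) = hat x v + hat x w" "hat x (gsc G c v) = c * hat x v" if vw: "v \<in> V" "w \<in> V" for v w c
  proof -
    obtain a b where [simp]: "v = \<omega> a" "w = \<omega> b" using vw by (metis omegaE)
    show "hat x (v + w) = hat x v + hat x w" "hat x (gsc G c v) = c * hat x v"
      using x by (simp_all add: hat_omega x.add x.scale flip: omega_add omega_sc)
  qed
  then show "hat x \<in> V'" by (simp add: dual_space_def hat_def)
qed

lemma hat_add_arg: "x \<in> \<g> \<Longrightarrow> v \<in> V \<Longrightarrow> w \<in> V \<Longrightarrow> hat x (v + w) = hat x v + hat x w"
  and hat_gsc_arg: "x \<in> \<g> \<Longrightarrow> v \<in> V \<Longrightarrow> hat x (gsc G c v) = c * hat x v"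
  using hat_dual unfolding dual_space_def by blast+

lemma tangentI:
  assumes "\<And>v w. v \<in> V \<Longrightarrow> w \<in> V \<Longrightarrow> f (v + w) = f v + f w" "\<And>c v. v \<in> V \<Longrightarrow> f (gsc G c v) = c * f v"
  shows "(\<lambda>a. f (\<omega> a)) \<in> \<g>"
proof -
  interpret S: vector_space "gsc G" by (rule gsc_vector_space)
  have "f (gsc G 0 0) = 0 * f 0"
    by (rule assms(2)) (rule S.subspace_0[OF subspace_right_inv])
  then have "f 0 = 0" by simp
  then show ?thesis
    by (auto simp: tangent_space_def dual_space_iff_linear Vector_Spaces.linear_iff sc_vector_space
        vector_space_field omega_add omega_sc assms omega_V ideal_of_def omega_one)
qed

lemma tangent_of_dual: "f \<in> V' \<Longrightarrow> (\<lambda>a. f (\<omega> a)) \<in> \<g>"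
  by (rule tangentI) (simp_all add: dual_space_def)

lemma hat_tangent_of_dual: "f \<in> V' \<Longrightarrow> hat (\<lambda>a. f (\<omega> a)) = f"
proof
  fix v assume f: "f \<in> V'"
  show "hat (\<lambda>a. f (\<omega> a)) v = f v"
  proof (cases "v \<in> V")
    case True
    then obtain a where "v = \<omega> a" by (rule omegaE)
    then show ?thesis using hat_omega[OF tangent_of_dual[OF f]] by simp
  next
    case False
    then show ?thesis using f by (simp add: hat_def dual_space_def)
  qed
qed

lemma subspace_tangent: "module.subspace fun_scale \<g>"
proof -
  interpret F: vector_space fun_scale by (rule vector_space_fun_scale)
  show ?thesis
    by (rule F.subspaceI)
      (auto simp: tangent_space_def dual_space_def fun_scale_def algebra_simps)
qed

lemma hat_add: "hat (x + y) = hat x + hat y" and hat_scale: "hat (fun_scale c x) = fun_scale c (hat x)"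
  by (auto simp: hat_def fun_scale_def)

lemma act_tangent_bilinear:
  assumes "x \<in> \<g>" "y \<in> \<g>" "w \<in> V"
  shows "bilinear_on (sc H) UNIV (gsc G) V (*) (\<lambda>p z. hat x (act p w) * hat y z)"
  using assms by (auto simp: bilinear_on_def hat_add_arg hat_gsc_arg crossed_act_simps
      crossed_act_right_inv algebra_simps)

text \<open>Compare \<open>bracket_sw\<close> with the adjoint form of the coaction. It follows that
  [X, y](a) depends on a only through \<omega>(a), which is what makes the bracket tangent.\<close>

lemma bracket_coact:
  assumes "X \<in> fd" "y \<in> \<g>"
  shows "bracket H X y a = lin_ext (*) (\<lambda>(p, z). X p * hat y z) (crossed_coact H G (\<omega> a))"
proof -
  have "bilinear_on (sc H) UNIV (gsc G) V (*) (\<lambda>p z. X p * hat y z)"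
    using finite_dual_linear[OF assms(1)] assms(2)
    by (auto simp: bilinear_on_def Vector_Spaces.linear_iff hat_add_arg hat_gsc_arg algebra_simps)
  from crossed_coact_omega[OF vector_space_field this, of a] show ?thesis
    by (simp add: bracket_sw[OF assms(1)] hat_omega[OF assms(2)])
qed

text \<open>A representative is chosen anew for each vector, so \<open>crossed_coact\<close> itself
  need not be additive; its values under bilinear maps are.\<close>

lemma crossed_coact_linear:
  assumes "vector_space r" "bilinear_on (sc H) UNIV (gsc G) V r f" "v \<in> V" "w \<in> V"
  shows "lin_ext r (\<lambda>(p, z). f p z) (crossed_coact H G (v + w))
      = lin_ext r (\<lambda>(p, z). f p z) (crossed_coact H G v) + lin_ext r (\<lambda>(p, z). f p z) (crossed_coact H G w)"
    and "lin_ext r (\<lambda>(p, z). f p z) (crossed_coact H G (gsc G c v))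
      = r c (lin_ext r (\<lambda>(p, z). f p z) (crossed_coact H G v))"
proof -
  interpret S: vector_space "gsc G" by (rule gsc_vector_space)
  have b: "lbil r (\<lambda>p z. f p (proj z))"
    using assms(2) by (simp add: bilinear_on_def proj_V proj_add proj_gsc)
  have "v + w \<in> V" "gsc G c v \<in> V"
    using assms(3,4) by (auto intro: S.subspace_add S.subspace_scale subspace_right_inv)
  then show "lin_ext r (\<lambda>(p, z). f p z) (crossed_coact H G (v + w))
      = lin_ext r (\<lambda>(p, z). f p z) (crossed_coact H G v) + lin_ext r (\<lambda>(p, z). f p z) (crossed_coact H G w)"
    and "lin_ext r (\<lambda>(p, z). f p z) (crossed_coact H G (gsc G c v))
      = r c (lin_ext r (\<lambda>(p, z). f p z) (crossed_coact H G v))"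
    using lw_linear[OF assms(1) b]
    by (simp_all add: crossed_coact_lw[OF _ assms(1,2)] assms(3,4) Vector_Spaces.linear_iff)
qed

text \<open>X ranges over the whole finite dual because the first legs of the coproduct of x, which
  enter \<open>sigma\<close>, need not be tangent.\<close>

lemma bracket_tangent:
  assumes "X \<in> fd" "y \<in> \<g>"
  shows "bracket H X y \<in> \<g>"
proof -
  have "bilinear_on (sc H) UNIV (gsc G) V (*) (\<lambda>p z. X p * hat y z)"
    using finite_dual_linear[OF assms(1)] assms(2)
    by (auto simp: bilinear_on_def Vector_Spaces.linear_iff hat_add_arg hat_gsc_arg algebra_simps)
  note lin = crossed_coact_linear[OF vector_space_field this]
  have "bracket H X y = (\<lambda>a. lin_ext (*) (\<lambda>(p, z). X p * hat y z) (crossed_coact H G (\<omega> a)))"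
    using bracket_coact[OF assms] by blast
  also have "\<dots> \<in> \<g>" by (rule tangentI) (rule lin; assumption)+
  finally show ?thesis .
qed

lemma crossed_act_zero: "act a 0 = 0"
  using crossed_act_minus[of a 0 0] by simp

lemma dual_basis:
  "\<exists>E \<phi>. finite E \<and> E \<subseteq> V \<and> (\<forall>e. \<phi> e \<in> V') \<and> (\<forall>v\<in>V. (\<Sum>e\<in>E. gsc G (\<phi> e v) e) = v)"
proof -
  obtain B where "finite B" "module.span (gsc G) B = V"
    using finite_dim unfolding finite_dim_fodc_def by blast
  then show ?thesis
  proof (rule finite_dual_basis[OF gsc_vector_space])
    fix E \<phi> assume "finite E" "E \<subseteq> V" "\<And>e. \<phi> e \<in> V'"
      "\<And>v. v \<in> V \<Longrightarrow> v = (\<Sum>e\<in>E. gsc G (\<phi> e v) e)"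
    then show ?thesis by (intro exI[of _ E] exI[of _ \<phi>]) auto
  qed
qed

text \<open>The tangent functionals vanish on the annihilator of the crossed module, a two-sided ideal.\<close>

lemma tangent_finite_dual:
  assumes x: "x \<in> \<g>"
  shows "x \<in> fd"
proof -
  interpret S: vector_space "gsc G" by (rule gsc_vector_space)
  obtain E \<phi> where E: "finite E" "E \<subseteq> V" "\<forall>e. \<phi> e \<in> V'"
    "\<forall>v\<in>V. (\<Sum>e\<in>E. gsc G (\<phi> e v) e) = v"
    using dual_basis by blast
  have E_lin: "\<phi> e (v + w) = \<phi> e v + \<phi> e w" "\<phi> e (gsc G c v) = c * \<phi> e v" "\<phi> e 0 = 0"
    if "v \<in> V" "w \<in> V" for e v w c
  proof -
    show "\<phi> e (v + w) = \<phi> e v + \<phi> e w" "\<phi> e (gsc G c v) = c * \<phi> e v"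
      using E(3) that unfolding dual_space_def by blast+
    have "\<phi> e (gsc G 0 v) = 0 * \<phi> e v"
      using E(3) that unfolding dual_space_def by blast
    then show "\<phi> e 0 = 0" by simp
  qed
  \<comment> \<open>Matrix coefficients of the crossed action together with the counit: b
    \<triangleright> \<theta> = 0 alone would give only \<omega>(b) = - \<epsilon>(b)
    \<theta>.\<close>
  define \<Phi> where "\<Phi> = insert (cou H) ((\<lambda>(d, e) a. \<phi> d (act a e)) ` (E \<times> E))"
  have vanish: "(\<forall>g\<in>\<Phi>. g a = 0) \<longleftrightarrow> cou H a = 0 \<and> (\<forall>v\<in>V. act a v = 0)" for a
  proof
    assume *: "\<forall>g\<in>\<Phi>. g a = 0"
    have e: "act a e = 0" if "e \<in> E" for e
    proof -
      have "\<phi> d (act a e) = 0" if "d \<in> E" for d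
        using * that \<open>e \<in> E\<close> by (force simp: \<Phi>_def)
      then have "(\<Sum>d\<in>E. gsc G (\<phi> d (act a e)) d) = 0" by simp
      moreover have "act a e \<in> V" using that E(2) crossed_act_right_inv by blast
      ultimately show ?thesis using E(4) by metis
    qed
    interpret A: Vector_Spaces.linear "gsc G" "gsc G" "act a"
      by (simp add: Vector_Spaces.linear_iff gsc_vector_space crossed_act_simps)
    have "act a v = 0" if "v \<in> V" for v
    proof -
      have "act a (\<Sum>e\<in>E. gsc G (\<phi> e v) e) = 0" by (simp add: A.sum A.scale e)
      then show ?thesis using E(4) that by simp
    qed
    with * show "cou H a = 0 \<and> (\<forall>v\<in>V. act a v = 0)" by (simp add: \<Phi>_def)
  qed (use E(2) E_lin(3) theta_V in \<open>auto simp: \<Phi>_def subset_iff\<close>)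
  have "Vector_Spaces.linear (sc H) (*) (\<lambda>a. \<phi> d (act a e))" if "e \<in> E" for d e
    using that E(2)
    by (auto simp: Vector_Spaces.linear_iff sc_vector_space vector_space_field crossed_act_simps
        E_lin crossed_act_right_inv subset_iff)
  then have "cuts_ideal \<Phi>"
    unfolding cuts_ideal_def ball_conj_distrib vanish
    using E(1) by (auto simp: \<Phi>_def cou_linear cou_mult crossed_act_mult crossed_act_right_inv
        crossed_act_zero)
  then show ?thesis
  proof (rule finite_dualI[OF tangent_linear[OF x]])
    fix b assume "\<forall>g\<in>\<Phi>. g b = 0"
    then have "\<omega> b = 0"
      using theta_V by (simp add: vanish omega_act)
    moreover have "\<omega> 0 = 0"
      using omega_add[of 0 0] by simp
    ultimately have "\<omega> b = \<omega> 0" by simp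
    then have "x b = x 0" by (metis hat_omega[OF x])
    interpret x: Vector_Spaces.linear "sc H" "(*)" x using x by (rule tangent_linear)
    show "x b = 0" by (simp add: \<open>x b = x 0\<close> x.zero)
  qed
qed

text \<open>The pairing of x \<otimes> y with the braiding of v \<otimes> w. For tangent x, y and
  right invariant v, w it depends on no choice of representatives, so \<open>sigma\<close> and
  \<open>sigma_t\<close> can both be compared with it.\<close>

definition braid :: "('a \<Rightarrow> 'k) \<Rightarrow> ('a \<Rightarrow> 'k) \<Rightarrow> 'g \<Rightarrow> 'g \<Rightarrow> 'k"
  where "braid x y v w = lin_ext (*) (\<lambda>(p, z). hat x (act p w) * hat y z) (crossed_coact H G v)"

lemma pairing2_sigma_t:
  "pairing2 (sigma_t H G (gen (v, w))) (gen (hat x, hat y)) = braid x y v w"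
  unfolding pairing2_right_gen sigma_t_def braid_def
  by (simp add: lin_ext_gen[OF vector_space_formal_scale] lin_ext_gen[OF vector_space_field]
      lin_ext_formal_ext[OF vector_space_field] case_prod_unfold)

lemma braid_bilinear:
  assumes "x \<in> \<g>" "y \<in> \<g>"
  shows "bilinear_on (gsc G) V (gsc G) V (*) (braid x y)"
proof -
  note lin = crossed_coact_linear[OF vector_space_field act_tangent_bilinear[OF assms]]
  show ?thesis
    unfolding bilinear_on_def braid_def
  proof (intro conjI ballI allI)
    fix v w w' assume w: "w \<in> V" "w' \<in> V"
    have "hat x (act p (w + w')) * hat y z = hat x (act p w) * hat y z + hat x (act p w') * hat y z" for p z
      using w assms by (simp add: crossed_act_simps hat_add_arg crossed_act_right_inv distrib_right)
    then show "lin_ext (*) (\<lambda>(p, z). hat x (act p (w + w')) * hat y z) (crossed_coact H G v)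
        = lin_ext (*) (\<lambda>(p, z). hat x (act p w) * hat y z) (crossed_coact H G v)
        + lin_ext (*) (\<lambda>(p, z). hat x (act p w') * hat y z) (crossed_coact H G v)"
      by (simp add: case_prod_unfold lin_ext_addf[OF vector_space_field])
  next
    fix c v w assume w: "w \<in> V"
    have "hat x (act p (gsc G c w)) * hat y z = c * (hat x (act p w) * hat y z)" for p z
      using w assms by (simp add: crossed_act_simps hat_gsc_arg crossed_act_right_inv)
    then show "lin_ext (*) (\<lambda>(p, z). hat x (act p (gsc G c w)) * hat y z) (crossed_coact H G v)
        = c * lin_ext (*) (\<lambda>(p, z). hat x (act p w) * hat y z) (crossed_coact H G v)"
      by (simp only: case_prod_unfold lin_ext_field_mult)
  qed (rule lin; assumption)+
qed

lemma braid_omega: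
  assumes "x \<in> \<g>" "y \<in> \<g>" "w \<in> V"
  shows "braid x y (\<omega> a) w = sw (*) (\<lambda>p q. sw (*) (\<lambda>s t. hat x (act (s * anti H q) w) * y t) p) a"
  unfolding braid_def
  using crossed_coact_omega[OF vector_space_field act_tangent_bilinear[OF assms], of a]
  by (simp add: hat_omega[OF assms(2)])

text \<open>This makes \<open>sigma\<close> the transpose of \<open>sigma_t\<close>. The key is that
  x(c b) equals \<open>hat x\<close> at c \<triangleright> \<omega>(b) plus x(c) \<epsilon>(b). For
  c = a1 S(a3) the first summand yields the braiding, and the second yields [x, y](a) \<epsilon>(b),
  precisely the term [x, y] \<otimes> 1 that is subtracted in \<open>sigma\<close>.\<close>

lemma sigma:
  assumes x: "x \<in> \<g>" and y: "y \<in> \<g>"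
  shows "Poly_Mapping.keys (sigma H G x y) \<subseteq> \<g> \<times> \<g>"
    and "lin_ext (*) (\<lambda>(f, g). f a * g b) (sigma H G x y) = braid x y (\<omega> a) (\<omega> b)"
proof -
  interpret S: vector_space "gsc G" by (rule gsc_vector_space)
  note K = vector_space_field
  have x_fd: "x \<in> fd" by (rule tangent_finite_dual[OF x])
  let ?T = "formal_ext (\<lambda>(x1, x2). gen (bracket H x1 y, x2)) (dual_cop H x) - gen (bracket H x y, cou H)"
  have fd_dc: "fst p \<in> fd \<and> snd p \<in> fd" if "p \<in> Poly_Mapping.keys (dual_cop H x)" for p
    using that dual_cop(1)[OF x_fd] by auto
  have br_fd: "bracket H X y \<in> fd" if "X \<in> fd" for X
    by (rule tangent_finite_dual[OF bracket_tangent[OF that y]])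
  have T_keys: "Poly_Mapping.keys ?T \<subseteq> fd \<times> fd"
  proof -
    have "Poly_Mapping.keys (formal_ext (\<lambda>(x1, x2). gen (bracket H x1 y, x2)) (dual_cop H x)) \<subseteq> fd \<times> fd"
      by (rule keys_formal_ext)
        (use fd_dc in \<open>simp add: case_prod_unfold br_fd\<close>)
    moreover have "Poly_Mapping.keys (gen (bracket H x y, cou H)) \<subseteq> fd \<times> fd"
      by (simp add: br_fd[OF x_fd] cou_finite_dual)
    ultimately show ?thesis by (intro order.trans[OF keys_diff]) simp
  qed
  have T_eval: "lin_ext (*) (\<lambda>(f, g). f a * g b) ?T = braid x y (\<omega> a) (\<omega> b)" for a b
  proof -
    let ?S = "anti H" and ?e = "cou H"
    have "lin_ext (*) (\<lambda>(f, g). f a * g b) (formal_ext (\<lambda>(x1, x2). gen (bracket H x1 y, x2)) (dual_cop H x))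
        = lin_ext (*) (\<lambda>p. bracket H (fst p) y a * snd p b) (dual_cop H x)"
      by (simp add: lin_ext_formal_ext[OF K] case_prod_unfold lin_ext_gen[OF K])
    also have "\<dots> = lin_ext (*) (\<lambda>z. sw (*) (\<lambda>p q. sw (*) (\<lambda>s t. fst z (s * ?S q) * y t * snd z b) p) a) (dual_cop H x)"
      by (rule lin_ext_cong) (use fd_dc in \<open>simp add: bracket_sw sw_field_mult\<close>)
    also have "\<dots> = sw (*) (\<lambda>p q. sw (*) (\<lambda>s t. lin_ext (*) (\<lambda>z. fst z (s * ?S q) * y t * snd z b) (dual_cop H x)) p) a"
      by (simp add: sw_lin_ext_swap[OF K])
    also have "\<dots> = sw (*) (\<lambda>p q. sw (*) (\<lambda>s t. x (s * ?S q * b) * y t) p) a"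
    proof -
      have "lin_ext (*) (\<lambda>z. fst z c * y t * snd z b) (dual_cop H x)
          = lin_ext (*) (\<lambda>z. (fst z c * snd z b) * y t) (dual_cop H x)" for c t
        by (simp add: mult_ac)
      then have "lin_ext (*) (\<lambda>z. fst z c * y t * snd z b) (dual_cop H x) = x (c * b) * y t" for c t
        by (simp only: lin_ext_field_mult dual_cop(2)[OF x_fd, of c b] case_prod_unfold)
      then show ?thesis by simp
    qed
    finally have 1: "lin_ext (*) (\<lambda>(f, g). f a * g b) (formal_ext (\<lambda>(x1, x2). gen (bracket H x1 y, x2)) (dual_cop H x))
        = sw (*) (\<lambda>p q. sw (*) (\<lambda>s t. x (s * ?S q * b) * y t) p) a" .
    have 2: "x (c * b) = hat x (act c (\<omega> b)) + x c * ?e b" for c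
    proof -
      have "hat x (act c (\<omega> b)) + hat x (gsc G (?e b) (\<omega> c)) = hat x (\<omega> (c * b))"
        using hat_add_arg[OF x, of "act c (\<omega> b)" "gsc G (?e b) (\<omega> c)"]
        by (simp add: act_omega crossed_act_right_inv omega_V S.subspace_diff S.subspace_scale subspace_right_inv)
      then show ?thesis by (simp add: hat_omega[OF x] hat_gsc_arg[OF x] omega_V mult.commute)
    qed
    have "sw (*) (\<lambda>p q. sw (*) (\<lambda>s t. x (s * ?S q * b) * y t) p) a
        = sw (*) (\<lambda>p q. sw (*) (\<lambda>s t. hat x (act (s * ?S q) (\<omega> b)) * y t + x (s * ?S q) * y t * ?e b) p) a"
    proof -
      have "x (c * b) * y t = hat x (act c (\<omega> b)) * y t + x c * y t * ?e b" for c t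
        by (simp add: 2 distrib_right)
      then show ?thesis by simp
    qed
    also have "\<dots> = braid x y (\<omega> a) (\<omega> b) + bracket H x y a * ?e b"
      by (simp add: sw_add_fun K sw_field_mult braid_omega[OF x y omega_V] bracket_sw[OF x_fd])
    finally show ?thesis
      by (simp add: lin_ext_diff[OF K] 1 lin_ext_gen[OF K])
  qed
  obtain E \<phi> where E: "finite E" "E \<subseteq> V" "\<forall>e. \<phi> e \<in> V'"
    "\<forall>v\<in>V. (\<Sum>e\<in>E. gsc G (\<phi> e v) e) = v"
    using dual_basis by blast
  let ?s = "\<lambda>d e. formal_scale (braid x y d e) (gen (\<lambda>a. \<phi> d (\<omega> a), \<lambda>a. \<phi> e (\<omega> a)))"
  \<comment> \<open>Expansion of \<open>braid x y\<close> in a dual basis: a tensor with tangent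
    legs and the same values as \<open>?T\<close>, hence a witness for the choice in
    \<open>sigma\<close>.\<close>
  define R where "R = (\<Sum>d\<in>E. \<Sum>e\<in>E. ?s d e)"
  have "Poly_Mapping.keys (?s d e) \<subseteq> \<g> \<times> \<g>" for d e
    using tangent_of_dual[OF E(3)[rule_format]] by (auto simp: in_keys_iff lookup_single when_def split: if_splits)
  then have R_keys: "Poly_Mapping.keys R \<subseteq> \<g> \<times> \<g>"
    unfolding R_def by (intro order.trans[OF keys_sum] UN_least) blast
  have R_eval: "lin_ext (*) (\<lambda>(f, g). f a * g b) R = braid x y (\<omega> a) (\<omega> b)" for a b
  proof -
    note b = braid_bilinear[OF x y]
    have "braid x y (\<omega> a) (\<omega> b) = braid x y (\<Sum>d\<in>E. gsc G (\<phi> d (\<omega> a)) d) (\<omega> b)"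
      using E(4) omega_V by simp
    also have "\<dots> = (\<Sum>d\<in>E. \<phi> d (\<omega> a) * braid x y d (\<omega> b))"
      using E(2) by (intro bilinear_on_left_sum[OF b omega_V gsc_vector_space subspace_right_inv E(1)]) auto
    also have "\<dots> = (\<Sum>d\<in>E. \<phi> d (\<omega> a) * braid x y d (\<Sum>e\<in>E. gsc G (\<phi> e (\<omega> b)) e))"
      using E(4) omega_V by simp
    also have "\<dots> = (\<Sum>d\<in>E. \<phi> d (\<omega> a) * (\<Sum>e\<in>E. \<phi> e (\<omega> b) * braid x y d e))"
      using E(2)
      by (intro sum.cong refl arg_cong2[where f = "(*)"]
          bilinear_on_right_sum[OF b _ gsc_vector_space subspace_right_inv E(1)]) auto
    finally show ?thesis
      by (simp add: R_def lin_ext_sum[OF K] lin_ext_scale[OF K] lin_ext_gen[OF K] sum_distrib_left mult_ac)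
  qed
  have "tensor_eq fun_scale fd fun_scale fd R ?T"
    by (rule tensor_eq_fun_space)
      (use R_keys T_keys R_eval T_eval tangent_finite_dual in \<open>auto simp: subspace_finite_dual\<close>)
  note sig = tensor_restrict[OF R_keys this, folded sigma_def]
  show "Poly_Mapping.keys (sigma H G x y) \<subseteq> \<g> \<times> \<g>" by (rule sig(1))
  have "bilinear_on fun_scale fd fun_scale fd (*) (\<lambda>f g. f a * g b)"
    by (simp add: bilinear_on_def fun_scale_def algebra_simps)
  from tensor_eq_lin_ext[OF sig(2) K this] T_eval
  show "lin_ext (*) (\<lambda>(f, g). f a * g b) (sigma H G x y) = braid x y (\<omega> a) (\<omega> b)" by simp
qed

end

section \<open>Isomorphisms of quotient algebras\<close>

text \<open>The isomorphisms themselves are collected: passing to quotients uses the map and not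
  only its existence.\<close>

definition alg_iso :: "('k, 'b) module \<Rightarrow> ('k, 'c) module \<Rightarrow> ('b \<Rightarrow> 'c) set"
  where "alg_iso B C = {h \<in> ring_iso B C. \<forall>c. \<forall>x \<in> carrier B. h (c \<odot>\<^bsub>B\<^esub> x) = c \<odot>\<^bsub>C\<^esub> h x}"

text \<open>The preimage of an ideal under a homomorphism is an ideal.\<close>

lemma hom_genideal_subset:
  assumes "ring B" "ring C" "h \<in> ring_hom B C" "S \<subseteq> carrier B"
  shows "h ` (Idl\<^bsub>B\<^esub> S) \<subseteq> Idl\<^bsub>C\<^esub> (h ` S)"
proof -
  interpret B: ring B by fact
  interpret C: ring C by fact
  interpret h: ring_hom_ring B C h
    using assms(3) by unfold_locales
  have S: "h ` S \<subseteq> carrier C" using assms(4) h.hom_closed by blast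
  then have "ideal {r \<in> carrier B. h r \<in> Idl\<^bsub>C\<^esub> (h ` S)} B"
    by (intro h.ideal_vimage C.genideal_ideal)
  moreover have "S \<subseteq> {r \<in> carrier B. h r \<in> Idl\<^bsub>C\<^esub> (h ` S)}"
    using assms(4) C.genideal_self[OF S] by blast
  ultimately have "Idl\<^bsub>B\<^esub> S \<subseteq> {r \<in> carrier B. h r \<in> Idl\<^bsub>C\<^esub> (h ` S)}"
    by (rule B.genideal_minimal)
  then show ?thesis by blast
qed

text \<open>Apply \<open>hom_genideal_subset\<close> to the map and to its inverse.\<close>

lemma iso_genideal:
  assumes "ring B" "ring C" and h: "h \<in> ring_iso B C" and S: "S \<subseteq> carrier B"
  shows "h ` (Idl\<^bsub>B\<^esub> S) = Idl\<^bsub>C\<^esub> (h ` S)"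
proof
  have hom: "h \<in> ring_hom B C" and bij: "bij_betw h (carrier B) (carrier C)"
    using h by (simp_all add: ring_iso_def)
  let ?g = "inv_into (carrier B) h"
  have "?g \<in> ring_hom C B"
    using ring_iso_set_sym[OF assms(1) h] by (simp add: ring_iso_def)
  moreover have "h ` S \<subseteq> carrier C" using S bij by (auto simp: bij_betw_def)
  ultimately have "?g ` (Idl\<^bsub>C\<^esub> (h ` S)) \<subseteq> Idl\<^bsub>B\<^esub> (?g ` h ` S)"
    by (intro hom_genideal_subset assms(1,2))
  also have "?g ` h ` S = S"
    using bij S by (simp add: bij_betw_def inv_into_image_cancel)
  finally have "h ` ?g ` (Idl\<^bsub>C\<^esub> (h ` S)) \<subseteq> h ` (Idl\<^bsub>B\<^esub> S)" by (rule image_mono)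
  moreover have "Idl\<^bsub>C\<^esub> (h ` S) \<subseteq> carrier C"
    using ring.genideal_ideal[OF assms(2) \<open>h ` S \<subseteq> carrier C\<close>]
    by (meson additive_subgroup.a_subset ideal.axioms(1))
  then have "h ` ?g ` (Idl\<^bsub>C\<^esub> (h ` S)) = Idl\<^bsub>C\<^esub> (h ` S)"
    using bij by (simp add: bij_betw_def image_inv_into_cancel)
  ultimately show "Idl\<^bsub>C\<^esub> (h ` S) \<subseteq> h ` (Idl\<^bsub>B\<^esub> S)" by simp
  show "h ` (Idl\<^bsub>B\<^esub> S) \<subseteq> Idl\<^bsub>C\<^esub> (h ` S)"
    by (rule hom_genideal_subset[OF assms(1,2) hom S])
qed

lemma quot_alg_simps:
  "carrier (quot_alg B I) = (\<Union>a\<in>carrier B. {I +>\<^bsub>B\<^esub> a})" "mult (quot_alg B I) = rcoset_mult B I"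
  "one (quot_alg B I) = I +>\<^bsub>B\<^esub> \<one>\<^bsub>B\<^esub>" "add (quot_alg B I) = set_add B"
  "smult (quot_alg B I) = (\<lambda>c X. \<Union>x\<in>X. I +>\<^bsub>B\<^esub> (c \<odot>\<^bsub>B\<^esub> x))"
  by (simp_all add: quot_alg_def ring.defs module.defs FactRing_def A_RCOSETS_def')

text \<open>Cosets are sets of representatives and the quotient operations are unions over them, so
  taking images under \<open>h\<close> commutes with each operation.\<close>

lemma alg_iso_quot_alg:
  assumes "ring B" "I \<subseteq> carrier B" and h: "h \<in> alg_iso B C"
    and smult: "\<And>c x. x \<in> carrier B \<Longrightarrow> c \<odot>\<^bsub>B\<^esub> x \<in> carrier B"
  shows "(`) h \<in> alg_iso (quot_alg B I) (quot_alg C (h ` I))"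
proof -
  interpret B: ring B by fact
  have hom: "x \<in> carrier B \<Longrightarrow> h x \<in> carrier C"
      "x \<in> carrier B \<Longrightarrow> y \<in> carrier B \<Longrightarrow> h (x \<otimes>\<^bsub>B\<^esub> y) = h x \<otimes>\<^bsub>C\<^esub> h y"
      "x \<in> carrier B \<Longrightarrow> y \<in> carrier B \<Longrightarrow> h (x \<oplus>\<^bsub>B\<^esub> y) = h x \<oplus>\<^bsub>C\<^esub> h y"
      "x \<in> carrier B \<Longrightarrow> h (c \<odot>\<^bsub>B\<^esub> x) = c \<odot>\<^bsub>C\<^esub> h x" for x y c
    using h ring_iso_memE[of h B C] unfolding alg_iso_def by blast+
  have one: "h \<one>\<^bsub>B\<^esub> = \<one>\<^bsub>C\<^esub>" and bij: "bij_betw h (carrier B) (carrier C)"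
    using h by (simp_all add: alg_iso_def ring_iso_def ring_hom_def)
  have coset: "h ` (I +>\<^bsub>B\<^esub> a) = h ` I +>\<^bsub>C\<^esub> h a" if "a \<in> carrier B" for a
    unfolding a_r_coset_def' image_UN UN_simps(10)
    using assms(2) that by (auto simp: hom subset_iff)
  have sub: "I +>\<^bsub>B\<^esub> a \<subseteq> carrier B" if "a \<in> carrier B" for a
    by (rule B.a_r_coset_subset_G[OF assms(2) that])
  have car: "X \<subseteq> carrier B" if "X \<in> carrier (quot_alg B I)" for X
    using that sub by (auto simp: quot_alg_simps)
  show ?thesis
    unfolding alg_iso_def
  proof (intro CollectI conjI ring_iso_memI ballI allI)
    fix X assume X: "X \<in> carrier (quot_alg B I)"
    then obtain a where a: "a \<in> carrier B" "X = I +>\<^bsub>B\<^esub> a" by (auto simp: quot_alg_simps)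
    then show "h ` X \<in> carrier (quot_alg C (h ` I))"
      using hom(1)[OF a(1)] by (auto simp: quot_alg_simps coset)
    fix c
    have "h ` (\<Union>x\<in>X. I +>\<^bsub>B\<^esub> (c \<odot>\<^bsub>B\<^esub> x)) = (\<Union>x\<in>X. h ` I +>\<^bsub>C\<^esub> (c \<odot>\<^bsub>C\<^esub> h x))"
      unfolding image_UN using car[OF X]
      by (intro SUP_cong refl) (metis coset hom(4) smult subsetD)
    then show "h ` (c \<odot>\<^bsub>quot_alg B I\<^esub> X) = c \<odot>\<^bsub>quot_alg C (h ` I)\<^esub> h ` X"
      by (simp add: quot_alg_simps)
  next
    fix X Y assume X: "X \<in> carrier (quot_alg B I)" and Y: "Y \<in> carrier (quot_alg B I)"
    have "h ` (\<Union>x\<in>X. \<Union>y\<in>Y. I +>\<^bsub>B\<^esub> (x \<otimes>\<^bsub>B\<^esub> y)) = (\<Union>x\<in>X. \<Union>y\<in>Y. h ` I +>\<^bsub>C\<^esub> (h x \<otimes>\<^bsub>C\<^esub> h y))"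
      unfolding image_UN using car[OF X] car[OF Y]
      by (intro SUP_cong refl) (metis B.m_closed coset hom(2) subsetD)
    then show "h ` (X \<otimes>\<^bsub>quot_alg B I\<^esub> Y) = h ` X \<otimes>\<^bsub>quot_alg C (h ` I)\<^esub> h ` Y"
      by (simp add: quot_alg_simps rcoset_mult_def)
    have "h ` (\<Union>x\<in>X. \<Union>y\<in>Y. {x \<oplus>\<^bsub>B\<^esub> y}) = (\<Union>x\<in>X. \<Union>y\<in>Y. {h x \<oplus>\<^bsub>C\<^esub> h y})"
      unfolding image_UN using car[OF X] car[OF Y]
      by (intro SUP_cong refl) (auto simp: hom subset_iff)
    then show "h ` (X \<oplus>\<^bsub>quot_alg B I\<^esub> Y) = h ` X \<oplus>\<^bsub>quot_alg C (h ` I)\<^esub> h ` Y"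
      by (simp add: quot_alg_simps set_add_def')
  next
    show "h ` \<one>\<^bsub>quot_alg B I\<^esub> = \<one>\<^bsub>quot_alg C (h ` I)\<^esub>"
      by (simp add: quot_alg_simps coset one)
    have "inj_on ((`) h) (carrier (quot_alg B I))"
      using bij car by (intro inj_onI) (metis bij_betw_def inj_on_image_eq_iff)
    moreover have "(`) h ` carrier (quot_alg B I) = carrier (quot_alg C (h ` I))"
    proof -
      have "(`) h ` carrier (quot_alg B I) = (\<Union>a\<in>carrier B. {h ` I +>\<^bsub>C\<^esub> h a})"
        unfolding quot_alg_simps image_UN by (auto simp: coset)
      also have "\<dots> = (\<Union>a\<in>h ` carrier B. {h ` I +>\<^bsub>C\<^esub> a})" by simp
      also have "h ` carrier B = carrier C" using bij by (simp only: bij_betw_def)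
      finally show ?thesis by (simp only: quot_alg_simps)
    qed
    ultimately show "bij_betw ((`) h) (carrier (quot_alg B I)) (carrier (quot_alg C (h ` I)))"
      by (simp only: bij_betw_def)
  qed
qed

section \<open>Free algebras\<close>

abbreviation free_mult :: "('v list \<Rightarrow>\<^sub>0 'k::field) \<Rightarrow> ('v list \<Rightarrow>\<^sub>0 'k) \<Rightarrow> ('v list \<Rightarrow>\<^sub>0 'k)" (infixl \<open>\<odot>\<odot>\<close> 70)
  where "p \<odot>\<odot> q \<equiv> formal_ext (\<lambda>u. formal_ext (\<lambda>w. gen (u @ w)) q) p"

text \<open>Letters go to arbitrary elements rather than to letters, since the shift has a constant
  term.\<close>

primrec word_map :: "('v \<Rightarrow> ('w list \<Rightarrow>\<^sub>0 'k::field)) \<Rightarrow> 'v list \<Rightarrow> ('w list \<Rightarrow>\<^sub>0 'k)"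
  where "word_map \<phi> [] = gen []"
  | "word_map \<phi> (v # u) = \<phi> v \<odot>\<odot> word_map \<phi> u"

definition free_map :: "('v \<Rightarrow> ('w list \<Rightarrow>\<^sub>0 'k::field)) \<Rightarrow> ('v list \<Rightarrow>\<^sub>0 'k) \<Rightarrow> ('w list \<Rightarrow>\<^sub>0 'k)"
  where "free_map \<phi> = formal_ext (word_map \<phi>)"

lemma free_mult_one: "gen [] \<odot>\<odot> p = p" "p \<odot>\<odot> gen [] = p"
  by (simp_all add: formal_ext_simps gen_id)

lemma word_map_append: "word_map \<phi> (u @ w) = word_map \<phi> u \<odot>\<odot> word_map \<phi> w"
  by (induction u) (simp_all add: free_mult_one mult_assoc_free)

lemma free_map_gen: "free_map \<phi> (gen u) = word_map \<phi> u"
  by (simp add: free_map_def formal_ext_simps)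

lemma free_map_add: "free_map \<phi> (p + q) = free_map \<phi> p + free_map \<phi> q"
  and free_map_scale: "free_map \<phi> (formal_scale c p) = formal_scale c (free_map \<phi> p)"
  and free_map_diff: "free_map \<phi> (p - q) = free_map \<phi> p - free_map \<phi> q"
  by (simp_all add: free_map_def formal_ext_simps lin_ext_diff[OF vector_space_formal_scale])

lemma free_map_mult: "free_map \<phi> (p \<odot>\<odot> q) = free_map \<phi> p \<odot>\<odot> free_map \<phi> q"
proof (induction p rule: formal_induct)
  case (gen u)
  show ?case
    by (induction q rule: formal_induct)
      (simp_all add: formal_ext_simps free_map_add free_map_scale free_map_gen word_map_append)
qed (simp_all add: formal_ext_simps free_map_add free_map_scale)

lemma keys_free_mult:
  "Poly_Mapping.keys p \<subseteq> lists V \<Longrightarrow> Poly_Mapping.keys q \<subseteq> lists V \<Longrightarrow> Poly_Mapping.keys (p \<odot>\<odot> q) \<subseteq> lists V"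
  by (intro keys_formal_ext) auto

lemma keys_free_map:
  assumes "\<And>v. v \<in> V \<Longrightarrow> Poly_Mapping.keys (\<phi> v) \<subseteq> lists W" "Poly_Mapping.keys p \<subseteq> lists V"
  shows "Poly_Mapping.keys (free_map \<phi> p) \<subseteq> lists W"
proof -
  have "Poly_Mapping.keys (word_map \<phi> u) \<subseteq> lists W" if "u \<in> lists V" for u
    using that by (induction u) (simp_all add: keys_free_mult assms(1))
  then show ?thesis
    unfolding free_map_def using assms(2) by (intro keys_formal_ext) blast
qed

text \<open>Both maps are multiplicative and linear, so it is enough that their composite fixes
  letters.\<close>

lemma free_map_inverse:
  assumes "\<And>v. v \<in> V \<Longrightarrow> free_map \<psi> (\<phi> v) = gen [v]" "Poly_Mapping.keys p \<subseteq> lists V"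
  shows "free_map \<psi> (free_map \<phi> p) = p"
proof -
  have w: "free_map \<psi> (word_map \<phi> u) = gen u" if "u \<in> lists V" for u
    using that by (induction u) (simp_all add: free_map_gen free_map_mult assms(1) formal_ext_simps)
  have "free_map \<psi> (free_map \<phi> p) = formal_ext (\<lambda>u. free_map \<psi> (word_map \<phi> u)) p"
    unfolding free_map_def by (rule lin_ext_formal_ext[OF vector_space_formal_scale])
  also have "\<dots> = formal_ext gen p"
    by (rule lin_ext_cong) (use w assms(2) in blast)
  finally show ?thesis by (simp add: gen_id)
qed

lemma free_map_alg_iso:
  fixes \<phi> :: "'v \<Rightarrow> ('w list \<Rightarrow>\<^sub>0 'k::field)" and \<psi> :: "'w \<Rightarrow> ('v list \<Rightarrow>\<^sub>0 'k)"
  assumes "\<And>v. v \<in> V \<Longrightarrow> Poly_Mapping.keys (\<phi> v) \<subseteq> lists W"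
    and "\<And>w. w \<in> W \<Longrightarrow> Poly_Mapping.keys (\<psi> w) \<subseteq> lists V"
    and "\<And>v. v \<in> V \<Longrightarrow> free_map \<psi> (\<phi> v) = gen [v]" "\<And>w. w \<in> W \<Longrightarrow> free_map \<phi> (\<psi> w) = gen [w]"
  shows "free_map \<phi> \<in> alg_iso (free_alg V) (free_alg W)"
proof -
  have car: "carrier (free_alg V :: ('k, 'v list \<Rightarrow>\<^sub>0 'k) module) = {p. Poly_Mapping.keys p \<subseteq> lists V}"
    "carrier (free_alg W :: ('k, 'w list \<Rightarrow>\<^sub>0 'k) module) = {p. Poly_Mapping.keys p \<subseteq> lists W}"
    by (simp_all add: free_alg_def)
  have maps: "Poly_Mapping.keys (free_map \<phi> p) \<subseteq> lists W" if "Poly_Mapping.keys p \<subseteq> lists V" for p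
    using assms(1) that by (rule keys_free_map)
  have maps': "Poly_Mapping.keys (free_map \<psi> p) \<subseteq> lists V" if "Poly_Mapping.keys p \<subseteq> lists W" for p
    using assms(2) that by (rule keys_free_map)
  have "bij_betw (free_map \<phi>) (carrier (free_alg V)) (carrier (free_alg W))"
    unfolding car
  proof (rule bij_betw_byWitness[where f' = "free_map \<psi>"])
    show "\<forall>p\<in>{p. Poly_Mapping.keys p \<subseteq> lists V}. free_map \<psi> (free_map \<phi> p) = p"
      using free_map_inverse[OF assms(3)] by blast
    show "\<forall>p\<in>{p. Poly_Mapping.keys p \<subseteq> lists W}. free_map \<phi> (free_map \<psi> p) = p"
      using free_map_inverse[OF assms(4)] by blast
  qed (use maps maps' in blast)+
  then show ?thesis
    unfolding alg_iso_def
    by (intro CollectI conjI ring_iso_memI)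
      (simp_all add: free_alg_def free_map_mult free_map_add free_map_scale free_map_gen maps)
qed

lemma smult_free_alg: "x \<in> carrier (free_alg V) \<Longrightarrow> c \<odot>\<^bsub>free_alg V\<^esub> x \<in> carrier (free_alg V)"
  by (auto simp: free_alg_def in_keys_iff)

text \<open>Closure under scalars is not an axiom of a ring ideal; it holds because scaling is
  multiplication by a multiple of the empty word.\<close>

lemma free_ideal_closed:
  assumes "ideal K (free_alg V)"
  shows "0 \<in> K" "p \<in> K \<Longrightarrow> q \<in> K \<Longrightarrow> p + q \<in> K" "p \<in> K \<Longrightarrow> formal_scale c p \<in> K"
    "p \<in> K \<Longrightarrow> q \<in> K \<Longrightarrow> p - q \<in> K"
    "p \<in> K \<Longrightarrow> Poly_Mapping.keys q \<subseteq> lists V \<Longrightarrow> p \<odot>\<odot> q \<in> K"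
    "p \<in> K \<Longrightarrow> Poly_Mapping.keys q \<subseteq> lists V \<Longrightarrow> q \<odot>\<odot> p \<in> K"
proof -
  note add_sub = ideal.axioms(1)[OF assms]
  show "0 \<in> K"
    using additive_subgroup.zero_closed[OF add_sub] by (simp add: free_alg_def)
  show add: "p + q \<in> K" if "p \<in> K" "q \<in> K" for p q
    using additive_subgroup.a_closed[OF add_sub that] by (simp add: free_alg_def)
  show l: "q \<odot>\<odot> p \<in> K" if "p \<in> K" "Poly_Mapping.keys q \<subseteq> lists V" for p q
    using ideal.I_l_closed[OF assms that(1), of q] that(2) by (simp add: free_alg_def)
  show "p \<odot>\<odot> q \<in> K" if "p \<in> K" "Poly_Mapping.keys q \<subseteq> lists V" for p q
    using ideal.I_r_closed[OF assms that(1), of q] that(2) by (simp add: free_alg_def)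
  show scale: "formal_scale c p \<in> K" if "p \<in> K" for c p
  proof -
    have "formal_scale c p = formal_scale c (gen []) \<odot>\<odot> p"
      by (simp add: formal_ext_simps gen_id)
    moreover have "Poly_Mapping.keys (formal_scale c (gen [])) \<subseteq> lists V"
      by (auto simp: in_keys_iff lookup_single when_def split: if_splits)
    ultimately show ?thesis using l[OF that] by metis
  qed
  show "p - q \<in> K" if "p \<in> K" "q \<in> K" for p q
  proof -
    have "p - q = p + formal_scale (- 1) q" by (rule poly_mapping_eqI) (simp add: lookup_add lookup_minus)
    then show ?thesis using add scale that by metis
  qed
qed

lemma free_coset: "K +>\<^bsub>free_alg V\<^esub> p = (\<lambda>l. l + p) ` K"
  by (auto simp: a_r_coset_def' free_alg_def)

lemma free_coset_eq:
  assumes "ideal K (free_alg V)" "p - q \<in> K"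
  shows "K +>\<^bsub>free_alg V\<^esub> p = K +>\<^bsub>free_alg V\<^esub> q"
proof -
  note K = free_ideal_closed[OF assms(1)]
  show ?thesis
    unfolding free_coset
  proof (intro equalityI image_subsetI)
    fix l assume "l \<in> K"
    then have "l + p = (l + (p - q)) + q" "l + (p - q) \<in> K" using K(2) assms(2) by simp_all
    then show "l + p \<in> (\<lambda>l. l + q) ` K" by (rule image_eqI)
  next
    fix l assume "l \<in> K"
    then have "l + q = (l - (p - q)) + p" "l - (p - q) \<in> K" using K(4) assms(2) by simp_all
    then show "l + q \<in> (\<lambda>l. l + p) ` K" by (rule image_eqI)
  qed
qed

section \<open>Tensor algebras\<close>

lemma ideal_linearity_ideal:
  assumes "vector_space s" "module.subspace s V"
  shows "ideal (linearity_ideal s V) (free_alg V)"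
  unfolding linearity_ideal_def
  by (intro ring.genideal_ideal ring_free_alg linrel_carrier assms)

text \<open>In a quotient, \<open>smult\<close> is a union of cosets over all representatives. It
  collapses to a single coset because the linearity ideal is closed under scalars.\<close>

lemma smult_tensor_algebra:
  assumes "vector_space s" "module.subspace s V" "x \<in> carrier (tensor_algebra s V)"
  shows "c \<odot>\<^bsub>tensor_algebra s V\<^esub> x \<in> carrier (tensor_algebra s V)"
proof -
  let ?F = "free_alg V" and ?L = "linearity_ideal s V"
  note L = ideal_linearity_ideal[OF assms(1,2)]
  note K = free_ideal_closed[OF L]
  obtain a where a: "a \<in> carrier ?F" "x = ?L +>\<^bsub>?F\<^esub> a"
    using assms(3) by (auto simp: tensor_algebra_def quot_alg_simps)
  have "?L +>\<^bsub>?F\<^esub> (c \<odot>\<^bsub>?F\<^esub> y) = ?L +>\<^bsub>?F\<^esub> (c \<odot>\<^bsub>?F\<^esub> a)" if y: "y \<in> x" for y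
  proof (rule free_coset_eq[OF L])
    obtain l where l: "l \<in> ?L" "y = l + a"
      using y unfolding a(2) free_coset by blast
    have "c \<odot>\<^bsub>?F\<^esub> y - c \<odot>\<^bsub>?F\<^esub> a = formal_scale c l"
      by (rule poly_mapping_eqI) (simp add: l(2) free_alg_def lookup_add lookup_minus algebra_simps)
    then show "c \<odot>\<^bsub>?F\<^esub> y - c \<odot>\<^bsub>?F\<^esub> a \<in> ?L" using K(3)[OF l(1)] by simp
  qed
  moreover have "0 + a \<in> x"
    using K(1) unfolding a(2) free_coset by blast
  ultimately have "(\<Union>y\<in>x. ?L +>\<^bsub>?F\<^esub> (c \<odot>\<^bsub>?F\<^esub> y)) = ?L +>\<^bsub>?F\<^esub> (c \<odot>\<^bsub>?F\<^esub> a)" by blast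
  then show ?thesis
    using smult_free_alg[OF a(1), of c] by (auto simp: tensor_algebra_def quot_alg_simps)
qed

lemma coset_hom_tensor_algebra:
  assumes "vector_space s" "module.subspace s V"
  shows "(\<lambda>p. linearity_ideal s V +>\<^bsub>free_alg V\<^esub> p) \<in> ring_hom (free_alg V) (tensor_algebra s V)"
  using ideal.rcos_ring_hom[OF ideal_linearity_ideal[OF assms]]
  by (simp add: ring_hom_def tensor_algebra_def quot_alg_def ring.defs)

text \<open>Ideals of the tensor algebra correspond to ideals K of the free algebra that contain the
  linearity ideal. Testing both relation sets against every such K shows that they generate the same
  ideal, with no description of its elements.\<close>

lemma tensor_algebra_quot_iso:
  assumes V: "vector_space s" "module.subspace s V" and W: "vector_space t" "module.subspace t W"
    and h: "h \<in> alg_iso (free_alg V) (free_alg W)"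
    and lin: "h ` linearity_relations s V = linearity_relations t W"
    and R: "R \<subseteq> carrier (free_alg V)" and R': "R' \<subseteq> carrier (free_alg W)"
    and rel: "\<And>K. ideal K (free_alg W) \<Longrightarrow> linearity_ideal t W \<subseteq> K \<Longrightarrow> h ` R \<subseteq> K \<longleftrightarrow> R' \<subseteq> K"
  shows "tensor_algebra_quot s V R \<simeq>\<^sub>a\<^sub>l\<^sub>g tensor_algebra_quot t W R'"
proof -
  let ?F = "free_alg V" and ?F' = "free_alg W"
  let ?L = "linearity_ideal s V" and ?L' = "linearity_ideal t W"
  let ?T = "tensor_algebra s V" and ?T' = "tensor_algebra t W"
  let ?p = "\<lambda>p. ?L +>\<^bsub>?F\<^esub> p" and ?p' = "\<lambda>p. ?L' +>\<^bsub>?F'\<^esub> p"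
  have L_car: "?L \<subseteq> carrier ?F" "?L' \<subseteq> carrier ?F'"
    using ideal_linearity_ideal[OF V] ideal_linearity_ideal[OF W]
    by (meson additive_subgroup.a_subset ideal.axioms(1))+
  have ring_iso: "h \<in> ring_iso ?F ?F'" using h by (simp add: alg_iso_def)
  have hL: "h ` ?L = ?L'"
    unfolding linearity_ideal_def lin[symmetric]
    by (rule iso_genideal[OF ring_free_alg ring_free_alg ring_iso linrel_carrier[OF V(2,1)]])
  have H: "(`) h \<in> alg_iso ?T ?T'"
    unfolding tensor_algebra_def hL[symmetric]
    by (rule alg_iso_quot_alg[OF ring_free_alg L_car(1) h smult_free_alg])
  note rings = ring_tensor_algebra[OF V] ring_tensor_algebra[OF W]
  interpret T': ring ?T' by (rule rings)
  interpret p': ring_hom_ring ?F' ?T' ?p'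
    by (intro ring_hom_ringI2 ring_free_alg rings coset_hom_tensor_algebra[OF W])
  have hR: "h ` R \<subseteq> carrier ?F'" using R ring_iso by (auto simp: ring_iso_def bij_betw_def)
  have Hp: "(`) h ` ?p ` R = ?p' ` h ` R"
  proof -
    have "h ` (?L +>\<^bsub>?F\<^esub> p) = h ` ?L +>\<^bsub>?F'\<^esub> h p" if "p \<in> carrier ?F" for p
      unfolding a_r_coset_def' image_UN UN_simps(10)
      using ring_iso_memE(3)[OF ring_iso] L_car(1) that by (auto simp: subset_iff)
    then show ?thesis using R unfolding image_image hL by (intro image_cong refl) blast
  qed
  \<comment> \<open>The test ideal is the preimage of the ideal generated by \<open>B\<close>. It
    contains the linearity ideal, whose elements have the zero coset.\<close>
  have sub: "?p' ` A \<subseteq> Idl\<^bsub>?T'\<^esub> (?p' ` B)"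
    if "A \<subseteq> carrier ?F'" "B \<subseteq> carrier ?F'"
      and imp: "\<And>K. ideal K ?F' \<Longrightarrow> ?L' \<subseteq> K \<Longrightarrow> B \<subseteq> K \<Longrightarrow> A \<subseteq> K" for A B
  proof -
    have B: "?p' ` B \<subseteq> carrier ?T'" using that(2) p'.hom_closed by blast
    let ?K = "{r \<in> carrier ?F'. ?p' r \<in> Idl\<^bsub>?T'\<^esub> (?p' ` B)}"
    have I: "ideal (Idl\<^bsub>?T'\<^esub> (?p' ` B)) ?T'" by (rule T'.genideal_ideal[OF B])
    have "ideal ?K ?F'" by (rule p'.ideal_vimage[OF I])
    moreover have "?L' \<subseteq> ?K"
    proof
      fix l assume l: "l \<in> ?L'"
      have "?p' l = ?p' 0"
        by (rule free_coset_eq[OF ideal_linearity_ideal[OF W]]) (use l in simp)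
      also have "\<dots> = \<zero>\<^bsub>?T'\<^esub>" using p'.hom_zero by (simp add: free_alg_def)
      also have "\<dots> \<in> Idl\<^bsub>?T'\<^esub> (?p' ` B)"
        using I by (simp add: additive_subgroup.zero_closed ideal.axioms(1))
      finally show "l \<in> ?K" using l L_car(2) by blast
    qed
    moreover have "B \<subseteq> ?K" using T'.genideal_self[OF B] that(2) by blast
    ultimately have "A \<subseteq> ?K" by (rule imp)
    then show ?thesis by blast
  qed
  have 1: "?p' ` h ` R \<subseteq> Idl\<^bsub>?T'\<^esub> (?p' ` R')"
    by (rule sub[OF hR R']) (simp only: rel)
  have 2: "?p' ` R' \<subseteq> Idl\<^bsub>?T'\<^esub> (?p' ` h ` R)"
    by (rule sub[OF R' hR]) (simp only: rel)
  have car: "?p' ` h ` R \<subseteq> carrier ?T'" "?p' ` R' \<subseteq> carrier ?T'"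
    using hR R' p'.hom_closed by blast+
  have Idl: "Idl\<^bsub>?T'\<^esub> (?p' ` h ` R) = Idl\<^bsub>?T'\<^esub> (?p' ` R')"
    using T'.genideal_minimal[OF T'.genideal_ideal[OF car(2)] 1]
      T'.genideal_minimal[OF T'.genideal_ideal[OF car(1)] 2] by (rule equalityI)
  have pR: "?p ` R \<subseteq> carrier ?T"
    using R by (auto simp: tensor_algebra_def quot_alg_simps)
  have "(`) h ` (Idl\<^bsub>?T\<^esub> (?p ` R)) = Idl\<^bsub>?T'\<^esub> (?p' ` R')"
    using iso_genideal[OF rings _ pR, of "(`) h"] H unfolding Hp Idl by (simp add: alg_iso_def)
  moreover have "Idl\<^bsub>?T\<^esub> (?p ` R) \<subseteq> carrier ?T"
    using ring.genideal_ideal[OF rings(1) pR]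
    by (meson additive_subgroup.a_subset ideal.axioms(1))
  ultimately have "(`) ((`) h) \<in> alg_iso (tensor_algebra_quot s V R) (tensor_algebra_quot t W R')"
    using alg_iso_quot_alg[OF rings(1) _ H smult_tensor_algebra[OF V]]
    unfolding tensor_algebra_quot_def by metis
  then show ?thesis by (auto simp: alg_isomorphic_def alg_iso_def)
qed

lemma free_coset_sum:
  assumes s: "vector_space s" "module.subspace s V" and "finite A" "A \<subseteq> V"
  shows "(\<Sum>v\<in>A. formal_scale (c v) (gen [v])) - gen [\<Sum>v\<in>A. s (c v) v] \<in> linearity_ideal s V"
  using assms(3,4)
proof (induction A)
  interpret S: vector_space s by fact
  let ?L = "linearity_ideal s V"
  note L = free_ideal_closed[OF ideal_linearity_ideal[OF s]]
  have rel: "r \<in> ?L" if "r \<in> linearity_relations s V" for r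
    using that ring.genideal_self[OF ring_free_alg linrel_carrier[OF s(2,1)]]
    unfolding linearity_ideal_def by blast
  {
    case empty
    \<comment> \<open>The one-letter word [0] is not the zero of the free algebra; this relation is
      its negative.\<close>
    have "gen [0 + 0] - gen [0] - gen [0] \<in> ?L"
      by (rule rel) (use S.subspace_0[OF s(2)] in \<open>unfold linearity_relations_def, blast\<close>)
    then show ?case by simp
  next
    case (insert u A)
    let ?w = "\<Sum>v\<in>A. s (c v) v"
    have w: "?w \<in> V" and u: "u \<in> V"
      using insert.prems by (auto intro!: S.subspace_sum S.subspace_scale s(2))
    have "gen [s (c u) u + ?w] - gen [s (c u) u] - gen [?w] \<in> ?L"
      by (rule rel) (use w S.subspace_scale[OF s(2) u] in \<open>unfold linearity_relations_def, blast\<close>)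
    moreover have "gen [s (c u) u] - formal_scale (c u) (gen [u]) \<in> ?L"
      by (rule rel) (use u in \<open>unfold linearity_relations_def, blast\<close>)
    moreover have "(\<Sum>v\<in>A. formal_scale (c v) (gen [v])) - gen [?w] \<in> ?L"
      using insert by simp
    ultimately have "((\<Sum>v\<in>A. formal_scale (c v) (gen [v])) - gen [?w])
        - ((gen [s (c u) u + ?w] - gen [s (c u) u] - gen [?w])
          + (gen [s (c u) u] - formal_scale (c u) (gen [u]))) \<in> ?L"
      by (intro L(4)[OF _ L(2)])
    then show ?case using insert.hyps by (simp add: algebra_simps)
  }
qed

text \<open>By \<open>free_coset_sum\<close> the combination of one-letter words is congruent to the
  single word [0], which lies in the ideal.\<close>

lemma linear_part_in_ideal:
  assumes s: "vector_space s" "module.subspace s V"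
    and "Poly_Mapping.keys q \<subseteq> V" "lin_ext s (\<lambda>v. v) q = 0"
  shows "formal_ext (\<lambda>v. gen [v]) q \<in> linearity_ideal s V"
proof -
  note L = free_ideal_closed[OF ideal_linearity_ideal[OF s]]
  have "formal_ext (\<lambda>v. gen [v]) q - gen [0] \<in> linearity_ideal s V"
    using free_coset_sum[OF s finite_keys assms(3), of "Poly_Mapping.lookup q"] assms(4)
    by (simp add: lin_ext_def)
  moreover have "0 - gen [0] \<in> linearity_ideal s V"
    using free_coset_sum[OF s finite.emptyI, of "\<lambda>_. 0"] by simp
  ultimately have "(formal_ext (\<lambda>v. gen [v]) q - gen [0]) - (0 - gen [0]) \<in> linearity_ideal s V"
    by (rule L(4))
  then show ?thesis by simp
qed

text \<open>Each bilinearity relation between pairs is a linearity relation multiplied by a letter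
  on one side.\<close>

lemma deg2_tensor_eq:
  assumes s: "vector_space s" "module.subspace s V" and "tensor_eq s V s V x y"
  shows "deg2 x - deg2 y \<in> linearity_ideal s V"
proof -
  interpret S: vector_space s by fact
  let ?L = "linearity_ideal s V"
  note L = free_ideal_closed[OF ideal_linearity_ideal[OF s]]
  interpret F: vector_space "formal_scale :: _ \<Rightarrow> ('b \<times> 'b \<Rightarrow>\<^sub>0 'a) \<Rightarrow> _" by (rule vector_space_formal_scale)
  have rel: "r \<in> ?L" if "r \<in> linearity_relations s V" for r
    using that ring.genideal_self[OF ring_free_alg linrel_carrier[OF s(2,1)]]
    unfolding linearity_ideal_def by blast
  have deg2: "deg2 (p + q) = deg2 p + deg2 q" "deg2 (p - q) = deg2 p - deg2 q"
      "deg2 (formal_scale c p) = formal_scale c (deg2 p)" "deg2 (gen (v, w)) = gen [v, w]" "deg2 0 = 0"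
    for p q :: "'b \<times> 'b \<Rightarrow>\<^sub>0 'a" and c v w
    by (simp_all add: deg2_def formal_ext_simps lin_ext_diff[OF vector_space_formal_scale] lin_ext_0)
  note simps = deg2 formal_ext_simps lin_ext_diff[OF vector_space_formal_scale]
    lin_ext_diff_fun[OF vector_space_formal_scale]
  have "deg2 z \<in> ?L" if "z \<in> F.span (tensor_relations s V s V)" for z
    using that
  proof (induction rule: F.span_induct_alt)
    case (step c z z')
    have "deg2 z \<in> ?L"
      using step(1) unfolding tensor_relations_def
    proof (elim UnE CollectE exE conjE)
      fix v v' w assume z: "z = gen (v + v', w) - gen (v, w) - gen (v', w)" and V: "v \<in> V" "v' \<in> V" "w \<in> V"
      have "(gen [v + v'] - gen [v] - gen [v']) \<odot>\<odot> gen [w] \<in> ?L"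
        by (rule L(5)[OF rel]) (use V in \<open>unfold linearity_relations_def, blast, simp\<close>)
      then show ?thesis by (simp add: z simps)
    next
      fix v w w' assume z: "z = gen (v, w + w') - gen (v, w) - gen (v, w')" and V: "v \<in> V" "w \<in> V" "w' \<in> V"
      have "gen [v] \<odot>\<odot> (gen [w + w'] - gen [w] - gen [w']) \<in> ?L"
        by (rule L(6)[OF rel]) (use V in \<open>unfold linearity_relations_def, blast, simp\<close>)
      then show ?thesis by (simp add: z simps)
    next
      fix c v w assume z: "z = gen (s c v, w) - formal_scale c (gen (v, w))" and V: "v \<in> V" "w \<in> V"
      have "(gen [s c v] - formal_scale c (gen [v])) \<odot>\<odot> gen [w] \<in> ?L"
        by (rule L(5)[OF rel]) (use V in \<open>unfold linearity_relations_def, blast, simp\<close>)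
      then show ?thesis by (simp add: z simps)
    next
      fix c v w assume z: "z = gen (v, s c w) - formal_scale c (gen (v, w))" and V: "v \<in> V" "w \<in> V"
      have "gen [v] \<odot>\<odot> (gen [s c w] - formal_scale c (gen [w])) \<in> ?L"
        by (rule L(6)[OF rel]) (use V in \<open>unfold linearity_relations_def, blast, simp\<close>)
      then show ?thesis by (simp add: z simps)
    qed
    then show ?case using step by (simp add: deg2 L(2,3))
  qed (simp add: deg2 L(1))
  then show ?thesis
    using assms(3) by (simp add: tensor_eq_def flip: deg2(2))
qed

lemma formal_ext_scale_const:
  "formal_ext (\<lambda>x. formal_scale (c x) u) p = formal_scale (lin_ext (*) c p) u"
proof -
  interpret F: vector_space formal_scale by (rule vector_space_formal_scale)
  have "Vector_Spaces.linear (*) formal_scale (\<lambda>c. formal_scale c u)"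
    by (simp add: Vector_Spaces.linear_iff vector_space_field vector_space_formal_scale
        F.scale_left_distrib)
  from lin_ext_comp[OF this, of c p] show ?thesis by simp
qed

lemma formal_scale_simps:
  "formal_scale c (p + q) = formal_scale c p + formal_scale c q"
  "formal_scale c (p - q) = formal_scale c p - formal_scale c q"
  "formal_scale c (formal_scale d p) = formal_scale (c * d) p"
  "formal_scale (c + d) p = formal_scale c p + formal_scale d p"
  by (rule poly_mapping_eqI; simp add: lookup_add lookup_minus algebra_simps)+

lemma fun_scale_apply: "fun_scale c f x = c * f x"
  by (simp add: fun_scale_def)

context fin_inner_fodc
begin

section \<open>The shift by the inner element\<close>

definition hat2 :: "(('a \<Rightarrow> 'k) \<times> ('a \<Rightarrow> 'k) \<Rightarrow>\<^sub>0 'k) \<Rightarrow> (('g \<Rightarrow> 'k) \<times> ('g \<Rightarrow> 'k) \<Rightarrow>\<^sub>0 'k)"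
  where "hat2 = formal_ext (\<lambda>(f, g). gen (hat f, hat g))"

definition relator :: "('a \<Rightarrow> 'k) \<Rightarrow> ('a \<Rightarrow> 'k) \<Rightarrow> (('g \<Rightarrow> 'k) \<times> ('g \<Rightarrow> 'k) \<Rightarrow>\<^sub>0 'k)"
  where "relator x y = gen (hat x, hat y) - hat2 (sigma H G x y)"

text \<open>Combines the identification \<open>hat\<close> with the translation by x(\<theta>), so
  the letters of the image are functionals on right invariants; the empty word is the unit.\<close>

definition shift :: "('a \<Rightarrow> 'k) \<Rightarrow> (('g \<Rightarrow> 'k) list \<Rightarrow>\<^sub>0 'k)"
  where "shift x = gen [hat x] - formal_scale (hat x \<theta>) (gen [])"

definition unshift :: "('g \<Rightarrow> 'k) \<Rightarrow> (('a \<Rightarrow> 'k) list \<Rightarrow>\<^sub>0 'k)"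
  where "unshift f = gen [\<lambda>a. f (\<omega> a)] + formal_scale (f \<theta>) (gen [])"

lemma lin_ext_hat2: "lin_ext (*) (\<lambda>z. F (fst z) (snd z)) (hat2 s) = lin_ext (*) (\<lambda>z. F (hat (fst z)) (hat (snd z))) s"
  by (simp add: hat2_def lin_ext_formal_ext[OF vector_space_field] case_prod_unfold
      lin_ext_gen[OF vector_space_field])

lemma hat_sigma_eval:
  assumes "x \<in> \<g>" "y \<in> \<g>" "v \<in> V" "w \<in> V"
  shows "lin_ext (*) (\<lambda>z. hat (fst z) v * hat (snd z) w) (sigma H G x y) = braid x y v w"
proof -
  obtain a b where ab: "v = \<omega> a" "w = \<omega> b" using assms(3,4) by (metis omegaE)
  have "lin_ext (*) (\<lambda>z. hat (fst z) v * hat (snd z) w) (sigma H G x y)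
      = lin_ext (*) (\<lambda>(f, g). f a * g b) (sigma H G x y)"
    unfolding ab using sigma(1)[OF assms(1,2)]
    by (intro lin_ext_cong) (auto simp: hat_omega)
  then show ?thesis by (simp add: sigma(2)[OF assms(1,2)] ab)
qed

lemma bracket_in_tangent: "x \<in> \<g> \<Longrightarrow> y \<in> \<g> \<Longrightarrow> bracket H x y \<in> \<g>"
  by (intro bracket_tangent tangent_finite_dual)

text \<open>By left invariance the coaction of \<theta> is 1 \<otimes> \<theta>, and 1 acts as the
  identity.\<close>

lemma braid_theta_left:
  assumes "x \<in> \<g>" "y \<in> \<g>" "w \<in> V"
  shows "braid x y \<theta> w = hat x w * hat y \<theta>"
proof -
  note b = act_tangent_bilinear[OF assms]
  have "lbil (*) (\<lambda>p z. hat x (act p w) * hat y (proj z))"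
    using b proj_V unfolding bilinear_on_def proj_add proj_gsc by blast
  then show ?thesis
    unfolding braid_def
    by (simp add: crossed_coact_lw[OF theta_V vector_space_field b] lw_theta vector_space_field
        crossed_act_one proj_right_inv[OF theta_V])
qed

text \<open>Split p \<triangleright> \<theta> = \<omega>(p) + \<epsilon>(p) \<theta>. The first part
  produces the bracket by \<open>bracket_coact\<close>; the second is reduced by the counit axiom of
  the coaction.\<close>

lemma braid_theta_right:
  assumes x: "x \<in> \<g>" and y: "y \<in> \<g>" and v: "v \<in> V"
  shows "braid x y v \<theta> = hat (bracket H x y) v + hat x \<theta> * hat y v"
proof -
  interpret S: vector_space "gsc G" by (rule gsc_vector_space)
  note K = vector_space_field
  obtain a where a: "v = \<omega> a" using v by (rule omegaE)
  have "hat x (act p \<theta>) = x p + cou H p * hat x \<theta>" for p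
    unfolding act_theta
    using omega_V theta_V x
    by (simp add: hat_add_arg hat_gsc_arg hat_omega S.subspace_scale[OF subspace_right_inv])
  then have e: "hat x (act p \<theta>) * hat y z = x p * hat y z + hat x \<theta> * (cou H p * hat y z)" for p z
    by (simp add: algebra_simps)
  have "braid x y v \<theta> = lin_ext (*) (\<lambda>z. x (fst z) * hat y (snd z)) (crossed_coact H G v)
      + hat x \<theta> * lin_ext (*) (\<lambda>z. cou H (fst z) * hat y (snd z)) (crossed_coact H G v)"
    by (simp only: braid_def case_prod_unfold e lin_ext_addf[OF K] lin_ext_field_mult)
  moreover have "lin_ext (*) (\<lambda>z. x (fst z) * hat y (snd z)) (crossed_coact H G v) = hat (bracket H x y) v"
    using bracket_coact[OF tangent_finite_dual[OF x] y, of a]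
    by (simp add: a hat_omega bracket_in_tangent x y case_prod_unfold)
  moreover have "lin_ext (*) (\<lambda>z. cou H (fst z) * hat y (snd z)) (crossed_coact H G v) = hat y v"
  proof -
    have b: "bilinear_on (sc H) UNIV (gsc G) V (*) (\<lambda>p z. cou H p * hat y z)"
      using y by (auto simp: bilinear_on_def cou_add cou_sc hat_add_arg hat_gsc_arg algebra_simps)
    \<comment> \<open>Composing with \<open>proj\<close> makes \<open>hat y\<close> linear on all of
      \<Gamma>, where the counit axiom is stated.\<close>
    have lin: "Vector_Spaces.linear (gsc G) (*) (\<lambda>z. hat y (proj z))"
      using y by (simp add: Vector_Spaces.linear_iff gsc_vector_space K proj_add proj_gsc
          hat_add_arg hat_gsc_arg proj_V)
    have "lin_ext (*) (\<lambda>z. cou H (fst z) * hat y (snd z)) (crossed_coact H G v)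
        = lw (*) (\<lambda>p z. cou H p * hat y (proj z)) v"
      using crossed_coact_lw[OF v K b] by (simp add: case_prod_unfold)
    also have "\<dots> = hat y (proj (lw (gsc G) (\<lambda>p z. gsc G (cou H p) z) v))"
      using y by (simp add: lw_comp[OF lin] proj_gsc hat_gsc_arg proj_V)
    also have "lw (gsc G) (\<lambda>p z. gsc G (cou H p) z) v = v"
      by (simp add: lw_def lcoact_counit)
    finally show ?thesis by (simp add: proj_right_inv[OF v])
  qed
  ultimately show ?thesis by simp
qed

text \<open>Compare the two preceding formulas at \<theta> \<otimes> \<theta>. As a consequence the
  shift adds no constant to [x, y].\<close>

lemma bracket_theta: "x \<in> \<g> \<Longrightarrow> y \<in> \<g> \<Longrightarrow> hat (bracket H x y) \<theta> = 0"
  using braid_theta_left[of x y \<theta>] braid_theta_right[of x y \<theta>] theta_V by simp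

text \<open>
  The coefficients of degree one in the image of a defining relation of the enveloping algebra
  under the shift.
\<close>

definition linear_part :: "('a \<Rightarrow> 'k) \<Rightarrow> ('a \<Rightarrow> 'k) \<Rightarrow> (('g \<Rightarrow> 'k) \<Rightarrow>\<^sub>0 'k)"
  where "linear_part x y =
    formal_ext (\<lambda>z. formal_scale (hat (snd z) \<theta>) (gen (hat (fst z)))) (sigma H G x y)
    + formal_ext (\<lambda>z. formal_scale (hat (fst z) \<theta>) (gen (hat (snd z)))) (sigma H G x y)
    - formal_scale (hat y \<theta>) (gen (hat x)) - formal_scale (hat x \<theta>) (gen (hat y))
    - gen (hat (bracket H x y))"

lemma keys_formal_scale_gen: "v \<in> A \<Longrightarrow> Poly_Mapping.keys (formal_scale c (gen v)) \<subseteq> A"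
  by (auto simp: in_keys_iff lookup_single when_def split: if_splits)

lemma keys_linear_part:
  assumes "x \<in> \<g>" "y \<in> \<g>"
  shows "Poly_Mapping.keys (linear_part x y) \<subseteq> V'"
proof -
  have sig: "hat (fst z) \<in> V' \<and> hat (snd z) \<in> V'" if "z \<in> Poly_Mapping.keys (sigma H G x y)" for z
    using sigma(1)[OF assms] that by (auto intro!: hat_dual)
  have k1: "Poly_Mapping.keys (formal_ext (\<lambda>z. formal_scale (hat (snd z) \<theta>) (gen (hat (fst z)))) (sigma H G x y)) \<subseteq> V'"
    "Poly_Mapping.keys (formal_ext (\<lambda>z. formal_scale (hat (fst z) \<theta>) (gen (hat (snd z)))) (sigma H G x y)) \<subseteq> V'"
    by (rule keys_formal_ext, rule keys_formal_scale_gen, use sig in blast)+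
  have k2: "Poly_Mapping.keys (gen (hat (bracket H x y))) \<subseteq> V'"
    using hat_dual[OF bracket_in_tangent[OF assms]] by simp
  have pm: "Poly_Mapping.keys (p + q) \<subseteq> V'" "Poly_Mapping.keys (p - q) \<subseteq> V'"
    if "Poly_Mapping.keys p \<subseteq> V'" "Poly_Mapping.keys q \<subseteq> V'" for p q :: "('g \<Rightarrow> 'k) \<Rightarrow>\<^sub>0 'k"
    using that keys_add[of p q] keys_diff[of p q] by blast+
  show ?thesis
    unfolding linear_part_def
    by (intro pm k1 k2 keys_formal_scale_gen hat_dual assms)
qed

text \<open>It is the sum of the functionals that vanishes; the formal combination need not, since
  different functions index its terms. On right invariants the two contractions of \<sigma>(x
  \<otimes> y) with \<theta>, known from \<open>braid_theta_left\<close> and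
  \<open>braid_theta_right\<close>, cancel the other terms; elsewhere every \<open>hat\<close> is
  0.\<close>

lemma linear_part_zero:
  assumes x: "x \<in> \<g>" and y: "y \<in> \<g>"
  shows "lin_ext fun_scale (\<lambda>v. v) (linear_part x y) = 0"
proof
  fix v
  note K = vector_space_field
  have "lin_ext fun_scale (\<lambda>v. v) (linear_part x y) v = lin_ext (*) (\<lambda>f. f v) (linear_part x y)"
    by (rule lin_ext_comp[OF linear_fun_eval])
  also have "\<dots> = lin_ext (*) (\<lambda>z. hat (fst z) v * hat (snd z) \<theta>) (sigma H G x y)
      + lin_ext (*) (\<lambda>z. hat (fst z) \<theta> * hat (snd z) v) (sigma H G x y)
      - hat y \<theta> * hat x v - hat x \<theta> * hat y v - hat (bracket H x y) v"
    unfolding linear_part_def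
    by (simp add: lin_ext_add[OF K] lin_ext_diff[OF K] lin_ext_scale[OF K] lin_ext_gen[OF K]
        lin_ext_formal_ext[OF K] mult.commute)
  also have "\<dots> = 0"
  proof (cases "v \<in> V")
    case True
    then show ?thesis
      using x y theta_V by (simp add: hat_sigma_eval braid_theta_left braid_theta_right)
  next
    case False
    then have "hat f v = 0" for f by (simp add: hat_def)
    then show ?thesis by (simp add: lin_ext_def)
  qed
  finally show "lin_ext fun_scale (\<lambda>v. v) (linear_part x y) v = 0 v" by simp
qed

lemma shift_mult:
  "shift x \<odot>\<odot> shift y = gen [hat x, hat y] - formal_scale (hat y \<theta>) (gen [hat x])
    - formal_scale (hat x \<theta>) (gen [hat y]) + formal_scale (hat x \<theta> * hat y \<theta>) (gen [])"
  unfolding shift_def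
  by (simp add: formal_ext_simps lin_ext_diff[OF vector_space_formal_scale]
      lin_ext_diff_fun[OF vector_space_formal_scale] formal_scale_simps mult.commute)

lemma free_map_shift_deg2:
  "free_map shift (deg2 s) = deg2 (hat2 s)
    - formal_ext (\<lambda>z. formal_scale (hat (snd z) \<theta>) (gen [hat (fst z)])) s
    - formal_ext (\<lambda>z. formal_scale (hat (fst z) \<theta>) (gen [hat (snd z)])) s
    + formal_scale (lin_ext (*) (\<lambda>z. hat (fst z) \<theta> * hat (snd z) \<theta>) s) (gen [])"
proof -
  note F = vector_space_formal_scale
  have w: "word_map shift [v, w] = shift v \<odot>\<odot> shift w" for v w
    by (simp only: word_map.simps free_mult_one)
  have "free_map shift (deg2 s) = formal_ext (\<lambda>z. shift (fst z) \<odot>\<odot> shift (snd z)) s"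
    unfolding free_map_def deg2_def lin_ext_formal_ext[OF F] case_prod_unfold lin_ext_gen[OF F] w ..
  also have "\<dots> = formal_ext (\<lambda>z. gen [hat (fst z), hat (snd z)]) s
    - formal_ext (\<lambda>z. formal_scale (hat (snd z) \<theta>) (gen [hat (fst z)])) s
    - formal_ext (\<lambda>z. formal_scale (hat (fst z) \<theta>) (gen [hat (snd z)])) s
    + formal_ext (\<lambda>z. formal_scale (hat (fst z) \<theta> * hat (snd z) \<theta>) (gen [])) s"
    unfolding shift_mult lin_ext_addf[OF F] lin_ext_diff_fun[OF F] ..
  also have "formal_ext (\<lambda>z. gen [hat (fst z), hat (snd z)]) s = deg2 (hat2 s)"
    unfolding hat2_def deg2_def lin_ext_formal_ext[OF F] case_prod_unfold lin_ext_gen[OF F]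
    by simp
  finally show ?thesis by (simp only: formal_ext_scale_const)
qed

text \<open>The constants cancel: the product of the shifts contributes x(\<theta>) y(\<theta>), the
  braided term contributes the same with the opposite sign, and [x, y] contributes none.\<close>

lemma free_map_shift_relation:
  assumes x: "x \<in> \<g>" and y: "y \<in> \<g>"
  shows "free_map shift (gen [x, y] - deg2 (sigma H G x y) - gen [bracket H x y])
    = deg2 (relator x y) + formal_ext (\<lambda>f. gen [f]) (linear_part x y)"
proof -
  note F = vector_space_formal_scale
  have f1: "free_map shift (gen [x, y]) = shift x \<odot>\<odot> shift y"
    unfolding free_map_gen by (simp only: word_map.simps free_mult_one)
  have f2: "free_map shift (gen [bracket H x y]) = gen [hat (bracket H x y)]"
    unfolding free_map_gen word_map.simps free_mult_one shift_def
    by (rule poly_mapping_eqI) (simp add: bracket_theta[OF x y] lookup_minus)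
  have f3: "lin_ext (*) (\<lambda>z. hat (fst z) \<theta> * hat (snd z) \<theta>) (sigma H G x y) = hat x \<theta> * hat y \<theta>"
    using x y theta_V by (simp add: hat_sigma_eval braid_theta_left)
  have f4: "formal_ext (\<lambda>f. gen [f]) (linear_part x y)
     = formal_ext (\<lambda>z. formal_scale (hat (snd z) \<theta>) (gen [hat (fst z)])) (sigma H G x y)
    + formal_ext (\<lambda>z. formal_scale (hat (fst z) \<theta>) (gen [hat (snd z)])) (sigma H G x y)
    - formal_scale (hat y \<theta>) (gen [hat x]) - formal_scale (hat x \<theta>) (gen [hat y])
    - gen [hat (bracket H x y)]"
    unfolding linear_part_def
    by (simp add: lin_ext_diff[OF F] formal_ext_simps lin_ext_formal_ext[OF F])
  have f5: "deg2 (relator x y) = gen [hat x, hat y] - deg2 (hat2 (sigma H G x y))"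
    by (simp add: relator_def deg2_def lin_ext_diff[OF F] formal_ext_simps)
  show ?thesis
    unfolding free_map_diff free_map_shift_deg2 f1 f2 f3 f4 f5 shift_mult by (simp add: algebra_simps)
qed

lemma free_map_shift_iso: "free_map shift \<in> alg_iso (free_alg \<g>) (free_alg V')"
proof (rule free_map_alg_iso)
  show "Poly_Mapping.keys (shift x) \<subseteq> lists V'" if "x \<in> \<g>" for x
    unfolding shift_def using hat_dual[OF that]
    by (intro order.trans[OF keys_diff] Un_least keys_formal_scale_gen) auto
  show "Poly_Mapping.keys (unshift f) \<subseteq> lists \<g>" if "f \<in> V'" for f
    unfolding unshift_def using tangent_of_dual[OF that]
    by (intro order.trans[OF keys_add] Un_least keys_formal_scale_gen) auto
  show "free_map unshift (shift x) = gen [x]" if "x \<in> \<g>" for x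
    unfolding shift_def unshift_def
    by (simp add: free_map_diff free_map_scale free_map_gen free_mult_one hat_omega[OF that])
  show "free_map shift (unshift f) = gen [f]" if "f \<in> V'" for f
    unfolding shift_def unshift_def
    by (simp add: free_map_add free_map_scale free_map_gen free_mult_one hat_tangent_of_dual[OF that])
qed

lemma subspace_V': "module.subspace fun_scale V'"
  by (rule subspace_dual_space[OF gsc_vector_space subspace_right_inv])

text \<open>The constants within a linearity relation cancel because x(\<theta>) is linear in x. All
  relations over \<open>V'\<close> are reached because \<open>hat\<close> maps the tangent space
  onto \<open>V'\<close>.\<close>

lemma free_map_shift_linearity:
  "free_map shift ` linearity_relations fun_scale \<g> = linearity_relations fun_scale V'"
proof -
  interpret F: vector_space fun_scale by (rule vector_space_fun_scale)
  let ?h = "free_map shift"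
  have word1: "?h (gen [x]) = shift x" for x
    unfolding free_map_gen by (simp only: word_map.simps free_mult_one)
  have add: "?h (gen [x + y] - gen [x] - gen [y]) = gen [hat x + hat y] - gen [hat x] - gen [hat y]" for x y
    by (simp add: free_map_diff word1 shift_def hat_add formal_scale_simps)
  have scale: "?h (gen [fun_scale c x] - formal_scale c (gen [x]))
      = gen [fun_scale c (hat x)] - formal_scale c (gen [hat x])" for c x
    by (simp add: free_map_diff free_map_scale word1 shift_def hat_scale formal_scale_simps fun_scale_apply)
  show ?thesis
  proof (intro equalityI subsetI)
    fix r assume "r \<in> ?h ` linearity_relations fun_scale \<g>"
    then show "r \<in> linearity_relations fun_scale V'"
      unfolding linearity_relations_def
      by (auto simp: add scale) (use hat_dual in blast)+
  next
    fix r assume "r \<in> linearity_relations fun_scale V'"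
    then consider (a) f g where "f \<in> V'" "g \<in> V'" "r = gen [f + g] - gen [f] - gen [g]"
      | (s) c f where "f \<in> V'" "r = gen [fun_scale c f] - formal_scale c (gen [f])"
      unfolding linearity_relations_def by blast
    then show "r \<in> ?h ` linearity_relations fun_scale \<g>"
    proof cases
      case a
      let ?x = "\<lambda>a. f (\<omega> a)" and ?y = "\<lambda>a. g (\<omega> a)"
      have "r = ?h (gen [?x + ?y] - gen [?x] - gen [?y])"
        unfolding add using a by (simp add: hat_tangent_of_dual)
      moreover have "gen [?x + ?y] - gen [?x] - gen [?y] \<in> linearity_relations fun_scale \<g>"
        unfolding linearity_relations_def using a(1,2)[THEN tangent_of_dual] by blast
      ultimately show ?thesis by blast
    next
      case s
      let ?x = "\<lambda>a. f (\<omega> a)"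
      have "r = ?h (gen [fun_scale c ?x] - formal_scale c (gen [?x]))"
        unfolding scale using s by (simp add: hat_tangent_of_dual)
      moreover have "gen [fun_scale c ?x] - formal_scale c (gen [?x]) \<in> linearity_relations fun_scale \<g>"
        unfolding linearity_relations_def using s(1)[THEN tangent_of_dual] by blast
      ultimately show ?thesis by blast
    qed
  qed
qed

section \<open>The annihilator of the quadratic relations\<close>

definition perp :: "(('g \<Rightarrow> 'k) \<times> ('g \<Rightarrow> 'k) \<Rightarrow>\<^sub>0 'k) set"
  where "perp = {f. Poly_Mapping.keys f \<subseteq> V' \<times> V'
    \<and> (\<forall>t \<in> rel_space (wedge_quad H G). pairing2 t f = 0)}"

lemma keys_sigma_t:
  assumes "Poly_Mapping.keys t \<subseteq> V \<times> V"
  shows "Poly_Mapping.keys (sigma_t H G t) \<subseteq> V \<times> V"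
  unfolding sigma_t_def
proof (rule keys_formal_ext)
  fix p assume "p \<in> Poly_Mapping.keys t"
  then obtain v w where p: "p = (v, w)" "v \<in> V" "w \<in> V" using assms by blast
  have "Poly_Mapping.keys (formal_ext (\<lambda>(a, v0). gen (act a w, v0)) (crossed_coact H G v)) \<subseteq> V \<times> V"
    by (rule keys_formal_ext) (use crossed_coact(1)[OF p(2)] crossed_act_right_inv[OF p(3)] in auto)
  then show "Poly_Mapping.keys (case p of (v, w) \<Rightarrow>
      formal_ext (\<lambda>(a, v0). gen (act a w, v0)) (crossed_coact H G v)) \<subseteq> V \<times> V"
    by (simp add: p)
qed

lemma keys_relator:
  assumes "x \<in> \<g>" "y \<in> \<g>"
  shows "Poly_Mapping.keys (relator x y) \<subseteq> V' \<times> V'"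
proof -
  have "Poly_Mapping.keys (hat2 (sigma H G x y)) \<subseteq> V' \<times> V'"
    unfolding hat2_def by (rule keys_formal_ext) (use sigma(1)[OF assms] hat_dual in auto)
  then show ?thesis
    unfolding relator_def using assms hat_dual
    by (intro order.trans[OF keys_diff] Un_least) auto
qed

text \<open>This is transposition of id - \<sigma>. Both sides are linear in t, and on a pair (v, w)
  the braided terms on both sides are \<open>braid x y v w\<close>.\<close>

lemma pairing2_relator:
  assumes x: "x \<in> \<g>" and y: "y \<in> \<g>" and t: "Poly_Mapping.keys t \<subseteq> V \<times> V"
  shows "pairing2 t (relator x y) = pairing2 (t - sigma_t H G t) (gen (hat x, hat y))"
proof -
  note K = vector_space_field
  let ?u = "gen (hat x, hat y) :: ('g \<Rightarrow> 'k) \<times> ('g \<Rightarrow> 'k) \<Rightarrow>\<^sub>0 'k"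
  interpret L: Vector_Spaces.linear formal_scale "(*)" "\<lambda>t. pairing2 t ?u"
    by (rule linear_pairing2_left)
  interpret R: Vector_Spaces.linear formal_scale "(*)" "pairing2 t"
    by (rule linear_pairing2_right)
  have "pairing2 (sigma_t H G t) ?u
      = lin_ext (*) (\<lambda>p. pairing2 (sigma_t H G (gen p)) ?u) t"
    unfolding sigma_t_def lin_ext_gen[OF vector_space_formal_scale]
    by (rule lin_ext_comp[OF linear_pairing2_left])
  also have "\<dots> = lin_ext (*) (\<lambda>p. pairing2 (gen p) (hat2 (sigma H G x y))) t"
  proof (rule lin_ext_cong)
    fix p assume "p \<in> Poly_Mapping.keys t"
    then obtain v w where p: "p = (v, w)" "v \<in> V" "w \<in> V" using t by blast
    show "pairing2 (sigma_t H G (gen p)) ?u = pairing2 (gen p) (hat2 (sigma H G x y))"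
      unfolding p(1) pairing2_sigma_t pairing2_gen case_prod_unfold lin_ext_hat2[where F = "\<lambda>f g. f v * g w"]
      by (rule hat_sigma_eval[OF x y p(2,3), symmetric])
  qed
  also have "\<dots> = pairing2 t (hat2 (sigma H G x y))"
    unfolding pairing2_def by (simp add: lin_ext_gen[OF K])
  finally show ?thesis by (simp add: relator_def L.diff R.diff)
qed

lemma relator_perp: "x \<in> \<g> \<Longrightarrow> y \<in> \<g> \<Longrightarrow> relator x y \<in> perp"
proof -
  assume x: "x \<in> \<g>" and y: "y \<in> \<g>"
  have "pairing2 t (relator x y) = 0" if "t \<in> rel_space (wedge_quad H G)" for t
  proof -
    have t: "Poly_Mapping.keys t \<subseteq> V \<times> V" "tensor_eq (gsc G) V (gsc G) V (t - sigma_t H G t) 0"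
      using that by (simp_all add: wedge_quad_def Let_def)
    have "bilinear_on (gsc G) V (gsc G) V (*) (\<lambda>v w. hat x v * hat y w)"
      using x y by (auto simp: bilinear_on_def hat_add_arg hat_gsc_arg algebra_simps)
    from tensor_eq_lin_ext[OF t(2) vector_space_field this]
    show ?thesis by (simp add: pairing2_relator[OF x y t(1)] pairing2_right_gen lin_ext_0)
  qed
  then show "relator x y \<in> perp" by (simp add: perp_def keys_relator x y)
qed

text \<open>The relators of a dual basis form a finite family. If t pairs to 0 with all of them,
  then t - \<open>sigma_t H G t\<close> pairs to 0 with all basis tensors and so represents 0; thus
  t is a relation of the exterior algebra and f kills it. By \<open>functional_in_span\<close>, f is
  a combination of relators as a functional on formal sums, hence also as a tensor.\<close>

lemma perp_span:
  assumes f: "f \<in> perp"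
  obtains E :: "('g \<times> 'g) set" and c \<phi> where "finite E" "\<forall>p\<in>E. fst (\<phi> p) \<in> \<g> \<and> snd (\<phi> p) \<in> \<g>"
    "tensor_eq fun_scale V' fun_scale V' f (\<Sum>p\<in>E. formal_scale (c p) (relator (fst (\<phi> p)) (snd (\<phi> p))))"
proof -
  note K = vector_space_field and F = vector_space_formal_scale
  interpret FS: vector_space "formal_scale :: 'k \<Rightarrow> ('g \<times> 'g \<Rightarrow>\<^sub>0 'k) \<Rightarrow> _" by (rule F)
  obtain E \<phi> where E: "finite E" "E \<subseteq> V" "\<forall>e. \<phi> e \<in> V'"
    "\<forall>v\<in>V. (\<Sum>e\<in>E. gsc G (\<phi> e v) e) = v"
    using dual_basis by blast
  define x where "x e a = \<phi> e (\<omega> a)" for e a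
  have x: "x e \<in> \<g>" "hat (x e) = \<phi> e" for e
    using E(3) tangent_of_dual hat_tangent_of_dual unfolding x_def by blast+
  let ?U = "{t :: 'g \<times> 'g \<Rightarrow>\<^sub>0 'k. Poly_Mapping.keys t \<subseteq> V \<times> V}"
  let ?r = "\<lambda>p. relator (x (fst p)) (x (snd p))"
  have U: "FS.subspace ?U"
  proof (rule FS.subspaceI)
    show "p + q \<in> ?U" if "p \<in> ?U" "q \<in> ?U" for p q
      using that keys_add[of p q] by blast
  qed (auto simp: in_keys_iff)
  have "pairing2 t f = 0" if t: "t \<in> ?U" and r: "\<And>p. p \<in> E \<times> E \<Longrightarrow> pairing2 t (?r p) = 0" for t
  proof -
    have keys: "Poly_Mapping.keys (t - sigma_t H G t) \<subseteq> V \<times> V"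
      using t keys_sigma_t by (intro order.trans[OF keys_diff] Un_least) auto
    have "tensor_eq (gsc G) V (gsc G) V (t - sigma_t H G t) 0"
    proof (rule tensor_eq_separating[where \<Phi> = "\<phi> ` E" and \<Psi> = "\<phi> ` E",
          OF gsc_vector_space gsc_vector_space subspace_right_inv subspace_right_inv keys])
      have sep: "v = 0" if "v \<in> V" "\<And>f. f \<in> \<phi> ` E \<Longrightarrow> f v = 0" for v
      proof -
        interpret S: vector_space "gsc G" by (rule gsc_vector_space)
        have "(\<Sum>e\<in>E. gsc G (\<phi> e v) e) = 0" using that(2) by (intro sum.neutral) simp
        then show ?thesis using E(4) that(1) by simp
      qed
      show "v = 0" if "v \<in> V" "\<And>f. f \<in> \<phi> ` E \<Longrightarrow> f v = 0" for v
        by (rule sep[OF that(1)]) (rule that(2))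
      show "v = 0" if "v \<in> V" "\<And>f. f \<in> \<phi> ` E \<Longrightarrow> f v = 0" for v
        by (rule sep[OF that(1)]) (rule that(2))
      fix f g assume "f \<in> \<phi> ` E" "g \<in> \<phi> ` E"
      then obtain d e where de: "d \<in> E" "e \<in> E" "f = \<phi> d" "g = \<phi> e" by blast
      have "pairing2 (t - sigma_t H G t) (gen (\<phi> d, \<phi> e)) = 0"
        using r[of "(d, e)"] t de by (simp add: pairing2_relator x)
      then show "lin_ext (*) (\<lambda>(v, w). f v * g w) (t - sigma_t H G t) = lin_ext (*) (\<lambda>(v, w). f v * g w) 0"
        by (simp add: pairing2_right_gen lin_ext_0 de)
    qed (use E(3) in \<open>auto simp: dual_space_def\<close>)
    then have "t \<in> rel_space (wedge_quad H G)"
      using t by (simp add: wedge_quad_def Let_def)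
    then show ?thesis using f by (simp add: perp_def)
  qed
  then obtain c where c: "\<forall>t\<in>?U. pairing2 t f = (\<Sum>p\<in>E \<times> E. c p * pairing2 t (?r p))"
    using functional_in_span[OF F finite_cartesian_product[OF E(1,1)] U,
        of "\<lambda>p t. pairing2 t (?r p)" "\<lambda>t. pairing2 t f"] linear_pairing2_left by blast
  let ?g = "\<Sum>p\<in>E \<times> E. formal_scale (c p) (?r p)"
  have g_keys: "Poly_Mapping.keys ?g \<subseteq> V' \<times> V'"
  proof -
    have "Poly_Mapping.keys (formal_scale (c p) (?r p)) \<subseteq> V' \<times> V'" for p
      using keys_relator[OF x(1) x(1), of "fst p" "snd p"] by (auto simp: in_keys_iff)
    then show ?thesis by (intro order.trans[OF keys_sum] UN_least)
  qed
  have "tensor_eq fun_scale V' fun_scale V' f ?g"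
  proof (rule tensor_eq_fun_space[OF subspace_V' subspace_V'])
    show f_keys: "Poly_Mapping.keys f \<subseteq> V' \<times> V'" using f by (simp add: perp_def)
    show "Poly_Mapping.keys ?g \<subseteq> V' \<times> V'" by (rule g_keys)
    fix v w
    show "lin_ext (*) (\<lambda>(f, g). f v * g w) f = lin_ext (*) (\<lambda>(f, g). f v * g w) ?g"
    proof (cases "v \<in> V \<and> w \<in> V")
      case True
      interpret R: Vector_Spaces.linear formal_scale "(*)" "pairing2 (gen (v, w))"
        by (rule linear_pairing2_right)
      have "pairing2 (gen (v, w)) f = (\<Sum>p\<in>E \<times> E. c p * pairing2 (gen (v, w)) (?r p))"
        using c True by simp
      also have "\<dots> = pairing2 (gen (v, w)) ?g" by (simp add: R.sum R.scale)
      finally show ?thesis by (simp add: pairing2_gen)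
    next
      case False
      \<comment> \<open>Outside \<open>V \<times> V\<close> both sides vanish, because elements of
        \<open>V'\<close> are 0 off \<open>V\<close>.\<close>
      have zero: "lin_ext (*) (\<lambda>(f, g). f v * g w) u = 0" if "Poly_Mapping.keys u \<subseteq> V' \<times> V'"
        for u :: "('g \<Rightarrow> 'k) \<times> ('g \<Rightarrow> 'k) \<Rightarrow>\<^sub>0 'k"
        unfolding lin_ext_def
      proof (rule sum.neutral, rule ballI)
        fix z assume "z \<in> Poly_Mapping.keys u"
        then have "fst z \<in> V'" "snd z \<in> V'" using that by auto
        then have "fst z v * snd z w = 0" using False by (auto simp: dual_space_def)
        then show "Poly_Mapping.lookup u z * (case z of (f, g) \<Rightarrow> f v * g w) = 0"
          by (simp add: case_prod_unfold)
      qed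
      show ?thesis using zero[OF f_keys] zero[OF g_keys] by simp
    qed
  qed
  then show thesis
    using that[of "E \<times> E" "\<lambda>p. (x (fst p), x (snd p))" c] E(1) x(1) by simp
qed

text \<open>Modulo K the linear part of a shifted relation vanishes, which leaves
  \<open>deg2\<close> of the relator. The relators span \<open>perp\<close> up to
  \<open>tensor_eq\<close>, and \<open>deg2\<close> sends differences of equal tensors into the
  linearity ideal.\<close>

lemma relations_iff:
  assumes K: "ideal K (free_alg V')" and L: "linearity_ideal fun_scale V' \<subseteq> K"
  shows "free_map shift ` {gen [x, y] - deg2 (sigma H G x y) - gen [bracket H x y] | x y. x \<in> \<g> \<and> y \<in> \<g>} \<subseteq> K
    \<longleftrightarrow> deg2 ` perp \<subseteq> K"
proof -
  note closed = free_ideal_closed[OF K] and F = vector_space_formal_scale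
  have lin: "formal_ext (\<lambda>f. gen [f]) (linear_part x y) \<in> K" if "x \<in> \<g>" "y \<in> \<g>" for x y
    using linear_part_in_ideal[OF vector_space_fun_scale subspace_V' keys_linear_part linear_part_zero] that L
    by blast
  have "free_map shift (gen [x, y] - deg2 (sigma H G x y) - gen [bracket H x y]) \<in> K \<longleftrightarrow> deg2 (relator x y) \<in> K"
    if "x \<in> \<g>" "y \<in> \<g>" for x y
    using closed(2)[OF _ lin[OF that]] closed(4)[OF _ lin[OF that]]
    by (metis add_diff_cancel_right' free_map_shift_relation[OF that])
  then have "free_map shift ` {gen [x, y] - deg2 (sigma H G x y) - gen [bracket H x y] | x y. x \<in> \<g> \<and> y \<in> \<g>} \<subseteq> K
    \<longleftrightarrow> (\<forall>x\<in>\<g>. \<forall>y\<in>\<g>. deg2 (relator x y) \<in> K)"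
    by blast
  also have "\<dots> \<longleftrightarrow> deg2 ` perp \<subseteq> K"
  proof
    assume rel: "\<forall>x\<in>\<g>. \<forall>y\<in>\<g>. deg2 (relator x y) \<in> K"
    show "deg2 ` perp \<subseteq> K"
    proof (rule image_subsetI)
      fix f assume "f \<in> perp"
      then show "deg2 f \<in> K"
      proof (rule perp_span)
        fix E :: "('g \<times> 'g) set" and c \<phi>
        assume E: "finite E" "\<forall>p\<in>E. fst (\<phi> p) \<in> \<g> \<and> snd (\<phi> p) \<in> \<g>"
          "tensor_eq fun_scale V' fun_scale V' f (\<Sum>p\<in>E. formal_scale (c p) (relator (fst (\<phi> p)) (snd (\<phi> p))))"
        let ?g = "\<Sum>p\<in>E. formal_scale (c p) (relator (fst (\<phi> p)) (snd (\<phi> p)))"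
        have "deg2 ?g = (\<Sum>p\<in>E. formal_scale (c p) (deg2 (relator (fst (\<phi> p)) (snd (\<phi> p)))))"
          unfolding deg2_def by (simp add: lin_ext_sum[OF F] formal_ext_simps)
        moreover have "\<dots> \<in> K"
          using E(1,2) by (induction E) (auto intro!: closed(1-3) simp: rel)
        moreover have "deg2 f - deg2 ?g \<in> K"
          using deg2_tensor_eq[OF vector_space_fun_scale subspace_V' E(3)] L by blast
        ultimately have "(deg2 f - deg2 ?g) + deg2 ?g \<in> K" by (intro closed(2)) simp_all
        then show ?thesis by simp
      qed
    qed
  qed (use relator_perp in blast)
  finally show ?thesis .
qed

lemma enveloping_algebra_iso:
  "enveloping_algebra H G \<simeq>\<^sub>a\<^sub>l\<^sub>g quadratic_algebra (quadratic_dual (wedge_quad H G))"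
proof -
  have "quadratic_algebra (quadratic_dual (wedge_quad H G)) = tensor_algebra_quot fun_scale V' (deg2 ` perp)"
    by (simp add: quadratic_algebra_def quadratic_dual_def Let_def wedge_quad_def perp_def)
  moreover have "enveloping_algebra H G \<simeq>\<^sub>a\<^sub>l\<^sub>g tensor_algebra_quot fun_scale V' (deg2 ` perp)"
    unfolding enveloping_algebra_def
  proof (rule tensor_algebra_quot_iso[OF vector_space_fun_scale subspace_tangent vector_space_fun_scale
        subspace_V' free_map_shift_iso free_map_shift_linearity _ _ relations_iff])
    have deg2_keys: "Poly_Mapping.keys (deg2 t) \<subseteq> lists A" if "Poly_Mapping.keys t \<subseteq> A \<times> A"
      for t :: "'v \<times> 'v \<Rightarrow>\<^sub>0 'k" and A
      unfolding deg2_def by (rule keys_formal_ext) (use that in auto)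
    show "deg2 ` perp \<subseteq> carrier (free_alg V')"
      by (auto simp: free_alg_def perp_def dest!: deg2_keys)
    have "Poly_Mapping.keys (gen [x, y] - deg2 (sigma H G x y) - gen [bracket H x y]) \<subseteq> lists \<g>"
      if "x \<in> \<g>" "y \<in> \<g>" for x y
      using that sigma(1)[OF that] bracket_in_tangent[OF that]
      by (intro order.trans[OF keys_diff] Un_least deg2_keys) auto
    then show "{gen [x, y] - deg2 (sigma H G x y) - gen [bracket H x y] | x y. x \<in> \<g> \<and> y \<in> \<g>}
        \<subseteq> carrier (free_alg \<g>)"
      by (auto simp: free_alg_def)
  qed
  ultimately show ?thesis by simp
qed

end

theorem theorem4p2:
  fixes H :: "('k::field, 'a::ring_1) hopf_data"
    and G :: "('k, 'a, 'g::ab_group_add) fodc_data"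
  assumes "bicovariant_fodc H G"
    and "finite_dim_fodc H G"
    and "\<exists>\<theta> \<in> bi_inv H G. \<forall>a. diff G a = lact G a \<theta> - ract G \<theta> a"
  shows "enveloping_algebra H G \<simeq>\<^sub>a\<^sub>l\<^sub>g quadratic_algebra (quadratic_dual (wedge_quad H G))"
proof -
  obtain \<theta> where "\<theta> \<in> bi_inv H G" "\<forall>a. diff G a = lact G a \<theta> - ract G \<theta> a"
    using assms(3) by blast
  then interpret fin_inner_fodc H G \<theta>
    using assms(1,2)
    by (simp add: fin_inner_fodc_def fin_inner_fodc_axioms_def inner_fodc_def inner_fodc_axioms_def)
  show ?thesis by (rule enveloping_algebra_iso)
qed

end
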